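(* Let $F$ be a field (containing a square root of $-1$ if $\operatorname{char}(F)\neq 2$). (1) For any tight set $S$ of quadratic $n$-fold Pfister forms over $F$, $\Sigma_S\in I_q^{n+1}F$. (2) If $S$ is strongly tight, then $\Sigma_S=0$.
   Context: $[a,b]$ denotes the quadratic form $ax^2+xy+by^2$. $I_q^1F$ is the group of Witt classes of even-dimensional nonsingular quadratic forms over $F$ under orthogonal sum; it is a module (via tensor product) over the Witt ring of nondegenerate symmetric bilinear forms. Bilinear Pfister forms: $\langle\langle\beta\rangle\rangle=\langle 1,\beta\rangle$ (diagonal form) and $\langle\langle\beta_1,\dots,\beta_m\rangle\rangle=\langle\langle\beta_1\rangle\rangle\otimes\cdots\otimes\langle\langle\beta_m\rangle\rangle$, $\beta_i\in F^\times$. Quadratic Pfister forms: the quadratic 1-fold ones are the nonsingular forms $\langle\langle\alpha]]=[1,\alpha]$; the quadratic $n$-fold ones are $\langle\langle\beta_1,\dots,\beta_{n-1},\alpha]]=\langle\langle\beta_1,\dots,\beta_{n-1}\rangle\rangle\otimes\langle\langle\alpha]]$. $I_q^nF$ is the subgroup of $I_q^1F$ generated by scalar multiples of quadratic $n$-fold Pfister forms. Forms are identified with their Witt classes. A set of quadratic $n$-fold Pfister forms is tight if every element of the subgroup it generates in $I_q^nF/I_q^{n+1}F$ is represented by a quadratic $n$-fold Pfister form (which is then unique up to isometry). It is strongly tight if the subgroup it generates in $I_q^nF$ consists of (Witt classes of) $n$-fold Pfister forms. For a finite tight set $S$ of more than one $n$-fold Pfister form, $\Sigma_S\in I_q^nF$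 is the sum in $I_q^nF$ of the unique $n$-fold Pfister representatives of all the elements of the subgroup generated by the image of $S$ in $I_q^nF/I_q^{n+1}F$; the statement concerns sets for which $\Sigma_S$ is thus defined.
   Formalization: "More than one form" is read as "more than one nonhyperbolic form": for S consisting of the hyperbolic n-fold Pfister form and one nonhyperbolic form φ, Σ_S = φ is not in I_q^{n+1}F, so the claim fails for exactly these sets, which are excluded. *)

theory Defs
  imports "Jordan_Normal_Form.Matrix" "HOL-Algebra.Generated_Groups"
begin

section \<open>Quadratic forms\<close>

text \<open>A square matrix \<open>A\<close> of size \<open>n\<close> stands for the quadratic form \<open>v \<mapsto> v\<^sup>T A v\<close> on \<open>F\<^sup>n\<close>. The matrix
  is not required to be symmetric or triangular, so a form has many matrices; forms are only ever
  compared up to isometry, which refers to their values. The polar form of \<open>A\<close> has Gram matrix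
  \<open>A + A\<^sup>T\<close>, in every characteristic.\<close>

definition qeval :: "'a::field mat \<Rightarrow> 'a vec \<Rightarrow> 'a" where
  "qeval A v = v \<bullet> (A *\<^sub>v v)"

definition nonsingular_form :: "'a::field mat \<Rightarrow> bool" where
  "nonsingular_form A \<longleftrightarrow> square_mat A \<and> invertible_mat (A + transpose_mat A)"

definition isometric :: "'a::field mat \<Rightarrow> 'a mat \<Rightarrow> bool" where
  "isometric A B \<longleftrightarrow> square_mat A \<and> square_mat B \<and> dim_row A = dim_row B \<and>
     (\<exists>P \<in> carrier_mat (dim_row A) (dim_row A). invertible_mat P \<and>
        (\<forall>v \<in> carrier_vec (dim_row A). qeval B (P *\<^sub>v v) = qeval A v))"

definition orth_sum :: "'a::field mat \<Rightarrow> 'a mat \<Rightarrow> 'a mat" where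
  "orth_sum A B = four_block_mat A (0\<^sub>m (dim_row A) (dim_col B)) (0\<^sub>m (dim_row B) (dim_col A)) B"

text \<open>The form \<open>[a, b] = a x\<^sup>2 + x y + b y\<^sup>2\<close>.\<close>

definition binary_form :: "'a::field \<Rightarrow> 'a \<Rightarrow> 'a mat" where
  "binary_form a b = mat_of_rows_list 2 [[a, 1], [0, b]]"

text \<open>The hyperbolic form \<open>(x, y) \<mapsto> x\<^sub>1 y\<^sub>1 + \<dots> + x\<^sub>m y\<^sub>m\<close> of dimension \<open>2 m\<close>.\<close>

definition hyperbolic_form :: "nat \<Rightarrow> 'a::field mat" where
  "hyperbolic_form m = four_block_mat (0\<^sub>m m m) (1\<^sub>m m) (0\<^sub>m m m) (0\<^sub>m m m)"

section \<open>The group of Witt classes\<close>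

definition even_nonsingular_forms :: "'a::field mat set" where
  "even_nonsingular_forms = {A. nonsingular_form A \<and> even (dim_row A)}"

definition witt_equiv :: "'a::field mat \<Rightarrow> 'a mat \<Rightarrow> bool" where
  "witt_equiv A B \<longleftrightarrow>
     (\<exists>m k. isometric (orth_sum A (hyperbolic_form m)) (orth_sum B (hyperbolic_form k)))"

definition witt_class :: "'a::field mat \<Rightarrow> 'a mat set" where
  "witt_class A = {B \<in> even_nonsingular_forms. witt_equiv A B}"

text \<open>\<open>I\<^sub>q\<^sup>1 F\<close>. As always with \<^locale>\<open>comm_group\<close>, it is written multiplicatively: the product is
  induced by the orthogonal sum, and \<open>\<one>\<close> is the zero class, i.e. the class of hyperbolic forms.\<close>

definition Iq1_group :: "'a::field mat set monoid" where
  "Iq1_group =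
     \<lparr>carrier = witt_class ` even_nonsingular_forms,
      mult = (\<lambda>X Y. \<Union>A\<in>X. \<Union>B\<in>Y. witt_class (orth_sum A B)),
      one = witt_class (0\<^sub>m 0 0)\<rparr>"

section \<open>Pfister forms and the groups \<open>I\<^sub>q\<^sup>n F\<close>\<close>

text \<open>The Kronecker product. If \<open>M\<close> is the Gram matrix of a symmetric bilinear form \<open>B\<close> and \<open>A\<close>
  represents the quadratic form \<open>q\<close>, then \<open>kronecker M A\<close> represents \<open>B \<otimes> q\<close>: it sends \<open>v \<otimes> w\<close> to
  \<open>B(v, v) q(w)\<close>, and its polar form has Gram matrix \<open>kronecker M (A + A\<^sup>T)\<close>.\<close>

definition kronecker :: "'a::field mat \<Rightarrow> 'a mat \<Rightarrow> 'a mat" where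
  "kronecker M A = mat (dim_row M * dim_row A) (dim_col M * dim_col A)
     (\<lambda>(i, j). M $$ (i div dim_row A, j div dim_col A) * A $$ (i mod dim_row A, j mod dim_col A))"

text \<open>The Gram matrix of \<open>\<langle>\<langle>\<beta>\<^sub>1, \<dots>, \<beta>\<^sub>m\<rangle>\<rangle>\<close>, where \<open>\<langle>\<langle>\<beta>\<rangle>\<rangle> = \<langle>1, \<beta>\<rangle>\<close> (and not \<open>\<langle>1, -\<beta>\<rangle>\<close>).\<close>

fun bilinear_pfister :: "'a::field list \<Rightarrow> 'a mat" where
  "bilinear_pfister [] = 1\<^sub>m 1"
| "bilinear_pfister (\<beta> # \<beta>s) =
     kronecker (mat_of_rows_list 2 [[1, 0], [0, \<beta>]]) (bilinear_pfister \<beta>s)"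

definition quadratic_pfister :: "'a::field list \<Rightarrow> 'a \<Rightarrow> 'a mat" where
  "quadratic_pfister \<beta>s \<alpha> = kronecker (bilinear_pfister \<beta>s) (binary_form 1 \<alpha>)"

definition pfister_forms :: "nat \<Rightarrow> 'a::field mat set" where
  "pfister_forms n = {quadratic_pfister \<beta>s \<alpha> | \<beta>s \<alpha>.
     Suc (length \<beta>s) = n \<and> 0 \<notin> set \<beta>s \<and> nonsingular_form (binary_form 1 \<alpha>)}"

definition pfister_classes :: "nat \<Rightarrow> 'a::field mat set set" where
  "pfister_classes n = witt_class ` pfister_forms n"

definition Iq :: "nat \<Rightarrow> 'a::field mat set set" where
  "Iq n = generate Iq1_group {witt_class (c \<cdot>\<^sub>m A) | c A. c \<noteq> 0 \<and> A \<in> pfister_forms n}"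

definition Iq_group :: "nat \<Rightarrow> 'a::field mat set monoid" where
  "Iq_group n = Iq1_group\<lparr>carrier := Iq n\<rparr>"

text \<open>The quotient \<open>I\<^sub>q\<^sup>n F / I\<^sub>q\<^sup>n\<^sup>+\<^sup>1 F\<close> and its projection map.\<close>

definition Iq_quot :: "nat \<Rightarrow> 'a::field mat set set monoid" where
  "Iq_quot n = Iq_group n Mod Iq (Suc n)"

definition Iq_proj :: "nat \<Rightarrow> 'a::field mat set \<Rightarrow> 'a mat set set" where
  "Iq_proj n \<phi> = Iq (Suc n) #>\<^bsub>Iq_group n\<^esub> \<phi>"

section \<open>Tight sets\<close>

text \<open>Forms are identified with their Witt classes, so sets of Pfister forms are sets of classes.\<close>

definition generated_mod :: "nat \<Rightarrow> 'a::field mat set set \<Rightarrow> 'a mat set set set" where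
  "generated_mod n S = generate (Iq_quot n) (Iq_proj n ` S)"

definition tight :: "nat \<Rightarrow> 'a::field mat set set \<Rightarrow> bool" where
  "tight n S \<longleftrightarrow> S \<subseteq> pfister_classes n \<and>
     (\<forall>c \<in> generated_mod n S. \<exists>\<phi> \<in> pfister_classes n. Iq_proj n \<phi> = c)"

definition strongly_tight :: "nat \<Rightarrow> 'a::field mat set set \<Rightarrow> bool" where
  "strongly_tight n S \<longleftrightarrow> S \<subseteq> pfister_classes n \<and> generate (Iq_group n) S \<subseteq> pfister_classes n"

definition pfister_representative :: "nat \<Rightarrow> 'a::field mat set set \<Rightarrow> 'a mat set" where
  "pfister_representative n c = (THE \<phi>. \<phi> \<in> pfister_classes n \<and> Iq_proj n \<phi> = c)"

text \<open>The sum \<open>\<Sigma>\<^sub>S\<close>; it appears as a product because of the multiplicative notation. A set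
  \<open>S = {0, \<phi>}\<close> consisting of a nonzero class \<open>\<phi>\<close> and the hyperbolic one has \<open>\<Sigma>\<^sub>S = \<phi>\<close>, just as
  \<open>S = {\<phi>}\<close> has; hence a set with more than one form is understood as one with more than one
  nonhyperbolic form in statements about \<open>\<Sigma>\<^sub>S\<close>.\<close>

definition Sigma_inv :: "nat \<Rightarrow> 'a::field mat set set \<Rightarrow> 'a mat set" where
  "Sigma_inv n S = finprod (Iq_group n) (pfister_representative n) (generated_mod n S)"

end

theory Submission
  imports Defs "HOL-Algebra.Algebraic_Closure_Type" "HOL-Library.Poly_Mapping"
    "HOL-Computational_Algebra.Fraction_Field" "Jordan_Normal_Form.Determinant"
begin

text \<open>Since \<open>-1\<close> is a square, \<open>q \<bottom> q\<close> is isometric to the hyperbolic form \<open>q \<bottom> -q\<close>, so every Witt class is its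
  own inverse. The key point is that a class of \<open>I\<^sub>q\<^sup>n F / I\<^sub>q\<^sup>n\<^sup>+\<^sup>1 F\<close> has at most one Pfister representative. If
  \<open>\<phi>\<close> and \<open>\<psi>\<close> both represent it, the \<open>2\<^sup>n\<^sup>+\<^sup>1\<close>-dimensional form \<open>\<phi> \<bottom> \<psi>\<close>, which is isotropic, becomes hyperbolic
  after adding scaled \<open>(n+1)\<close>-fold Pfister forms. As in the Hauptsatz of Arason and Pfister, one passes to
  the function fields of these, one after the other, where they become hyperbolic; by the subform theorem,
  a form whose anisotropic part is smaller than theirs is hyperbolic over such a function field only if it
  already is over the ground field. All these fields live inside one algebraically closed field of infinite
  transcendence degree.

  Now \<open>\<Sigma>\<^sub>S\<close> is modulo \<open>I\<^sub>q\<^sup>n\<^sup>+\<^sup>1 F\<close> the sum of all elements of a finite group of exponent two; this group has more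
  than two elements since distinct Pfister forms stay distinct modulo \<open>I\<^sub>q\<^sup>n\<^sup>+\<^sup>1 F\<close>, so the sum is zero. If \<open>S\<close> is
  strongly tight, the same applies in \<open>I\<^sub>q\<^sup>n F\<close> itself.\<close>

section \<open>Quadratic forms over subfields\<close>

text \<open>The dimension count is borderline: \<phi> \<bottom> \<psi> has exactly the dimension of
  the forms that are to be removed, so size alone decides nothing. One isotropic vector settles it:
  both forms represent 1, and 1 + i^2 = 0; once the corresponding plane is split off, what remains
  is strictly smaller. A generic zero is enough to make a Pfister form hyperbolic because Pfister
  forms are round. The subform theorem itself is about generic values: a form q that becomes
  hyperbolic over the function field of C represents a multiple of C(t) for independent variables t,
  and the Cassels--Pfister theorem turns this single equation into vectors over the ground field.
  Characteristic two shapes the arguments: matrices are never symmetrised, only values and polar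
  values are compared, and vectors are moved by the reflections v - (b(v, z) / q(z)) z, which do not
  divide by two. The bound on the size of the group cannot be dropped from the last step, since the
  elements of a group of order two add up to its nonzero element.\<close>

locale subfld =
  fixes L :: "'u::field set"
  assumes one_mem: "1 \<in> L"
    and diff_mem: "a \<in> L \<Longrightarrow> b \<in> L \<Longrightarrow> a - b \<in> L"
    and mult_mem: "a \<in> L \<Longrightarrow> b \<in> L \<Longrightarrow> a * b \<in> L"
    and inverse_mem: "a \<in> L \<Longrightarrow> inverse a \<in> L"
begin

lemma zero_mem: "0 \<in> L"
  using diff_mem[OF one_mem one_mem] by simp

lemma uminus_mem: "a \<in> L \<Longrightarrow> - a \<in> L"
  using diff_mem[OF zero_mem, of a] by simp

lemma add_mem: "a \<in> L \<Longrightarrow> b \<in> L \<Longrightarrow> a + b \<in> L"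
  using diff_mem[of a "- b"] uminus_mem[of b] by simp

lemma divide_mem: "a \<in> L \<Longrightarrow> b \<in> L \<Longrightarrow> a / b \<in> L"
  by (simp add: divide_inverse mult_mem inverse_mem)

lemma power_mem: "a \<in> L \<Longrightarrow> a ^ n \<in> L"
  by (induction n) (auto intro: one_mem mult_mem)

lemma sum_mem: "(\<And>i. i \<in> I \<Longrightarrow> f i \<in> L) \<Longrightarrow> sum f I \<in> L"
  by (induction I rule: infinite_finite_induct) (auto intro: zero_mem add_mem)

lemmas mems = zero_mem one_mem diff_mem mult_mem inverse_mem uminus_mem add_mem divide_mem
  power_mem sum_mem

end

lemma subfld_UNIV: "subfld UNIV"
  by unfold_locales auto

text \<open>All fields are subfields \<open>L\<close> of the field \<open>'u\<close>, so that extending scalars is just an inclusion of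
  sets. A vector over \<open>L\<close> with index set \<open>I\<close> is a function that vanishes outside \<open>I\<close>, and \<open>bf\<close> is the
  polar form of \<open>qf\<close>. For nonsingular forms, \<open>hyp\<close> is hyperbolicity.\<close>

definition cvec :: "'u::zero set \<Rightarrow> 'i set \<Rightarrow> ('i \<Rightarrow> 'u) set" where
  "cvec L I = {v. (\<forall>i\<in>I. v i \<in> L) \<and> (\<forall>i. i \<notin> I \<longrightarrow> v i = 0)}"

definition qf :: "'i set \<Rightarrow> ('i \<Rightarrow> 'i \<Rightarrow> 'u::comm_ring_1) \<Rightarrow> ('i \<Rightarrow> 'u) \<Rightarrow> 'u" where
  "qf I A v = (\<Sum>i\<in>I. \<Sum>j\<in>I. A i j * v i * v j)"

definition bf :: "'i set \<Rightarrow> ('i \<Rightarrow> 'i \<Rightarrow> 'u::comm_ring_1) \<Rightarrow> ('i \<Rightarrow> 'u) \<Rightarrow> ('i \<Rightarrow> 'u) \<Rightarrow> 'u" where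
  "bf I A v w = (\<Sum>i\<in>I. \<Sum>j\<in>I. A i j * (v i * w j + w i * v j))"

definition lsub :: "'u::comm_ring_1 set \<Rightarrow> ('i \<Rightarrow> 'u) set \<Rightarrow> bool" where
  "lsub L V \<longleftrightarrow> (\<lambda>_. 0) \<in> V \<and> (\<forall>v\<in>V. \<forall>w\<in>V. \<forall>c\<in>L. (\<lambda>i. v i + c * w i) \<in> V)"

definition lfun :: "'u::comm_ring_1 set \<Rightarrow> ('i \<Rightarrow> 'u) set \<Rightarrow> (('i \<Rightarrow> 'u) \<Rightarrow> 'u) \<Rightarrow> bool" where
  "lfun L V f \<longleftrightarrow> (\<forall>v\<in>V. f v \<in> L) \<and>
     (\<forall>v\<in>V. \<forall>w\<in>V. \<forall>c\<in>L. f (\<lambda>i. v i + c * w i) = f v + c * f w)"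

definition lmap :: "'u::comm_ring_1 set \<Rightarrow> ('i \<Rightarrow> 'u) set \<Rightarrow> ('j \<Rightarrow> 'u) set
    \<Rightarrow> (('i \<Rightarrow> 'u) \<Rightarrow> ('j \<Rightarrow> 'u)) \<Rightarrow> bool" where
  "lmap L V Y f \<longleftrightarrow> (\<forall>v\<in>V. f v \<in> Y) \<and>
     (\<forall>v\<in>V. \<forall>w\<in>V. \<forall>c\<in>L. f (\<lambda>i. v i + c * w i) = (\<lambda>i. f v i + c * f w i))"

text \<open>A substitute for ``dimension at least \<open>m\<close>'' that needs no bases.\<close>

definition dimge :: "'u::comm_ring_1 set \<Rightarrow> ('i \<Rightarrow> 'u) set \<Rightarrow> nat \<Rightarrow> bool" where
  "dimge L V m \<longleftrightarrow> (\<forall>Fs. finite Fs \<and> card Fs < m \<and> (\<forall>f\<in>Fs. lfun L V f) \<longrightarrow>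
     (\<exists>v\<in>V. v \<noteq> (\<lambda>_. 0) \<and> (\<forall>f\<in>Fs. f v = 0)))"

definition aniso :: "'u::comm_ring_1 set \<Rightarrow> 'i set \<Rightarrow> ('i \<Rightarrow> 'i \<Rightarrow> 'u) \<Rightarrow> bool" where
  "aniso L I A \<longleftrightarrow> (\<forall>v\<in>cvec L I. qf I A v = 0 \<longrightarrow> v = (\<lambda>_. 0))"

definition nonsing :: "'u::comm_ring_1 set \<Rightarrow> 'i set \<Rightarrow> ('i \<Rightarrow> 'i \<Rightarrow> 'u) \<Rightarrow> bool" where
  "nonsing L I A \<longleftrightarrow> (\<forall>v\<in>cvec L I. (\<forall>w\<in>cvec L I. bf I A v w = 0) \<longrightarrow> v = (\<lambda>_. 0))"

definition hyp :: "'u::comm_ring_1 set \<Rightarrow> 'i set \<Rightarrow> ('i \<Rightarrow> 'i \<Rightarrow> 'u) \<Rightarrow> bool" where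
  "hyp L I A \<longleftrightarrow> (\<exists>W m. W \<subseteq> cvec L I \<and> lsub L W \<and> (\<forall>v\<in>W. qf I A v = 0) \<and>
     card I \<le> 2 * m \<and> dimge L W m)"

definition unitv :: "'i \<Rightarrow> 'i \<Rightarrow> 'u::zero_neq_one" where
  "unitv k = (\<lambda>i. if i = k then 1 else 0)"

section \<open>Calculus of quadratic and polar forms\<close>

lemma qf_comb: "qf I A (\<lambda>i. v i + c * w i) = qf I A v + c * bf I A v w + c\<^sup>2 * qf I A w"
  unfolding qf_def bf_def
  by (simp add: sum_distrib_left sum.distrib[symmetric] algebra_simps power2_eq_square)

lemma bf_comb_right: "bf I A v (\<lambda>i. w i + c * u i) = bf I A v w + c * bf I A v u"
  unfolding bf_def by (simp add: sum_distrib_left sum.distrib[symmetric] algebra_simps)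

lemma bf_commute: "bf I A v w = bf I A w v"
  unfolding bf_def by (simp add: algebra_simps)

lemma bf_comb_left: "bf I A (\<lambda>i. w i + c * u i) v = bf I A w v + c * bf I A u v"
  using bf_comb_right bf_commute by metis

lemma bf_self: "bf I A v v = 2 * qf I A v"
  unfolding bf_def qf_def by (simp add: sum_distrib_left algebra_simps)

lemma qf_scale: "qf I A (\<lambda>i. c * w i) = c\<^sup>2 * qf I A w"
  unfolding qf_def by (simp add: sum_distrib_left algebra_simps power2_eq_square)

lemma bf_scale_left: "bf I A (\<lambda>i. c * w i) v = c * bf I A w v"
  unfolding bf_def by (simp add: sum_distrib_left algebra_simps)

lemma qf_zero [simp]: "qf I A (\<lambda>_. 0) = 0"
  by (simp add: qf_def)

lemma bf_zero [simp]: "bf I A (\<lambda>_. 0) v = 0" "bf I A v (\<lambda>_. 0) = 0"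
  by (simp_all add: bf_def)

lemma qf_cong:
  "(\<And>i j. i \<in> I \<Longrightarrow> j \<in> I \<Longrightarrow> A i j = A' i j) \<Longrightarrow> (\<And>i. i \<in> I \<Longrightarrow> v i = v' i) \<Longrightarrow> qf I A v = qf I A' v'"
  unfolding qf_def by (intro sum.cong) auto

lemma bf_cong:
  "(\<And>i j. i \<in> I \<Longrightarrow> j \<in> I \<Longrightarrow> A i j = A' i j) \<Longrightarrow> (\<And>i. i \<in> I \<Longrightarrow> v i = v' i) \<Longrightarrow>
   (\<And>i. i \<in> I \<Longrightarrow> w i = w' i) \<Longrightarrow> bf I A v w = bf I A' v' w'"
  unfolding bf_def by (intro sum.cong) auto

lemma hyp_cong:
  assumes "\<And>i j. i \<in> I \<Longrightarrow> j \<in> I \<Longrightarrow> A i j = A' i j" "hyp L I A"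
  shows "hyp L I A'"
proof -
  have "qf I A v = qf I A' v" for v by (rule qf_cong) (auto simp: assms(1))
  thus ?thesis using assms(2) unfolding hyp_def by simp
qed

lemma cvec_mono: "L \<subseteq> L' \<Longrightarrow> cvec L I \<subseteq> cvec L' I"
  unfolding cvec_def by auto

lemma (in subfld) cvec_mono_index: "I \<subseteq> J \<Longrightarrow> cvec L I \<subseteq> cvec L J"
  unfolding cvec_def using zero_mem by fastforce

lemma (in subfld) unitv_cvec: "k \<in> I \<Longrightarrow> unitv k \<in> cvec L I"
  unfolding unitv_def cvec_def using zero_mem one_mem by auto

lemma (in subfld) zero_cvec: "(\<lambda>_. 0) \<in> cvec L I"
  unfolding cvec_def using zero_mem by auto

lemma (in subfld) comb_cvec: "v \<in> cvec L I \<Longrightarrow> w \<in> cvec L I \<Longrightarrow> c \<in> L \<Longrightarrow> (\<lambda>i. v i + c * w i) \<in> cvec L I"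
  unfolding cvec_def using mems by auto

lemma (in subfld) scale_cvec: "w \<in> cvec L I \<Longrightarrow> c \<in> L \<Longrightarrow> (\<lambda>i. c * w i) \<in> cvec L I"
  unfolding cvec_def using mems by auto

lemma (in subfld) lsub_cvec: "lsub L (cvec L I)"
  unfolding lsub_def using zero_cvec comb_cvec by auto

lemma (in subfld) qf_mem: "\<forall>i\<in>I. \<forall>j\<in>I. A i j \<in> L \<Longrightarrow> v \<in> cvec L I \<Longrightarrow> qf I A v \<in> L"
  unfolding qf_def cvec_def by (auto intro!: mems)

lemma (in subfld) bf_mem:
  "\<forall>i\<in>I. \<forall>j\<in>I. A i j \<in> L \<Longrightarrow> v \<in> cvec L I \<Longrightarrow> w \<in> cvec L I \<Longrightarrow> bf I A v w \<in> L"
  unfolding bf_def cvec_def by (auto intro!: mems)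

lemma (in subfld) lfun_coord: "V \<subseteq> cvec L I \<Longrightarrow> lfun L V (\<lambda>v. v i)"
  unfolding lfun_def cvec_def using zero_mem by (cases "i \<in> I") auto

lemma (in subfld) lfun_bf:
  "\<forall>i\<in>I. \<forall>j\<in>I. A i j \<in> L \<Longrightarrow> V \<subseteq> cvec L I \<Longrightarrow> w \<in> cvec L I \<Longrightarrow> lfun L V (\<lambda>v. bf I A v w)"
  unfolding lfun_def by (auto simp: bf_comb_left subset_iff intro!: bf_mem)

section \<open>Linear subspaces, functionals and maps\<close>

lemma lsubD:
  assumes "lsub L V"
  shows "(\<lambda>_. 0) \<in> V" "v \<in> V \<Longrightarrow> w \<in> V \<Longrightarrow> c \<in> L \<Longrightarrow> (\<lambda>i. v i + c * w i) \<in> V"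
  using assms unfolding lsub_def by simp_all

lemma lfunD:
  assumes "lfun L V f" "v \<in> V"
  shows "f v \<in> L" "w \<in> V \<Longrightarrow> c \<in> L \<Longrightarrow> f (\<lambda>i. v i + c * w i) = f v + c * f w"
  using assms unfolding lfun_def by simp_all

lemma lmapD:
  assumes "lmap L V Y f" "v \<in> V"
  shows "f v \<in> Y" "w \<in> V \<Longrightarrow> c \<in> L \<Longrightarrow> f (\<lambda>i. v i + c * w i) = (\<lambda>i. f v i + c * f w i)"
  using assms unfolding lmap_def by simp_all

lemma lfun_subset: "lfun L V f \<Longrightarrow> Y \<subseteq> V \<Longrightarrow> lfun L Y f"
  unfolding lfun_def by blast

lemma lfun_comp_lmap: "lfun L Y f \<Longrightarrow> lmap L V Y T \<Longrightarrow> lfun L V (f \<circ> T)"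
  unfolding lfun_def lmap_def by auto

lemma lsub_scale: "lsub L V \<Longrightarrow> v \<in> V \<Longrightarrow> c \<in> L \<Longrightarrow> (\<lambda>i. c * v i) \<in> V"
proof -
  assume a: "lsub L V" "v \<in> V" "c \<in> L"
  have "(\<lambda>i. (\<lambda>_. 0) i + c * v i) \<in> V" by (rule lsubD(2)) (use a lsubD(1) in auto)
  thus ?thesis by simp
qed

lemma lmap_zero: "lmap L V Y f \<Longrightarrow> 1 \<in> L \<Longrightarrow> (\<lambda>_. 0) \<in> V \<Longrightarrow> f (\<lambda>_. 0) = (\<lambda>_. 0)"
proof -
  assume a: "lmap L V Y f" "1 \<in> L" "(\<lambda>_. 0) \<in> V"
  show ?thesis using lmapD(2)[OF a(1,3,3,2)] by (simp add: fun_eq_iff)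
qed

lemma lfun_zero: "lfun L V f \<Longrightarrow> 1 \<in> L \<Longrightarrow> (\<lambda>_. 0) \<in> V \<Longrightarrow> f (\<lambda>_. 0) = 0"
proof -
  assume a: "lfun L V f" "1 \<in> L" "(\<lambda>_. 0) \<in> V"
  show ?thesis using lfunD(2)[OF a(1,3,3,2)] by simp
qed

lemma lsub_image:
  assumes "lsub L V" "lmap L V Y T" "1 \<in> L"
  shows "lsub L (T ` V)"
  unfolding lsub_def
proof (intro conjI ballI)
  have "(\<lambda>_. 0) \<in> V" using assms(1) unfolding lsub_def by blast
  thus "(\<lambda>_. 0) \<in> T ` V" using lmap_zero[OF assms(2,3)] by force
next
  fix v w c assume "v \<in> T ` V" "w \<in> T ` V" and c: "c \<in> L"
  then obtain v' w' where v: "v' \<in> V" "w' \<in> V" "v = T v'" "w = T w'" by blast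
  have "(\<lambda>i. v' i + c * w' i) \<in> V" using lsubD(2)[OF assms(1) v(1,2) c] .
  moreover have "T (\<lambda>i. v' i + c * w' i) = (\<lambda>i. v i + c * w i)"
    unfolding v(3,4) using lmapD(2)[OF assms(2) v(1,2) c] .
  ultimately show "(\<lambda>i. v i + c * w i) \<in> T ` V" using imageI[of _ V T] by metis
qed

section \<open>Dimension measured by linear conditions\<close>

lemma dimgeI:
  "(\<And>Fs. finite Fs \<Longrightarrow> card Fs < m \<Longrightarrow> (\<And>f. f \<in> Fs \<Longrightarrow> lfun L V f) \<Longrightarrow>
     \<exists>v\<in>V. v \<noteq> (\<lambda>_. 0) \<and> (\<forall>f\<in>Fs. f v = 0)) \<Longrightarrow> dimge L V m"
  unfolding dimge_def by blast

lemma dimgeD: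
  assumes "dimge L V m" "finite Fs" "card Fs < m" "\<And>f. f \<in> Fs \<Longrightarrow> lfun L V f"
  obtains v where "v \<in> V" "v \<noteq> (\<lambda>_. 0)" "\<forall>f\<in>Fs. f v = 0"
  using assms unfolding dimge_def by blast

lemma dimge_mono: "dimge L V m \<Longrightarrow> k \<le> m \<Longrightarrow> dimge L V k"
  unfolding dimge_def by fastforce

text \<open>Conditions on the image are pulled back along \<open>T\<close>. Different functionals
  may coincide after composition with \<open>T\<close>, which only lowers their number.\<close>

lemma dimge_image:
  assumes "dimge L V m" "lmap L V Y T" "\<And>v. v \<in> V \<Longrightarrow> T v = (\<lambda>_. 0) \<Longrightarrow> v = (\<lambda>_. 0)"
  shows "dimge L (T ` V) m"
proof (rule dimgeI)
  fix Fs assume Fs: "finite Fs" "card Fs < m" "\<And>f. f \<in> Fs \<Longrightarrow> lfun L (T ` V) f"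
  have "lmap L V (T ` V) T" using assms(2) unfolding lmap_def by auto
  hence "\<And>g. g \<in> (\<lambda>f. f \<circ> T) ` Fs \<Longrightarrow> lfun L V g"
    using Fs(3) lfun_comp_lmap by blast
  moreover have "card ((\<lambda>f. f \<circ> T) ` Fs) < m" using Fs card_image_le le_less_trans by blast
  ultimately obtain v where "v \<in> V" "v \<noteq> (\<lambda>_. 0)" "\<forall>f\<in>(\<lambda>f. f \<circ> T) ` Fs. f v = 0"
    using dimgeD[OF assms(1) finite_imageI[OF Fs(1), of "\<lambda>f. f \<circ> T"]] by blast
  thus "\<exists>v\<in>T ` V. v \<noteq> (\<lambda>_. 0) \<and> (\<forall>f\<in>Fs. f v = 0)"
    using assms(3) by (intro bexI[of _ "T v"]) auto
qed

text \<open>One equation is solved for a coordinate, which is then eliminated from the other equations.\<close>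

lemma (in subfld) dimge_cvec:
  assumes "finite I"
  shows "dimge L (cvec L I) (card I)"
proof -
  have "\<forall>I. finite I \<and> card Fs < card I \<and> (\<forall>f\<in>Fs. lfun L (cvec L I) f) \<longrightarrow>
     (\<exists>v\<in>cvec L I. v \<noteq> (\<lambda>_. 0) \<and> (\<forall>f\<in>Fs. f v = 0))" if "finite Fs" for Fs :: "(('a \<Rightarrow> 'u) \<Rightarrow> 'u) set"
  proof -
    have "\<forall>Fs :: (('a \<Rightarrow> 'u) \<Rightarrow> 'u) set. finite Fs \<longrightarrow> card Fs \<le> k \<longrightarrow> (\<forall>I. finite I \<and> k < card I \<and> (\<forall>f\<in>Fs. lfun L (cvec L I) f) \<longrightarrow>
     (\<exists>v\<in>cvec L I. v \<noteq> (\<lambda>_. 0) \<and> (\<forall>f\<in>Fs. f v = 0)))" for k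
    proof (induction k)
      case 0
      show ?case
      proof (intro allI impI)
        fix Fs :: "(('a \<Rightarrow> 'u) \<Rightarrow> 'u) set" and I :: "'a set"
        assume Fs: "finite Fs" "card Fs \<le> 0" and I: "finite I \<and> 0 < card I \<and> (\<forall>f\<in>Fs. lfun L (cvec L I) f)"
        then obtain k where "k \<in> I" by (metis card.empty ex_in_conv less_irrefl)
        moreover have "Fs = {}" using Fs by simp
        ultimately show "\<exists>v\<in>cvec L I. v \<noteq> (\<lambda>_. 0) \<and> (\<forall>f\<in>Fs. f v = 0)"
          using unitv_cvec[of k I] by (intro bexI[of _ "unitv k"]) (auto simp: unitv_def fun_eq_iff)
      qed
    next
      case (Suc k)
      show ?case
      proof (intro allI impI)
        fix Fs :: "(('a \<Rightarrow> 'u) \<Rightarrow> 'u) set" and I :: "'a set"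
        assume Fs: "finite Fs" "card Fs \<le> Suc k"
          and I: "finite I \<and> Suc k < card I \<and> (\<forall>f\<in>Fs. lfun L (cvec L I) f)"
        show "\<exists>v\<in>cvec L I. v \<noteq> (\<lambda>_. 0) \<and> (\<forall>f\<in>Fs. f v = 0)"
        proof (cases "\<exists>g\<in>Fs. \<exists>u\<in>I. g (unitv u) \<noteq> 0")
          case False
          hence F0: "\<And>g u. g \<in> Fs \<Longrightarrow> u \<in> I \<Longrightarrow> g (unitv u) = 0" by blast
          obtain u where u: "u \<in> I" using I by (metis card.empty ex_in_conv less_zeroE)
          show ?thesis using F0 u unitv_cvec[OF u]
            by (intro bexI[of _ "unitv u"]) (auto simp: unitv_def fun_eq_iff)
        next
          case True
          then obtain g u where g: "g \<in> Fs" "u \<in> I" "g (unitv u) \<noteq> 0" by blast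
          define J where "J = I - {u}"
          define T where "T = (\<lambda>v :: 'a \<Rightarrow> 'u. \<lambda>i. v i + (- g v / g (unitv u)) * unitv u i)"
          have JI: "cvec L J \<subseteq> cvec L I" by (rule cvec_mono_index) (auto simp: J_def)
          have lg: "lfun L (cvec L I) g" using I g by blast
          have T_in: "T v \<in> cvec L I" if "v \<in> cvec L I" for v
            unfolding T_def using that lg g unitv_cvec[of u I]
            by (intro comb_cvec) (auto simp: lfun_def intro!: mems)
          have gl: "g (\<lambda>i. v i + c * w i) = g v + c * g w" if "v \<in> cvec L I" "w \<in> cvec L I" "c \<in> L" for v w c
            using lfunD(2)[OF lg that] .
          have T_map: "lmap L (cvec L J) (cvec L I) T"
            unfolding lmap_def
          proof (intro conjI ballI)
            fix v w c assume v: "v \<in> cvec L J" "w \<in> cvec L J" "c \<in> L"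
            show "T (\<lambda>i. v i + c * w i) = (\<lambda>i. T v i + c * T w i)"
              by (rule ext) (use g(3) in \<open>simp add: T_def gl[OF subsetD[OF JI v(1)] subsetD[OF JI v(2)] v(3)] field_simps\<close>)
          qed (use T_in JI in auto)
          have gT: "g (T v) = 0" if "v \<in> cvec L I" for v
          proof -
            have "g v \<in> L" "g (unitv u) \<in> L" using lg that unitv_cvec[of u I] g unfolding lfun_def by auto
            hence "- g v / g (unitv u) \<in> L" by (intro mems)
            thus ?thesis unfolding T_def using gl[OF that unitv_cvec, of u "- g v / g (unitv u)"] g by simp
          qed
          have "finite ((\<lambda>f. f \<circ> T) ` (Fs - {g}))" using Fs by auto
          moreover have "card ((\<lambda>f. f \<circ> T) ` (Fs - {g})) \<le> k"
            using card_image_le[of "Fs - {g}" "\<lambda>f. f \<circ> T"] Fs g by auto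
          moreover have "finite J" "k < card J" using I g by (auto simp: J_def)
          moreover have "\<forall>f\<in>(\<lambda>f. f \<circ> T) ` (Fs - {g}). lfun L (cvec L J) f"
            using I lfun_comp_lmap[OF _ T_map] by blast
          ultimately obtain v where v: "v \<in> cvec L J" "v \<noteq> (\<lambda>_. 0)" "\<forall>f\<in>(\<lambda>f. f \<circ> T) ` (Fs - {g}). f v = 0"
            using Suc.IH by blast
          have "T v \<noteq> (\<lambda>_. 0)"
          proof
            assume a: "T v = (\<lambda>_. 0)"
            have "v i = 0" for i
              using v(1) fun_cong[OF a, of i] by (cases "i = u") (auto simp: T_def unitv_def J_def cvec_def)
            thus False using v(2) by auto
          qed
          moreover have "f (T v) = 0" if "f \<in> Fs" for f
            using v(3) gT[of v] v(1) JI that by (cases "f = g") auto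
          ultimately show ?thesis using T_in[of v] v(1) JI by blast
        qed
      qed
    qed
    thus ?thesis using that by blast
  qed
  thus ?thesis using assms unfolding dimge_def by blast
qed

text \<open>A totally isotropic subspace of half dimension is carried along by any injective linear
  map that preserves isotropy of vectors; the bound on \<open>card J\<close> keeps it of half
  dimension.\<close>

lemma hyp_transport:
  assumes "hyp L I A" "lmap L (cvec L I) (cvec L J) T" "1 \<in> L" "0 \<in> L"
    and inj: "\<And>v. v \<in> cvec L I \<Longrightarrow> T v = (\<lambda>_. 0) \<Longrightarrow> v = (\<lambda>_. 0)"
    and q: "\<And>v. v \<in> cvec L I \<Longrightarrow> qf I A v = 0 \<Longrightarrow> qf J B (T v) = 0"
    and c: "card J \<le> card I"
  shows "hyp L J B"
proof -
  obtain W m where W: "W \<subseteq> cvec L I" "lsub L W" "\<forall>v\<in>W. qf I A v = 0" "card I \<le> 2 * m" "dimge L W m"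
    using assms(1) unfolding hyp_def by blast
  have T: "lmap L W (cvec L J) T" using assms(2) W(1) unfolding lmap_def by blast
  have "dimge L (T ` W) m" using dimge_image[OF W(5) T] inj W(1) by blast
  moreover have "lsub L (T ` W)" using lsub_image[OF W(2) T assms(3)] .
  moreover have "T ` W \<subseteq> cvec L J" using T unfolding lmap_def by blast
  ultimately show ?thesis using W q c unfolding hyp_def
    by (intro exI[of _ "T ` W"] exI[of _ m]) auto
qed

section \<open>Splitting off hyperbolic planes\<close>

text \<open>The coefficients of the linear form \<open>bf I A _ e\<close>. They turn orthogonality
  to \<open>e\<close> into one explicit equation between coordinates.\<close>

definition beta :: "'i set \<Rightarrow> ('i \<Rightarrow> 'i \<Rightarrow> 'u::comm_ring_1) \<Rightarrow> ('i \<Rightarrow> 'u) \<Rightarrow> 'i \<Rightarrow> 'u" where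
  "beta I A e k = (\<Sum>l\<in>I. (A k l + A l k) * e l)"

lemma bf_expand: "bf I A v e = (\<Sum>k\<in>I. v k * beta I A e k)"
proof -
  have "bf I A v e = (\<Sum>i\<in>I. \<Sum>j\<in>I. A i j * v i * e j) + (\<Sum>i\<in>I. \<Sum>j\<in>I. A i j * e i * v j)"
    unfolding bf_def by (simp add: sum.distrib[symmetric] algebra_simps)
  also have "(\<Sum>i\<in>I. \<Sum>j\<in>I. A i j * e i * v j) = (\<Sum>j\<in>I. \<Sum>i\<in>I. A i j * e i * v j)"
    by (rule sum.swap)
  finally show ?thesis
    unfolding beta_def by (simp add: sum_distrib_left sum.distrib[symmetric] algebra_simps)
qed

lemma bf_unitv: "finite I \<Longrightarrow> k \<in> I \<Longrightarrow> bf I A (unitv k) e = beta I A e k"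
  unfolding bf_expand by (simp add: unitv_def if_distrib[of "\<lambda>x. x * _"] cong: if_cong)

lemma qf_unitv: "finite I \<Longrightarrow> k \<in> I \<Longrightarrow> qf I A (unitv k) = A k k"
  unfolding qf_def by (simp add: unitv_def if_distrib[of "\<lambda>x. _ * x"] cong: if_cong)

lemma bf_polar: "bf I A v w = qf I A (\<lambda>i. v i + 1 * w i) - qf I A v - qf I A w"
  using qf_comb[of I A v 1 w] by simp

text \<open>The polar form vanishes at \<open>(e, e)\<close>. If \<open>beta\<close> vanished at all
  indices other than \<open>i\<close>, the expansion of this value would force it to vanish at
  \<open>i\<close> too, and \<open>e\<close> would lie in the radical. Two different indices are
  wanted because two variables are going to be eliminated.\<close>

lemma (in subfld) nonsing_isotropic_coordinates:
  assumes "finite I" "nonsing L I A" "e \<in> cvec L I" "e \<noteq> (\<lambda>_. 0)" "qf I A e = 0"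
  obtains i j where "i \<in> I" "j \<in> I" "i \<noteq> j" "e i \<noteq> 0" "beta I A e j \<noteq> 0"
proof -
  obtain i where i: "e i \<noteq> 0" using assms(4) by auto
  hence iI: "i \<in> I" using assms(3) unfolding cvec_def by auto
  have "\<exists>j\<in>I. j \<noteq> i \<and> beta I A e j \<noteq> 0"
  proof (rule ccontr)
    assume "\<not> ?thesis"
    hence b: "\<And>j. j \<in> I \<Longrightarrow> j \<noteq> i \<Longrightarrow> beta I A e j = 0" by blast
    have "0 = bf I A e e" using bf_self[of I A e] assms(5) by simp
    also have "\<dots> = (\<Sum>k\<in>I. if k = i then e i * beta I A e i else 0)"
      unfolding bf_expand by (intro sum.cong) (auto simp: b)
    also have "\<dots> = e i * beta I A e i" using iI assms(1) by simp
    finally have "beta I A e i = 0" using i by simp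
    hence b': "\<And>j. j \<in> I \<Longrightarrow> beta I A e j = 0" using b by (metis)
    have "bf I A e w = 0" for w
      using bf_expand[of I A w e] b' bf_commute[of I A e w] by simp
    thus False using assms(2-4) unfolding nonsing_def by blast
  qed
  thus ?thesis using that iI i by blast
qed

lemma lsub_ker:
  assumes "lsub L V" "lfun L V g" "1 \<in> L"
  shows "lsub L {v \<in> V. g v = 0}"
proof -
  have "g (\<lambda>_. 0) = 0" using lfun_zero[OF assms(2,3)] assms(1) unfolding lsub_def by blast
  thus ?thesis using lsubD[OF assms(1)] lfunD(2)[OF assms(2)] unfolding lsub_def by auto
qed

text \<open>If \<open>g x\<close> is nonzero, then projecting along \<open>x\<close> onto the kernel
  extends every functional on the kernel to all of \<open>V\<close>. Adding \<open>g\<close> itself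
  to the list costs one condition and forces the vector that is found into the kernel, where the
  projection is the identity.\<close>

lemma (in subfld) dimge_ker:
  assumes V: "lsub L V" "dimge L V m" and g: "lfun L V g"
  shows "dimge L {v \<in> V. g v = 0} (m - 1)"
proof (cases "\<exists>x\<in>V. g x \<noteq> 0")
  case False
  hence "{v \<in> V. g v = 0} = V" by blast
  thus ?thesis using dimge_mono[OF V(2)] by simp
next
  case True
  then obtain x where x: "x \<in> V" "g x \<noteq> 0" by blast
  define T where "T = (\<lambda>v. \<lambda>i. v i + (- g v / g x) * x i)"
  have gl: "g (\<lambda>i. v i + c * w i) = g v + c * g w" if "v \<in> V" "w \<in> V" "c \<in> L" for v w c
    using lfunD(2)[OF g that] .
  have gm: "g v \<in> L" if "v \<in> V" for v using g that unfolding lfun_def by blast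
  have cm: "- g v / g x \<in> L" if "v \<in> V" for v
    using gm[OF that] gm[OF x(1)] by (intro mems)
  have TV: "T v \<in> {v \<in> V. g v = 0}" if "v \<in> V" for v
    unfolding T_def using gl[OF that x(1) cm[OF that]] lsubD(2)[OF V(1) that x(1) cm[OF that]] x(2) by auto
  have T: "lmap L V {v \<in> V. g v = 0} T"
    unfolding lmap_def
  proof (intro conjI ballI)
    fix v w c assume v: "v \<in> V" "w \<in> V" "c \<in> L"
    show "T (\<lambda>i. v i + c * w i) = (\<lambda>i. T v i + c * T w i)"
      by (rule ext) (use x(2) in \<open>simp add: T_def gl[OF v] field_simps\<close>)
  qed (use TV in auto)
  show ?thesis
  proof (rule dimgeI)
    fix Fs assume Fs: "finite Fs" "card Fs < m - 1" "\<And>f. f \<in> Fs \<Longrightarrow> lfun L {v \<in> V. g v = 0} f"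
    let ?Gs = "insert g ((\<lambda>f. f \<circ> T) ` Fs)"
    have "card ?Gs \<le> Suc (card Fs)"
      using card_insert_le_m1 card_image_le[OF Fs(1), of "\<lambda>f. f \<circ> T"] Fs(1)
      by (metis Suc_le_mono card_insert_if finite_imageI le_SucI)
    hence "card ?Gs < m" using Fs(2) by linarith
    moreover have "\<And>f. f \<in> ?Gs \<Longrightarrow> lfun L V f" using Fs(3) lfun_comp_lmap[OF _ T] g by blast
    ultimately obtain v where v: "v \<in> V" "v \<noteq> (\<lambda>_. 0)" "\<forall>f\<in>?Gs. f v = 0"
      using dimgeD[OF V(2), of ?Gs] Fs(1) by blast
    have "T v = v" using v(3) unfolding T_def by simp
    thus "\<exists>v\<in>{v \<in> V. g v = 0}. v \<noteq> (\<lambda>_. 0) \<and> (\<forall>f\<in>Fs. f v = 0)" using v by auto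
  qed
qed

text \<open>If \<open>e\<close> is isotropic, the quotient of its orthogonal complement by \<open>e\<close> is a form in two
  variables less: the coordinate \<open>i\<close> (where \<open>e\<close> does not vanish) is made zero by subtracting a
  multiple of \<open>e\<close>, and the coordinate \<open>j\<close> is determined by orthogonality to \<open>e\<close>.\<close>

definition red_form :: "'i set \<Rightarrow> ('i \<Rightarrow> 'i \<Rightarrow> 'u::field) \<Rightarrow> ('i \<Rightarrow> 'u) \<Rightarrow> 'i \<Rightarrow> 'i \<Rightarrow> 'i \<Rightarrow> 'u" where
  "red_form I A e j k l = A k l - A k j * beta I A e l / beta I A e j
     - A j l * beta I A e k / beta I A e j + A j j * beta I A e k * beta I A e l / (beta I A e j)\<^sup>2"

section \<open>The quotient of an orthogonal complement by its isotropic vector\<close>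

locale red = subfld L for L :: "'u::field set" +
  fixes I I' :: "'i set" and A :: "'i \<Rightarrow> 'i \<Rightarrow> 'u" and e :: "'i \<Rightarrow> 'u" and i j :: 'i
  assumes fin: "finite I" and A_mem: "\<forall>i\<in>I. \<forall>j\<in>I. A i j \<in> L"
    and e: "e \<in> cvec L I" and iso: "qf I A e = 0"
    and I': "I = insert i (insert j I')" "i \<notin> I'" "j \<notin> I'" "i \<noteq> j"
    and ei: "e i \<noteq> 0" and bj: "beta I A e j \<noteq> 0"
begin

abbreviation "b \<equiv> beta I A e"
abbreviation "A' \<equiv> red_form I A e j"

text \<open>\<open>prj\<close> realises the quotient map on the orthogonal complement of
  \<open>e\<close>, and \<open>lft\<close> is its section: it picks the representative orthogonal to
  \<open>e\<close> whose coordinate \<open>i\<close> is zero.\<close>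

definition lft :: "('i \<Rightarrow> 'u) \<Rightarrow> 'i \<Rightarrow> 'u" where
  "lft a = (\<lambda>k. if k = j then - (\<Sum>l\<in>I'. b l * a l) / b j else a k)"

definition prj :: "('i \<Rightarrow> 'u) \<Rightarrow> 'i \<Rightarrow> 'u" where
  "prj w = (\<lambda>k. if k \<in> I' then w k + (- w i / e i) * e k else 0)"

lemma finI': "finite I'" using fin unfolding I'(1) by simp

lemma mem_I: "k \<in> I \<longleftrightarrow> k = i \<or> k = j \<or> k \<in> I'" unfolding I'(1) by blast

lemma sum_I: "sum f I = f i + (f j + sum f I')" for f :: "'i \<Rightarrow> 'u"
  unfolding I'(1) using I'(2-4) finI' by simp

lemmas distinct_indices = I'(2-4) I'(4)[symmetric]

lemma e_mem: "e k \<in> L" using e zero_mem unfolding cvec_def by (cases "k \<in> I") auto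

lemma b_mem: "k \<in> I \<Longrightarrow> b k \<in> L"
  unfolding beta_def using A_mem e_mem by (intro mems) auto

lemma A'_mem: "\<forall>k\<in>I'. \<forall>l\<in>I'. A' k l \<in> L"
proof (intro ballI)
  fix k l assume kl: "k \<in> I'" "l \<in> I'"
  hence m: "b k \<in> L" "b l \<in> L" "b j \<in> L" "A k l \<in> L" "A k j \<in> L" "A j l \<in> L" "A j j \<in> L"
    using b_mem A_mem mem_I distinct_indices by auto
  show "A' k l \<in> L" unfolding red_form_def by (intro mems m)
qed

lemma cvec_i: "a \<in> cvec L I' \<Longrightarrow> a i = 0" "a \<in> cvec L I' \<Longrightarrow> a j = 0"
  using mem_I distinct_indices unfolding cvec_def by auto

text \<open>The value \<open>s\<close> forced on coordinate \<open>j\<close> is substituted into the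
  original form. Each correction term is then a product of two linear forms in \<open>a\<close>,
  which accounts for the rank one terms of \<open>red_form\<close>.\<close>

lemma qf_red:
  assumes "a i = 0"
  shows "qf I' A' a = qf I A (lft a)"
proof -
  define s where "s = - (\<Sum>l\<in>I'. b l * a l) / b j"
  have y: "lft a j = s" "\<And>k. k \<in> I' \<Longrightarrow> lft a k = a k" "lft a i = 0"
    using mem_I distinct_indices assms by (auto simp: lft_def s_def)
  have "qf I A (lft a) = A j j * s * s + (\<Sum>l\<in>I'. A j l * s * lft a l)
      + (\<Sum>k\<in>I'. A k j * lft a k * s + (\<Sum>l\<in>I'. A k l * lft a k * lft a l))"
    unfolding qf_def sum_I y(1,3) by simp
  also have "\<dots> = A j j * s * s + (\<Sum>l\<in>I'. A j l * s * a l)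
      + (\<Sum>k\<in>I'. A k j * a k * s + (\<Sum>l\<in>I'. A k l * a k * a l))"
    using y(2) by simp
  finally have 1: "qf I A (lft a) = A j j * s * s + s * (\<Sum>l\<in>I'. A j l * a l) + s * (\<Sum>k\<in>I'. A k j * a k)
      + qf I' A a"
    by (simp add: sum.distrib sum_distrib_left qf_def algebra_simps)
  have "qf I' A' a = qf I' A a - (\<Sum>k\<in>I'. \<Sum>l\<in>I'. (A k j * a k) * (b l * a l)) / b j
     - (\<Sum>k\<in>I'. \<Sum>l\<in>I'. (b k * a k) * (A j l * a l)) / b j
     + A j j * (\<Sum>k\<in>I'. \<Sum>l\<in>I'. (b k * a k) * (b l * a l)) / (b j)\<^sup>2"
    unfolding qf_def sum_divide_distrib sum_distrib_left sum_subtractf[symmetric] sum.distrib[symmetric]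
    by (intro sum.cong refl) (simp add: red_form_def algebra_simps)
  also have "\<dots> = qf I' A a - (\<Sum>k\<in>I'. A k j * a k) * (\<Sum>l\<in>I'. b l * a l) / b j
     - (\<Sum>k\<in>I'. b k * a k) * (\<Sum>l\<in>I'. A j l * a l) / b j
     + A j j * ((\<Sum>l\<in>I'. b l * a l) * (\<Sum>l\<in>I'. b l * a l)) / (b j)\<^sup>2"
    unfolding sum_product ..
  also have "\<dots> = qf I A (lft a)"
    unfolding 1 s_def using bj by (simp add: field_simps power2_eq_square)
  finally show ?thesis .
qed

lemma lft_comb: "lft (\<lambda>k. v k + c * w k) = (\<lambda>k. lft v k + c * lft w k)"
  using bj by (auto simp: lft_def fun_eq_iff sum.distrib sum_distrib_left field_simps)

lemma lft_cvec: "a \<in> cvec L I' \<Longrightarrow> lft a \<in> cvec L I"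
  unfolding lft_def cvec_def using mem_I distinct_indices b_mem by (auto intro!: mems)

lemma lft_i: "a \<in> cvec L I' \<Longrightarrow> lft a i = 0"
  using cvec_i(1)[of a] mem_I distinct_indices by (auto simp: lft_def)

lemma lft_orth: "a \<in> cvec L I' \<Longrightarrow> bf I A (lft a) e = 0"
proof -
  assume a: "a \<in> cvec L I'"
  have "(\<Sum>k\<in>I'. lft a k * b k) = (\<Sum>k\<in>I'. b k * a k)"
    using mem_I distinct_indices by (intro sum.cong) (auto simp: lft_def)
  thus ?thesis using bj lft_i[OF a] unfolding bf_expand sum_I by (simp add: lft_def)
qed

lemma bf_red:
  assumes "v \<in> cvec L I'" "w \<in> cvec L I'"
  shows "bf I' A' v w = bf I A (lft v) (lft w)"
  unfolding bf_polar lft_comb[symmetric]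
  using assms[THEN cvec_i(1)] by (simp add: qf_red)

lemma prj_cvec: "w \<in> cvec L I \<Longrightarrow> prj w \<in> cvec L I'"
  unfolding prj_def cvec_def using mem_I distinct_indices e_mem by (auto intro!: mems)

lemma prj_lmap: "lmap L (cvec L I) (cvec L I') prj"
  unfolding lmap_def using prj_cvec ei by (auto simp: prj_def fun_eq_iff field_simps)

text \<open>Subtracting a multiple of the isotropic vector \<open>e\<close> keeps \<open>w\<close>
  orthogonal to \<open>e\<close>. With coordinate \<open>i\<close> made zero and coordinate
  \<open>j\<close> fixed by orthogonality, the coordinates in \<open>I'\<close> determine
  everything.\<close>

lemma lft_prj:
  assumes w: "w \<in> cvec L I" and o: "bf I A w e = 0"
  shows "lft (prj w) = (\<lambda>k. w k + (- w i / e i) * e k)"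
proof -
  define z where "z = (\<lambda>k. w k + (- w i / e i) * e k)"
  have wi: "w i \<in> L" using w mem_I distinct_indices unfolding cvec_def by auto
  have z: "z \<in> cvec L I" unfolding z_def using w e wi e_mem by (intro comb_cvec mems)
  have zi: "z i = 0" using ei by (simp add: z_def)
  have "bf I A z e = 0" unfolding z_def bf_comb_left using o bf_self[of I A e] iso by simp
  hence "z j * b j + (\<Sum>k\<in>I'. z k * b k) = 0"
    using zi unfolding bf_expand sum_I by simp
  hence zj: "z j = - (\<Sum>l\<in>I'. b l * z l) / b j"
    using bj by (simp add: field_simps eq_neg_iff_add_eq_0)
  have s: "(\<Sum>l\<in>I'. b l * prj w l) = (\<Sum>l\<in>I'. b l * z l)"
    by (intro sum.cong) (auto simp: prj_def z_def)
  have "lft (prj w) k = z k" for k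
  proof -
    consider "k = j" | "k \<in> I'" | "k = i" | "k \<notin> I" using mem_I distinct_indices by auto
    thus ?thesis
    proof cases
      case 1 thus ?thesis using zj s by (simp add: lft_def)
    next
      case 2 thus ?thesis using mem_I distinct_indices by (auto simp: lft_def prj_def z_def)
    next
      case 3 thus ?thesis using mem_I distinct_indices zi by (auto simp: lft_def prj_def)
    next
      case 4 thus ?thesis using mem_I distinct_indices z by (auto simp: lft_def prj_def cvec_def)
    qed
  qed
  thus ?thesis unfolding z_def by blast
qed

lemma card_I: "card I = card I' + 2"
  using distinct_indices finI' unfolding I'(1) by simp

text \<open>A single linear condition on \<open>W\<close> makes \<open>prj\<close> applicable and
  injective, so the dimension drops by one while the number of variables drops by two.\<close>

lemma hyp_red:
  assumes "hyp L I A"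
  shows "hyp L I' A'"
proof -
  obtain W m where W: "W \<subseteq> cvec L I" "lsub L W" "\<forall>v\<in>W. qf I A v = 0" "card I \<le> 2 * m" "dimge L W m"
    using assms unfolding hyp_def by blast
  \<comment> \<open>If \<open>e\<close> lies in \<open>W\<close>, then \<open>W\<close> is already
    orthogonal to \<open>e\<close>, and the condition serves to remove the line through
    \<open>e\<close>, which \<open>prj\<close> would kill. Otherwise the condition is orthogonality
    to \<open>e\<close>, and \<open>W\<close> meets that line only in zero.\<close>
  define g where "g = (if e \<in> W then (\<lambda>v. v i) else (\<lambda>v. bf I A v e))"
  have g: "lfun L W g"
    unfolding g_def using lfun_coord[OF W(1)] lfun_bf[OF A_mem W(1) e] by simp
  define V0 where "V0 = {v \<in> W. g v = 0}"
  have dX: "dimge L V0 (m - 1)" and lX: "lsub L V0"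
    unfolding V0_def using dimge_ker[OF W(2,5) g] lsub_ker[OF W(2) g one_mem] by auto
  have XI: "V0 \<subseteq> cvec L I" using W(1) by (auto simp: V0_def)
  have orth: "bf I A v e = 0" if "v \<in> V0" for v
  proof (cases "e \<in> W")
    case True
    hence "(\<lambda>i. v i + 1 * e i) \<in> W" using that one_mem unfolding V0_def by (intro lsubD(2)[OF W(2)]) auto
    thus ?thesis unfolding bf_polar using W(3) that True unfolding V0_def by auto
  next
    case False thus ?thesis using that by (auto simp: V0_def g_def)
  qed
  have inj: "v = (\<lambda>_. 0)" if v: "v \<in> V0" "prj v = (\<lambda>_. 0)" for v
  proof -
    have "lft (prj v) = (\<lambda>_. 0)" using v(2) by (auto simp: lft_def)
    hence "(\<lambda>k. v k + (- v i / e i) * e k) = (\<lambda>_. 0)" using lft_prj[OF subsetD[OF XI v(1)] orth[OF v(1)]] by simp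
    hence "v k + (- v i / e i) * e k = 0" for k by (rule fun_cong)
    hence ve: "v k = (v i / e i) * e k" for k by (metis add_eq_0_iff divide_minus_left mult_minus_left minus_minus)
    have "v i = 0"
    proof (rule ccontr)
      assume vi: "v i \<noteq> 0"
      have "v i \<in> L" using v XI mem_I distinct_indices unfolding cvec_def by auto
      have "(\<lambda>k. (e i / v i) * v k) \<in> W"
        using v W(2) \<open>v i \<in> L\<close> e_mem unfolding V0_def by (intro lsub_scale) (auto intro!: mems)
      also have "(\<lambda>k. (e i / v i) * v k) = e"
      proof
        fix k show "(e i / v i) * v k = e k" using ve[of k] vi ei by simp
      qed
      finally show False using v vi unfolding V0_def g_def by auto
    qed
    thus ?thesis using ve by (intro ext) (metis div_0 mult_zero_left)
  qed
  have pm: "lmap L V0 (cvec L I') prj" using prj_lmap XI unfolding lmap_def by blast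
  have "dimge L (prj ` V0) (m - 1)" using dimge_image[OF dX pm] inj by blast
  moreover have "lsub L (prj ` V0)" using lsub_image[OF lX pm one_mem] .
  moreover have "qf I' A' v = 0" if "v \<in> prj ` V0" for v
  proof -
    obtain w where w: "w \<in> V0" "v = prj w" using \<open>v \<in> prj ` V0\<close> by blast
    have "qf I' A' v = qf I A (lft (prj w))"
      unfolding w(2) using qf_red[of "prj w"] I' by (auto simp: prj_def)
    also have "\<dots> = 0"
      unfolding lft_prj[OF subsetD[OF XI w(1)] orth[OF w(1)]] qf_comb
      using w(1) orth[OF w(1)] W(3) iso unfolding V0_def by simp
    finally show ?thesis .
  qed
  moreover have "card I' \<le> 2 * (m - 1)" using W(4) card_I by linarith
  moreover have "prj ` V0 \<subseteq> cvec L I'" using XI prj_cvec by blast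
  ultimately show ?thesis unfolding hyp_def by blast
qed

text \<open>The lifts of \<open>W\<close> together with the line through \<open>e\<close> form a
  totally isotropic space with one dimension more.\<close>

lemma red_hyp:
  assumes "hyp L I' A'"
  shows "hyp L I A"
proof -
  obtain W m where W: "W \<subseteq> cvec L I'" "lsub L W" "\<forall>v\<in>W. qf I' A' v = 0" "card I' \<le> 2 * m" "dimge L W m"
    using assms unfolding hyp_def by blast
  define V0 where "V0 = {\<lambda>k. lft a k + c * e k | a c. a \<in> W \<and> c \<in> L}"
  have XI: "lft a \<in> cvec L I" if "a \<in> W" for a using that W(1) lft_cvec by blast
  have "V0 \<subseteq> cvec L I" using XI e unfolding V0_def by (auto intro!: comb_cvec)
  moreover have lX: "lsub L V0"
    unfolding lsub_def
  proof (intro conjI ballI)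
    have "(\<lambda>_. 0) \<in> W" using W(2) unfolding lsub_def by blast
    thus "(\<lambda>_. 0) \<in> V0" unfolding V0_def using zero_mem
      by (intro CollectI exI[of _ "\<lambda>_. 0"] exI[of _ 0]) (auto simp: lft_def fun_eq_iff)
  next
    fix v w c assume "v \<in> V0" "w \<in> V0" and c: "c \<in> L"
    then obtain a d a' d' where v: "a \<in> W" "d \<in> L" "v = (\<lambda>k. lft a k + d * e k)"
      and w: "a' \<in> W" "d' \<in> L" "w = (\<lambda>k. lft a' k + d' * e k)" unfolding V0_def by blast
    have "(\<lambda>i. v i + c * w i) = (\<lambda>k. lft (\<lambda>k. a k + c * a' k) k + (d + c * d') * e k)"
      unfolding lft_comb v w by (simp add: algebra_simps)
    moreover have "(\<lambda>k. a k + c * a' k) \<in> W" using lsubD(2)[OF W(2) v(1) w(1) c] .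
    moreover have "d + c * d' \<in> L" using v w c by (intro mems)
    ultimately show "(\<lambda>i. v i + c * w i) \<in> V0" unfolding V0_def by blast
  qed
  moreover have "qf I A v = 0" if "v \<in> V0" for v
  proof -
    obtain a c where a: "a \<in> W" "c \<in> L" "v = (\<lambda>k. lft a k + c * e k)" using \<open>v \<in> V0\<close> unfolding V0_def by blast
    have "a \<in> cvec L I'" using a W(1) by blast
    thus ?thesis unfolding a(3) qf_comb using iso lft_orth qf_red[of a] cvec_i W(3) a by simp
  qed
  moreover have "dimge L V0 (Suc m)"
  proof (rule dimgeI)
    fix Fs assume Fs: "finite Fs" "card Fs < Suc m" "\<And>f. f \<in> Fs \<Longrightarrow> lfun L V0 f"
    have "(\<lambda>_. 0) \<in> W" using W(2) unfolding lsub_def by blast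
    hence eX: "e \<in> V0" unfolding V0_def using one_mem
      by (intro CollectI exI[of _ "\<lambda>_. 0"] exI[of _ 1]) (auto simp: lft_def fun_eq_iff)
    have aX: "lft a \<in> V0" if "a \<in> W" for a unfolding V0_def using that zero_mem
      by (intro CollectI exI[of _ a] exI[of _ 0]) auto
    show "\<exists>v\<in>V0. v \<noteq> (\<lambda>_. 0) \<and> (\<forall>f\<in>Fs. f v = 0)"
    proof (cases "\<forall>f\<in>Fs. f e = 0")
      case True thus ?thesis using eX ei by (intro bexI[of _ e]) auto
    next
      case False
      then obtain g where g: "g \<in> Fs" "g e \<noteq> 0" by blast
      \<comment> \<open>The condition \<open>g\<close> does not vanish at \<open>e\<close>, so every
        lift can be corrected along \<open>e\<close> into its kernel. This uses up \<open>g\<close>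
        and leaves fewer than \<open>m\<close> conditions on \<open>W\<close>.\<close>
      define T where "T = (\<lambda>a. \<lambda>k. lft a k + (- g (lft a) / g e) * e k)"
      have lg: "lfun L V0 g" using Fs g by blast
      have gm: "g v \<in> L" if "v \<in> V0" for v using lg that unfolding lfun_def by blast
      have cm: "- g (lft a) / g e \<in> L" if "a \<in> W" for a
        using gm[OF aX[OF that]] gm[OF eX] by (intro mems)
      have gl: "g (\<lambda>i. v i + c * w i) = g v + c * g w" if "v \<in> V0" "w \<in> V0" "c \<in> L" for v w c
        using lfunD(2)[OF lg that] .
      have TX: "T a \<in> V0" if "a \<in> W" for a unfolding V0_def T_def using cm[OF that] that by blast
      have T: "lmap L W V0 T"
        unfolding lmap_def
      proof (intro conjI ballI)
        fix v w c assume v: "v \<in> W" "w \<in> W" "c \<in> L"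
        show "T (\<lambda>i. v i + c * w i) = (\<lambda>i. T v i + c * T w i)"
          by (rule ext) (use g(2) in \<open>simp add: T_def lft_comb gl[OF aX[OF v(1)] aX[OF v(2)] v(3)] field_simps\<close>)
      qed (use TX in auto)
      have cFs: "card ((\<lambda>f. f \<circ> T) ` (Fs - {g})) < m"
        using Fs(1,2) g(1) card_image_le[of "Fs - {g}" "\<lambda>f. f \<circ> T"] card_Suc_Diff1[of Fs g] by simp
      have "finite ((\<lambda>f. f \<circ> T) ` (Fs - {g}))" "card ((\<lambda>f. f \<circ> T) ` (Fs - {g})) < m"
        "\<And>f. f \<in> (\<lambda>f. f \<circ> T) ` (Fs - {g}) \<Longrightarrow> lfun L W f"
        using Fs(1,3) cFs lfun_comp_lmap[OF _ T] by blast+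
      then obtain a where a: "a \<in> W" "a \<noteq> (\<lambda>_. 0)" "\<forall>f\<in>(\<lambda>f. f \<circ> T) ` (Fs - {g}). f a = 0"
        using dimgeD[OF W(5)] by blast
      have "T a \<noteq> (\<lambda>_. 0)"
      proof
        assume 0: "T a = (\<lambda>_. 0)"
        have ac: "a \<in> cvec L I'" using a W(1) by blast
        have "- g (lft a) / g e = 0" using fun_cong[OF 0, of i] lft_i[OF ac] ei by (simp add: T_def)
        hence l0: "lft a = (\<lambda>_. 0)" using 0 unfolding T_def by (simp only: mult_zero_left add_0_right)
        have "a k = 0" for k using fun_cong[OF l0, of k] cvec_i[OF ac] by (cases "k = j") (auto simp: lft_def)
        thus False using a(2) by blast
      qed
      moreover have "g (T a) = 0" using gl[OF aX[OF a(1)] eX cm[OF a(1)]] g unfolding T_def by simp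
      hence "f (T a) = 0" if "f \<in> Fs" for f using a(3) that by (cases "f = g") auto
      ultimately show ?thesis using TX[OF a(1)] by blast
    qed
  qed
  moreover have "card I \<le> 2 * Suc m" using W(4) card_I by simp
  ultimately show ?thesis unfolding hyp_def by blast
qed

text \<open>A vector in the radical of the quotient lifts to \<open>y\<close>; a suitable multiple
  of \<open>e\<close> subtracted from \<open>y\<close> gives a vector in the radical of the whole
  form, hence zero.\<close>

lemma nonsing_red:
  assumes "nonsing L I A"
  shows "nonsing L I' A'"
  unfolding nonsing_def
proof (intro ballI impI)
  fix v assume v: "v \<in> cvec L I'" "\<forall>w\<in>cvec L I'. bf I' A' v w = 0"
  define y where "y = lft v"
  have y: "y \<in> cvec L I" "y i = 0" "bf I A y e = 0"
    unfolding y_def using v lft_cvec lft_i lft_orth by auto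
  have jI: "j \<in> I" "i \<in> I" using mem_I distinct_indices by auto
  have u: "unitv j \<in> cvec L I" by (rule unitv_cvec[OF jI(1)])
  \<comment> \<open>Chosen so that \<open>y - d e\<close> is orthogonal to \<open>unitv j\<close>,
    whose product with \<open>e\<close> is \<open>b j\<close>.\<close>
  define d where "d = bf I A y (unitv j) / b j"
  have dL: "d \<in> L" unfolding d_def using bf_mem[OF A_mem y(1) u] b_mem[OF jI(1)] by (intro mems)
  have "bf I A (\<lambda>k. y k + (- d) * e k) x = 0" if x: "x \<in> cvec L I" for x
  proof -
    \<comment> \<open>Splits \<open>x\<close> into a multiple of \<open>unitv j\<close> and a vector
      \<open>x'\<close> orthogonal to \<open>e\<close>; the latter comes from the quotient up to a
      multiple of \<open>e\<close>.\<close>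
    define c where "c = bf I A x e / b j"
    have cL: "c \<in> L" unfolding c_def using bf_mem[OF A_mem x e] b_mem[OF jI(1)] by (intro mems)
    define x' where "x' = (\<lambda>k. x k + (- c) * unitv j k)"
    have x': "x' \<in> cvec L I" unfolding x'_def using x u cL by (intro comb_cvec mems)
    have "bf I A x' e = 0"
      unfolding x'_def bf_comb_left bf_unitv[OF fin jI(1)] c_def using bj by simp
    hence "lft (prj x') = (\<lambda>k. x' k + (- x' i / e i) * e k)" using lft_prj x' by blast
    hence "bf I A y (lft (prj x')) = bf I A y x'" by (simp only: bf_comb_right y(3)) simp
    moreover have "bf I A y (lft (prj x')) = 0"
      using v bf_red[OF v(1) prj_cvec[OF x']] prj_cvec[OF x'] unfolding y_def by simp
    ultimately have "bf I A y x = c * bf I A y (unitv j)" unfolding x'_def bf_comb_right by simp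
    thus ?thesis unfolding bf_comb_left d_def c_def using bf_commute[of I A e x] by simp
  qed
  moreover have "(\<lambda>k. y k + (- d) * e k) \<in> cvec L I" using y e dL by (intro comb_cvec mems)
  ultimately have 0: "(\<lambda>k. y k + (- d) * e k) = (\<lambda>_. 0)" using assms unfolding nonsing_def by blast
  hence "d = 0" using fun_cong[OF 0, of i] y(2) ei by simp
  hence y0: "lft v = (\<lambda>_. 0)" using 0 unfolding y_def by simp
  have "v k = 0" for k using fun_cong[OF y0, of k] cvec_i[OF v(1)] by (cases "k = j") (auto simp: lft_def)
  thus "v = (\<lambda>_. 0)" by blast
qed

end

section \<open>Witt cancellation of hyperbolic summands\<close>

lemma (in subfld) hyp_isotropic:
  assumes "hyp L I A" "finite I" "I \<noteq> {}"
  obtains e where "e \<in> cvec L I" "e \<noteq> (\<lambda>_. 0)" "qf I A e = 0"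
proof -
  obtain W m where W: "W \<subseteq> cvec L I" "\<forall>v\<in>W. qf I A v = 0" "card I \<le> 2 * m" "dimge L W m"
    using assms(1) unfolding hyp_def by blast
  have "0 < m" using W(3) assms(2,3) card_gt_0_iff[of I] by linarith
  then obtain v where "v \<in> W" "v \<noteq> (\<lambda>_. 0)"
    using dimgeD[OF W(4), of "{}"] by auto
  thus ?thesis using that W by blast
qed

text \<open>An isotropic vector \<open>e\<close> of the summand on \<open>J\<close> is used to
  reduce both the form on \<open>J\<close> and the form on \<open>I \<union> J\<close>. As
  \<open>e\<close> vanishes on \<open>I\<close> and there are no mixed coefficients,
  \<open>beta\<close> vanishes on \<open>I\<close>, so both reductions have the same coefficients
  and the form on \<open>I\<close> is untouched.\<close>

lemma (in subfld) hyp_cancel: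
  assumes "finite J" "finite I" "I \<inter> J = {}"
    and "\<forall>k\<in>I \<union> J. \<forall>l\<in>I \<union> J. A k l \<in> L"
    and "\<forall>k\<in>I. \<forall>l\<in>J. A k l = 0 \<and> A l k = 0"
    and "nonsing L J A" "hyp L J A" "hyp L (I \<union> J) A"
  shows "hyp L I A"
  using assms
proof (induction "card J" arbitrary: J A rule: less_induct)
  case less
  show ?case
  proof (cases "J = {}")
    case True thus ?thesis using less.prems by simp
  next
    case False
    obtain e where e: "e \<in> cvec L J" "e \<noteq> (\<lambda>_. 0)" "qf J A e = 0"
      using hyp_isotropic[OF less.prems(7,1) False] by blast
    obtain i j where ij: "i \<in> J" "j \<in> J" "i \<noteq> j" "e i \<noteq> 0" "beta J A e j \<noteq> 0"
      using nonsing_isotropic_coordinates[OF less.prems(1,6) e] by blast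
    define J' where "J' = J - {i, j}"
    have J': "J = insert i (insert j J')" "i \<notin> J'" "j \<notin> J'" unfolding J'_def using ij by auto
    have J'J: "J' \<subseteq> J" unfolding J'_def by blast
    have IJ': "I \<union> J = insert i (insert j (I \<union> J'))" "i \<notin> I \<union> J'" "j \<notin> I \<union> J'"
      using J' ij less.prems(3) by blast+
    have eIJ: "e \<in> cvec L (I \<union> J)" using e(1) cvec_mono_index[of J "I \<union> J"] by blast
    have eI: "e l = 0" if "l \<in> I" for l using that e(1) less.prems(3) unfolding cvec_def by auto
    have fIJ: "finite (I \<union> J)" using less.prems by blast
    have beta_eq: "beta (I \<union> J) A e k = beta J A e k" for k
      unfolding beta_def using less.prems(3) eI less.prems(1,2) by (subst sum.union_disjoint) auto
    have beta_I: "beta J A e k = 0" if "k \<in> I" for k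
      unfolding beta_def using less.prems(5) that by (intro sum.neutral) auto
    have q0: "qf (I \<union> J) A e = 0"
    proof -
      have "qf (I \<union> J) A e = (\<Sum>k\<in>I \<union> J. e k * (\<Sum>l\<in>I \<union> J. A k l * e l))"
        unfolding qf_def by (simp add: sum_distrib_left algebra_simps)
      also have "\<dots> = (\<Sum>k\<in>J. e k * (\<Sum>l\<in>J. A k l * e l))"
        using less.prems(1-3) eI by (simp add: sum.union_disjoint)
      also have "\<dots> = qf J A e" unfolding qf_def by (simp add: sum_distrib_left algebra_simps)
      finally show ?thesis using e(3) by simp
    qed
    interpret R1: red L J J' A e i j
      by unfold_locales (fact less.prems(1) e(1,3) ij(3-5) J' | use less.prems(4) in blast)+
    interpret R2: red L "I \<union> J" "I \<union> J'" A e i j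
      by unfold_locales (fact fIJ less.prems(4) eIJ q0 IJ' ij(3,4) | use beta_eq ij(5) in metis)+
    have A'_eq: "red_form (I \<union> J) A e j = red_form J A e j"
      unfolding red_form_def beta_eq by simp
    have A'_I: "red_form J A e j k l = A k l" if "k \<in> I" "l \<in> I" for k l
      unfolding red_form_def using beta_I that by simp
    have "hyp L I (red_form J A e j)"
    proof (rule less.hyps)
      show "card J' < card J" "finite J'" using R1.card_I R1.finI' by auto
      show "I \<inter> J' = {}" using less.prems(3) J'J by blast
      show "\<forall>k\<in>I \<union> J'. \<forall>l\<in>I \<union> J'. red_form J A e j k l \<in> L" using R2.A'_mem unfolding A'_eq .
      show "\<forall>k\<in>I. \<forall>l\<in>J'. red_form J A e j k l = 0 \<and> red_form J A e j l k = 0"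
        unfolding red_form_def using beta_I less.prems(5) J'J ij(2) by (simp add: subset_iff)
      show "nonsing L J' (red_form J A e j)" using R1.nonsing_red less.prems(6) .
      show "hyp L J' (red_form J A e j)" using R1.hyp_red less.prems(7) .
      show "hyp L (I \<union> J') (red_form J A e j)" using R2.hyp_red less.prems(8) unfolding A'_eq .
    qed (use less.prems in auto)
    thus ?thesis using hyp_cong[of I "red_form J A e j" A] A'_I by blast
  qed
qed

section \<open>The Cassels--Pfister theorem\<close>

text \<open>\<open>pol L\<close> is \<open>L[X]\<close>, and \<open>fext L t\<close> is \<open>L(t)\<close>.\<close>

definition pol :: "'u::field set \<Rightarrow> 'u poly set" where
  "pol L = {p. \<forall>n. coeff p n \<in> L}"

definition pvec :: "'u::field set \<Rightarrow> 'i set \<Rightarrow> ('i \<Rightarrow> 'u poly) set" where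
  "pvec L I = {p. (\<forall>i\<in>I. p i \<in> pol L) \<and> (\<forall>i. i \<notin> I \<longrightarrow> p i = 0)}"

abbreviation cform :: "('i \<Rightarrow> 'i \<Rightarrow> 'u::field) \<Rightarrow> 'i \<Rightarrow> 'i \<Rightarrow> 'u poly" where
  "cform A \<equiv> (\<lambda>i j. [:A i j:])"

abbreviation cpv :: "('i \<Rightarrow> 'u::field) \<Rightarrow> 'i \<Rightarrow> 'u poly" where
  "cpv v \<equiv> (\<lambda>i. [:v i:])"

definition transc :: "'u::field set \<Rightarrow> 'u \<Rightarrow> bool" where
  "transc L t \<longleftrightarrow> (\<forall>p\<in>pol L. poly p t = 0 \<longrightarrow> p = 0)"

definition fext :: "'u::field set \<Rightarrow> 'u \<Rightarrow> 'u set" where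
  "fext L t = {poly p t / poly q t | p q. p \<in> pol L \<and> q \<in> pol L \<and> poly q t \<noteq> 0}"

lemma poly_qf: "poly (qf I (cform A) p) x = qf I A (\<lambda>i. poly (p i) x)"
  unfolding qf_def by (simp add: poly_sum mult.assoc)

lemma poly_bf: "poly (bf I (cform A) p q) x = bf I A (\<lambda>i. poly (p i) x) (\<lambda>i. poly (q i) x)"
  unfolding bf_def by (simp add: poly_sum)

context subfld
begin

lemma pol_const: "a \<in> L \<Longrightarrow> [:a:] \<in> pol L"
  unfolding pol_def using zero_mem by (auto simp: coeff_pCons split: nat.split)

lemma pol_0: "0 \<in> pol L" and pol_1: "1 \<in> pol L"
  unfolding pol_def using zero_mem one_mem by (auto simp: coeff_1)

lemma pol_pCons: "a \<in> L \<Longrightarrow> p \<in> pol L \<Longrightarrow> pCons a p \<in> pol L"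
  unfolding pol_def by (auto simp: coeff_pCons split: nat.split)

lemma pol_add: "p \<in> pol L \<Longrightarrow> q \<in> pol L \<Longrightarrow> p + q \<in> pol L"
  and pol_diff: "p \<in> pol L \<Longrightarrow> q \<in> pol L \<Longrightarrow> p - q \<in> pol L"
  and pol_uminus: "p \<in> pol L \<Longrightarrow> - p \<in> pol L"
  unfolding pol_def by (auto intro: mems)

lemma pol_mult: "p \<in> pol L \<Longrightarrow> q \<in> pol L \<Longrightarrow> p * q \<in> pol L"
  unfolding pol_def by (auto simp: coeff_mult intro!: mems)

lemma pol_monom: "a \<in> L \<Longrightarrow> monom a n \<in> pol L"
  unfolding pol_def using zero_mem by auto

lemma pol_power: "p \<in> pol L \<Longrightarrow> p ^ n \<in> pol L"
  by (induction n) (auto intro: pol_1 pol_mult)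

lemma pol_sum: "(\<And>i. i \<in> I \<Longrightarrow> f i \<in> pol L) \<Longrightarrow> sum f I \<in> pol L"
  by (induction I rule: infinite_finite_induct) (auto intro: pol_0 pol_add)

lemma pol_prod: "(\<And>i. i \<in> I \<Longrightarrow> f i \<in> pol L) \<Longrightarrow> prod f I \<in> pol L"
  by (induction I rule: infinite_finite_induct) (auto intro: pol_1 pol_mult)

lemmas pols = pol_const pol_0 pol_1 pol_add pol_diff pol_uminus pol_mult pol_monom pol_power pol_sum
  pol_prod pol_pCons

lemma poly_mem: "p \<in> pol L \<Longrightarrow> x \<in> L \<Longrightarrow> poly p x \<in> L"
  unfolding poly_altdef pol_def by (auto intro!: mems)

lemma coeff_mem: "p \<in> pol L \<Longrightarrow> coeff p n \<in> L"
  unfolding pol_def by simp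

text \<open>Long division divides only by the leading coefficient of \<open>d\<close>, so quotient
  and remainder keep their coefficients in the subfield.\<close>

lemma pol_division:
  assumes "p \<in> pol L" "d \<in> pol L" "d \<noteq> 0"
  shows "\<exists>s\<in>pol L. \<exists>r\<in>pol L. p = d * s + r \<and> (r = 0 \<or> degree r < degree d)"
  using assms(1)
proof (induction "degree p" arbitrary: p rule: less_induct)
  case less
  show ?case
  proof (cases "p = 0 \<or> degree p < degree d")
    case True
    thus ?thesis using less.prems pol_0 by (intro bexI[of _ 0] bexI[of _ p]) auto
  next
    case False
    hence p: "p \<noteq> 0" "degree d \<le> degree p" by auto
    define c where "c = lead_coeff p / lead_coeff d"
    define m where "m = monom c (degree p - degree d)"
    have m: "m \<in> pol L" unfolding m_def c_def using less.prems assms(2) by (intro pols mems coeff_mem)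
    have c0: "c \<noteq> 0" using p assms(3) by (simp add: c_def)
    have m0: "degree m = degree p - degree d" "lead_coeff m = c" "m \<noteq> 0"
      using c0 by (simp_all add: m_def degree_monom_eq monom_eq_0_iff)
    have deg1: "degree (d * m) = degree p" using m0 p assms(3) by (simp add: degree_mult_eq)
    have deg2: "lead_coeff (d * m) = lead_coeff p"
      unfolding lead_coeff_mult m0(2) using assms(3) by (simp add: c_def)
    note deg = deg1 deg2
    show ?thesis
    proof (cases "p - d * m = 0")
      case True
      thus ?thesis using m pol_0 by (intro bexI[of _ m] bexI[of _ 0]) auto
    next
      case nz: False
      have "degree (p - d * m) \<le> degree p" using deg(1) by (simp add: degree_diff_le)
      moreover have "coeff (p - d * m) (degree p) = 0" using deg by (metis coeff_diff diff_self)
      ultimately have "degree (p - d * m) < degree p" using nz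
        by (metis le_neq_implies_less leading_coeff_0_iff)
      moreover have "p - d * m \<in> pol L" using less.prems m assms(2) by (intro pols)
      ultimately obtain s r where sr: "s \<in> pol L" "r \<in> pol L" "p - d * m = d * s + r"
        "r = 0 \<or> degree r < degree d" using less.hyps by blast
      have "p = d * (s + m) + r" using sr(3) by (simp add: algebra_simps)
      thus ?thesis using sr m pol_add by blast
    qed
  qed
qed

lemma pvec_mem: "p \<in> pvec L I \<Longrightarrow> p i \<in> pol L"
  unfolding pvec_def using pol_0 by (cases "i \<in> I") auto

lemma qf_pol: "\<forall>i\<in>I. \<forall>j\<in>I. A i j \<in> L \<Longrightarrow> p \<in> pvec L I \<Longrightarrow> qf I (cform A) p \<in> pol L"
  unfolding qf_def by (intro pols) (auto intro: pvec_mem)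

lemma bf_pol: "\<forall>i\<in>I. \<forall>j\<in>I. A i j \<in> L \<Longrightarrow> p \<in> pvec L I \<Longrightarrow> q \<in> pvec L I \<Longrightarrow> bf I (cform A) p q \<in> pol L"
  unfolding bf_def by (intro pols) (auto intro: pvec_mem)

lemma cpv_pvec: "v \<in> cvec L I \<Longrightarrow> cpv v \<in> pvec L I"
  unfolding pvec_def cvec_def by (auto intro: pol_const)

lemma coeff_cvec: "p \<in> pvec L I \<Longrightarrow> (\<lambda>i. coeff (p i) n) \<in> cvec L I"
  unfolding pvec_def cvec_def by (auto intro: coeff_mem)

end

section \<open>Leading coefficients of polynomial vectors\<close>

lemma coeff_mult_top:
  fixes p q :: "'u::comm_ring_1 poly"
  assumes "degree p \<le> m" "degree q \<le> n"
  shows "coeff (p * q) (m + n) = coeff p m * coeff q n"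
proof -
  have "coeff (p * q) (m + n) = (\<Sum>i\<le>m + n. if i = m then coeff p m * coeff q n else 0)"
    unfolding coeff_mult
  proof (intro sum.cong refl)
    fix i assume "i \<in> {..m + n}"
    consider "i < m" | "i = m" | "i > m" by linarith
    thus "coeff p i * coeff q (m + n - i) = (if i = m then coeff p m * coeff q n else 0)"
    proof cases
      case 1
      hence "coeff q (m + n - i) = 0" using assms by (intro coeff_eq_0) auto
      thus ?thesis using 1 by simp
    next
      case 3
      hence "coeff p i = 0" using assms by (intro coeff_eq_0) auto
      thus ?thesis using 3 by simp
    qed simp
  qed
  thus ?thesis by simp
qed

text \<open>\<open>D\<close> is a common bound, not the degree of each entry; entries of smaller
  degree contribute zero to the vector on the right.\<close>

lemma coeff_qf_top:
  assumes "\<And>i. i \<in> I \<Longrightarrow> degree (p i) \<le> D"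
  shows "coeff (qf I (cform A) p) (D + D) = qf I A (\<lambda>i. coeff (p i) D)"
  unfolding qf_def coeff_sum
  using assms by (intro sum.cong refl) (simp add: coeff_mult_top mult.assoc)

lemma degree_qf:
  assumes "finite I" "\<And>i. i \<in> I \<Longrightarrow> degree (p i) \<le> D"
  shows "degree (qf I (cform A) p) \<le> D + D"
  unfolding qf_def
proof (intro degree_sum_le assms(1))
  fix i j assume ij: "i \<in> I" "j \<in> I"
  have "degree ([:A i j:] * p i * p j) \<le> degree ([:A i j:] * p i) + degree (p j)" by (rule degree_mult_le)
  also have "degree ([:A i j:] * p i) \<le> degree [:A i j:] + degree (p i)" by (rule degree_mult_le)
  finally show "degree ([:A i j:] * p i * p j) \<le> D + D" using assms(2)[OF ij(1)] assms(2)[OF ij(2)] by simp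
qed

lemma bf_const_expand: "bf I (cform A) p (cpv w) = (\<Sum>i\<in>I. \<Sum>j\<in>I. smult (A i j * w j) (p i) + smult (A i j * w i) (p j))"
  unfolding bf_def by (intro sum.cong refl) (simp add: smult_add_right algebra_simps)

lemma degree_bf_const:
  assumes "finite I" "\<And>i. i \<in> I \<Longrightarrow> degree (p i) \<le> D"
  shows "degree (bf I (cform A) p (cpv w)) \<le> D"
  unfolding bf_const_expand
  by (intro degree_sum_le assms(1) degree_add_le order.trans[OF degree_smult_le] assms(2))

lemma coeff_bf_const: "coeff (bf I (cform A) p (cpv w)) n = bf I A (\<lambda>i. coeff (p i) n) w"
  unfolding bf_const_expand bf_def coeff_sum by (intro sum.cong refl) (simp add: algebra_simps)

lemma qf_const: "qf I (cform A) (cpv v) = [:qf I A v:]"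
  unfolding qf_def by (rule poly_eqI) (simp add: coeff_sum coeff_pCons mult_ac split: nat.split)

lemma bf_const: "bf I (cform A) (cpv v) (cpv w) = [:bf I A v w:]"
  unfolding bf_def by (rule poly_eqI) (simp add: coeff_sum coeff_pCons algebra_simps split: nat.split)

lemma top_degree:
  assumes "finite I" "p \<in> pvec L I" "p \<noteq> (\<lambda>_. 0)"
  obtains D where "\<And>i. i \<in> I \<Longrightarrow> degree (p i) \<le> D" "(\<lambda>i. coeff (p i) D) \<noteq> (\<lambda>_. 0)"
proof -
  define J where "J = {i \<in> I. p i \<noteq> 0}"
  obtain i0 where "p i0 \<noteq> 0" using assms(3) by blast
  hence "i0 \<in> J" using assms(2) unfolding J_def pvec_def by auto
  hence J: "finite J" "J \<noteq> {}" using assms(1) by (auto simp: J_def)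
  define D where "D = Max ((\<lambda>i. degree (p i)) ` J)"
  have "degree (p i) \<le> D" if "i \<in> I" for i
  proof (cases "p i = 0")
    case False
    thus ?thesis unfolding D_def using J that by (intro Max_ge) (auto simp: J_def)
  qed simp
  moreover have "D \<in> (\<lambda>i. degree (p i)) ` J" unfolding D_def using J by (intro Max_in) auto
  then obtain i where "i \<in> J" "D = degree (p i)" by blast
  hence "coeff (p i) D \<noteq> 0" unfolding J_def by auto
  hence "(\<lambda>i. coeff (p i) D) \<noteq> (\<lambda>_. 0)" by (auto simp: fun_eq_iff)
  ultimately show ?thesis using that by blast
qed

context subfld
begin

text \<open>The coefficients of highest common degree of a nonzero polynomial zero would be a
  nonzero isotropic vector over \<open>L\<close>.\<close>

lemma aniso_poly:
  assumes "finite I" "aniso L I A" "p \<in> pvec L I" "qf I (cform A) p = 0"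
  shows "p = (\<lambda>_. 0)"
proof (rule ccontr)
  assume "p \<noteq> (\<lambda>_. 0)"
  then obtain D where D: "\<And>i. i \<in> I \<Longrightarrow> degree (p i) \<le> D" "(\<lambda>i. coeff (p i) D) \<noteq> (\<lambda>_. 0)"
    using top_degree[OF assms(1,3)] by blast
  have "qf I A (\<lambda>i. coeff (p i) D) = 0" using coeff_qf_top[of I p D A] D(1) assms(4) by simp
  thus False using assms(2) D(2) coeff_cvec[OF assms(3)] unfolding aniso_def by blast
qed

text \<open>The geometric argument of Cassels and Pfister: a solution \<open>p / d\<close> of \<open>q(v) = f\<close> is replaced by
  the second point in which the quadric meets the line through \<open>p / d\<close> and its polynomial part \<open>s\<close>.
  The line stays inside every affine hyperplane that contains both points, so linear conditions
  with constant coefficients are preserved.\<close>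

lemma cassels_pfister_poly:
  assumes "finite I" and A: "\<forall>i\<in>I. \<forall>j\<in>I. A i j \<in> L" and an: "aniso L I A" and f: "f \<in> pol L"
    and w: "\<And>k. k \<in> K \<Longrightarrow> w k \<in> cvec L I"
    and "p \<in> pvec L I" "d \<in> pol L" "d \<noteq> 0" "qf I (cform A) p = f * d\<^sup>2"
    and "\<And>k. k \<in> K \<Longrightarrow> bf I (cform A) p (cpv (w k)) = l k * d"
  shows "\<exists>s\<in>pvec L I. qf I (cform A) s = f \<and> (\<forall>k\<in>K. bf I (cform A) s (cpv (w k)) = l k)"
  using assms(6-)
proof (induction "degree d" arbitrary: p d rule: less_induct)
  case less
  have "\<forall>i. \<exists>s r. s \<in> pol L \<and> r \<in> pol L \<and> p i = d * s + r \<and> (r = 0 \<or> degree r < degree d)"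
    using pol_division[OF pvec_mem[OF less.prems(1)] less.prems(2,3)] by blast
  then obtain s0 r0 where sr0: "\<And>i. s0 i \<in> pol L \<and> r0 i \<in> pol L \<and> p i = d * s0 i + r0 i \<and>
     (r0 i = 0 \<or> degree (r0 i) < degree d)" by metis
  define s where "s = (\<lambda>i. if i \<in> I then s0 i else 0)"
  define r where "r = (\<lambda>i. if i \<in> I then r0 i else 0)"
  have s: "s \<in> pvec L I" and r: "r \<in> pvec L I" unfolding s_def r_def pvec_def using sr0 by auto
  have p: "p = (\<lambda>i. r i + d * s i)"
  proof
    fix i show "p i = r i + d * s i"
      using sr0[of i] less.prems(1) by (auto simp: s_def r_def pvec_def)
  qed
  have rdeg: "r i = 0 \<or> degree (r i) < degree d" for i using sr0[of i] by (auto simp: r_def)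
  \<comment> \<open>The polynomial part satisfies the linear conditions exactly: the defect times
    \<open>d\<close> equals the polar value of the remainder \<open>r\<close> with a constant
    vector, whose degree is below that of \<open>d\<close>.\<close>
  have bs: "bf I (cform A) s (cpv (w k)) = l k" if k: "k \<in> K" for k
  proof (rule ccontr)
    assume ne: "bf I (cform A) s (cpv (w k)) \<noteq> l k"
    have e: "bf I (cform A) r (cpv (w k)) = d * (l k - bf I (cform A) s (cpv (w k)))"
      using less.prems(5)[OF k] unfolding p bf_comb_left by (simp add: algebra_simps)
    hence nz: "bf I (cform A) r (cpv (w k)) \<noteq> 0" using ne less.prems(3) by simp
    have "degree (bf I (cform A) r (cpv (w k))) \<ge> degree d"
      unfolding e using ne less.prems(3) by (subst degree_mult_eq) auto
    moreover have "degree (bf I (cform A) r (cpv (w k))) \<le> degree d - 1"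
    proof (rule degree_bf_const[OF assms(1)])
      fix i show "degree (r i) \<le> degree d - 1" using rdeg[of i] by auto
    qed
    moreover have "degree d > 0"
    proof (rule ccontr)
      assume "\<not> degree d > 0"
      hence "r = (\<lambda>_. 0)" using rdeg by auto
      thus False using nz by simp
    qed
    ultimately show False by linarith
  qed
  show ?case
  proof (cases "r = (\<lambda>_. 0)")
    case True
    hence "p = (\<lambda>i. d * s i)" using p by simp
    hence "d\<^sup>2 * qf I (cform A) s = d\<^sup>2 * f" using less.prems(4) by (simp add: qf_scale mult.commute)
    hence "qf I (cform A) s = f" using less.prems(3) by simp
    thus ?thesis using s bs by blast
  next
    case False
    \<comment> \<open>\<open>p' / d'\<close> is the second intersection point of the quadric with
      the line through \<open>p / d\<close> and \<open>s\<close>; \<open>a\<close> and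
      \<open>B\<close> come from restricting the equation of the quadric to that line.\<close>
    define a where "a = qf I (cform A) s - f"
    define B where "B = bf I (cform A) p s - 2 * f * d"
    define d' where "d' = a * d - B"
    define p' where "p' = (\<lambda>i. a * p i + (- B) * s i)"
    have am: "a \<in> pol L" unfolding a_def using qf_pol[OF A s] f by (intro pols)
    have two: "2 \<in> pol L" using pol_add[OF pol_1 pol_1] by simp
    have Bm: "B \<in> pol L" unfolding B_def using bf_pol[OF A less.prems(1) s] f less.prems(2) two by (intro pols)
    \<comment> \<open>This is where the degree falls: the right side has degree at most twice
      \<open>degree d - 1\<close>, and by anisotropy it is not zero.\<close>
    have qr: "d * d' = qf I (cform A) r"
    proof -
      have "r = (\<lambda>i. p i + (- d) * s i)" unfolding p by simp
      hence "qf I (cform A) r = qf I (cform A) p + (- d) * bf I (cform A) p s + (- d)\<^sup>2 * qf I (cform A) s"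
        by (simp only: qf_comb)
      thus ?thesis unfolding less.prems(4) d'_def a_def B_def by (simp add: algebra_simps power2_eq_square)
    qed
    have qr0: "qf I (cform A) r \<noteq> 0" using aniso_poly[OF assms(1) an r] False by blast
    have d'0: "d' \<noteq> 0" using qr qr0 by auto
    have dpos: "degree d > 0" using False rdeg by (metis less_zeroE neq0_conv)
    have "degree (qf I (cform A) r) \<le> (degree d - 1) + (degree d - 1)"
    proof (rule degree_qf[OF assms(1)])
      fix i show "degree (r i) \<le> degree d - 1" using rdeg[of i] by auto
    qed
    moreover have "degree (qf I (cform A) r) = degree d + degree d'"
      unfolding qr[symmetric] using less.prems(3) d'0 by (simp add: degree_mult_eq)
    ultimately have deg: "degree d' < degree d" using dpos by linarith
    have p'm: "p' \<in> pvec L I"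
      using less.prems(1) s am Bm unfolding p'_def pvec_def by (auto intro!: pols)
    have d'm: "d' \<in> pol L" unfolding d'_def using am Bm less.prems(2) by (intro pols)
    have q': "qf I (cform A) p' = f * d'\<^sup>2"
    proof -
      have "qf I (cform A) p' = a\<^sup>2 * qf I (cform A) p - a * B * bf I (cform A) p s + B\<^sup>2 * qf I (cform A) s"
        unfolding p'_def qf_comb by (simp add: qf_scale bf_scale_left)
      moreover have "bf I (cform A) p s = B + 2 * f * d" "qf I (cform A) s = a + f" by (simp_all add: B_def a_def)
      ultimately show ?thesis unfolding less.prems(4) d'_def
        by (simp only:) (simp add: power2_eq_square algebra_simps)
    qed
    have "bf I (cform A) p' (cpv (w k)) = l k * d'" if k: "k \<in> K" for k
      unfolding p'_def bf_comb_left bf_scale_left less.prems(5)[OF k] bs[OF k] d'_def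
      by (simp add: algebra_simps)
    thus ?thesis using less.hyps[OF deg p'm d'm d'0 q'] by blast
  qed
qed

section \<open>Rational function fields\<close>

lemma fextI: "p \<in> pol L \<Longrightarrow> q \<in> pol L \<Longrightarrow> poly q t \<noteq> 0 \<Longrightarrow> poly p t / poly q t \<in> fext L t"
  unfolding fext_def by blast

lemma fext_base: "a \<in> L \<Longrightarrow> a \<in> fext L t"
  using fextI[OF pol_const[of a] pol_1, of t] by simp

lemma fext_gen: "t \<in> fext L t"
  using fextI[OF pol_pCons[OF zero_mem pol_1] pol_1, of t] by simp

lemma subfld_fext: "subfld (fext L t)"
proof
  show "1 \<in> fext L t" using fext_base one_mem by blast
next
  fix a b assume "a \<in> fext L t" "b \<in> fext L t"
  then obtain p q p' q' where a: "p \<in> pol L" "q \<in> pol L" "poly q t \<noteq> 0" "a = poly p t / poly q t"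
    and b: "p' \<in> pol L" "q' \<in> pol L" "poly q' t \<noteq> 0" "b = poly p' t / poly q' t"
    unfolding fext_def by blast
  have "a - b = poly (p * q' - p' * q) t / poly (q * q') t" "a * b = poly (p * p') t / poly (q * q') t"
    unfolding a(4) b(4) using a(3) b(3) by (simp_all add: field_simps)
  moreover have "poly (q * q') t \<noteq> 0" using a b by simp
  ultimately show "a - b \<in> fext L t" "a * b \<in> fext L t"
    using fextI[of "p * q' - p' * q" "q * q'"] fextI[of "p * p'" "q * q'"] a b pols by metis+
next
  fix a assume "a \<in> fext L t"
  then obtain p q where a: "p \<in> pol L" "q \<in> pol L" "poly q t \<noteq> 0" "a = poly p t / poly q t"
    unfolding fext_def by blast
  show "inverse a \<in> fext L t"
  proof (cases "poly p t = 0")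
    case True thus ?thesis using a fext_base[OF zero_mem] by simp
  next
    case False thus ?thesis unfolding a(4) inverse_divide using fextI[OF a(2,1)] by blast
  qed
qed

lemma common_denominator:
  assumes "finite I" "v \<in> cvec (fext L t) I"
  obtains p d where "p \<in> pvec L I" "d \<in> pol L" "poly d t \<noteq> 0" "v = (\<lambda>i. (1 / poly d t) * poly (p i) t)"
proof -
  have "\<forall>i. \<exists>p q. i \<in> I \<longrightarrow> p \<in> pol L \<and> q \<in> pol L \<and> poly q t \<noteq> 0 \<and> v i = poly p t / poly q t"
    using assms(2) unfolding cvec_def fext_def by blast
  then obtain p q where pq: "\<And>i. i \<in> I \<Longrightarrow> p i \<in> pol L \<and> q i \<in> pol L \<and> poly (q i) t \<noteq> 0 \<and> v i = poly (p i) t / poly (q i) t"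
    by metis
  define d where "d = (\<Prod>i\<in>I. q i)"
  define r where "r = (\<lambda>i. if i \<in> I then p i * (\<Prod>j\<in>I - {i}. q j) else 0)"
  have d: "d \<in> pol L" "poly d t \<noteq> 0"
    unfolding d_def using pq assms(1) by (auto intro!: pols simp: poly_prod)
  have "r \<in> pvec L I" unfolding r_def pvec_def using pq by (auto intro!: pols)
  moreover have "v i = (1 / poly d t) * poly (r i) t" for i
  proof (cases "i \<in> I")
    case True
    have "poly d t = poly (q i) t * poly (\<Prod>j\<in>I - {i}. q j) t"
      unfolding d_def using prod.remove[OF assms(1) True, of q] by simp
    thus ?thesis using pq[OF True] d(2) True by (simp add: r_def)
  next
    case False
    thus ?thesis using assms(2) by (simp add: r_def cvec_def)
  qed
  ultimately show ?thesis using d that by blast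
qed

lemma transc_eq: "transc L t \<Longrightarrow> p \<in> pol L \<Longrightarrow> q \<in> pol L \<Longrightarrow> poly p t = poly q t \<Longrightarrow> p = q"
  using pol_diff[of p q] unfolding transc_def by (metis eq_iff_diff_eq_0 poly_diff)

text \<open>With denominators cleared, an isotropic vector over \<open>L(t)\<close> is a polynomial
  zero of the form, since a transcendental \<open>t\<close> admits no accidental relation.\<close>

lemma aniso_fext:
  assumes "transc L t" "finite I" "\<forall>i\<in>I. \<forall>j\<in>I. A i j \<in> L" "aniso L I A"
  shows "aniso (fext L t) I A"
  unfolding aniso_def
proof (intro ballI impI)
  fix v assume v: "v \<in> cvec (fext L t) I" "qf I A v = 0"
  obtain p d where p: "p \<in> pvec L I" "d \<in> pol L" "poly d t \<noteq> 0" "v = (\<lambda>i. (1 / poly d t) * poly (p i) t)"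
    using common_denominator[OF assms(2) v(1)] by blast
  have "poly (qf I (cform A) p) t = 0"
    using v(2) p(3) unfolding p(4) qf_scale poly_qf by simp
  hence "qf I (cform A) p = 0" using assms(1) qf_pol[OF assms(3) p(1)] unfolding transc_def by blast
  hence "p = (\<lambda>_. 0)" using aniso_poly[OF assms(2,4) p(1)] by blast
  thus "v = (\<lambda>_. 0)" using p(4) by simp
qed

text \<open>Specialisation at infinity. All prescribed values are constants, so numerators and
  denominator can be compared in the highest degree \<open>D\<close> that occurs in any of
  them.\<close>

lemma specialise:
  assumes t: "transc L t" and "finite I" and A: "\<forall>i\<in>I. \<forall>j\<in>I. A i j \<in> L" and an: "aniso L I A"
    and v: "v \<in> cvec (fext L t) I" "qf I A v = c" "c \<in> L"
    and w: "\<And>k. k \<in> K \<Longrightarrow> w k \<in> cvec L I \<and> a k \<in> L \<and> bf I A v (w k) = a k"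
  shows "\<exists>u\<in>cvec L I. qf I A u = c \<and> (\<forall>k\<in>K. bf I A u (w k) = a k)"
proof -
  obtain p d where p: "p \<in> pvec L I" "d \<in> pol L" "poly d t \<noteq> 0" "v = (\<lambda>i. (1 / poly d t) * poly (p i) t)"
    using common_denominator[OF assms(2) v(1)] by blast
  have d0: "d \<noteq> 0" using p(3) by auto
  have "poly (qf I (cform A) p) t = poly ([:c:] * d\<^sup>2) t"
    using v(2) p(3) unfolding p(4) qf_scale poly_qf by (simp add: field_simps power2_eq_square)
  hence q: "qf I (cform A) p = [:c:] * d\<^sup>2"
    using p(1,2) v(3) A by (intro transc_eq[OF t] qf_pol pols)
  have b: "bf I (cform A) p (cpv (w k)) = [:a k:] * d" if k: "k \<in> K" for k
  proof (rule transc_eq[OF t])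
    show "poly (bf I (cform A) p (cpv (w k))) t = poly ([:a k:] * d) t"
      using w[OF k] p(3) unfolding p(4) bf_scale_left poly_bf by (simp add: field_simps)
  next
    show "bf I (cform A) p (cpv (w k)) \<in> pol L" using w[OF k] p(1) A by (intro bf_pol cpv_pvec) auto
    show "[:a k:] * d \<in> pol L" using w[OF k] p(2) by (intro pols) auto
  qed
  define D where "D = max (degree d) (Max (insert 0 ((\<lambda>i. degree (p i)) ` I)))"
  have Dp: "degree (p i) \<le> D" if "i \<in> I" for i
    unfolding D_def using that assms(2) by (intro max.coboundedI2 Max_ge) auto
  have Dd: "degree d \<le> D" by (simp add: D_def)
  have qD: "qf I A (\<lambda>i. coeff (p i) D) = c * (coeff d D)\<^sup>2"
    using coeff_qf_top[of I p D A] Dp coeff_mult_top[OF Dd Dd] unfolding q by (simp add: power2_eq_square)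
  \<comment> \<open>If the denominator had degree below \<open>D\<close>, the coefficients of degree
    \<open>D\<close> of the numerators would form a nonzero isotropic vector.\<close>
  have "coeff d D \<noteq> 0"
  proof
    assume 0: "coeff d D = 0"
    hence "qf I A (\<lambda>i. coeff (p i) D) = 0" using qD by simp
    hence c0: "(\<lambda>i. coeff (p i) D) = (\<lambda>_. 0)" using an coeff_cvec[OF p(1)] unfolding aniso_def by blast
    have Dd': "degree d < D" using 0 d0 Dd by (metis le_neq_implies_less leading_coeff_0_iff)
    have "D \<in> insert 0 ((\<lambda>i. degree (p i)) ` I)"
    proof -
      have "D = Max (insert 0 ((\<lambda>i. degree (p i)) ` I))" using Dd' unfolding D_def by linarith
      thus ?thesis using assms(2) Max_in[of "insert 0 ((\<lambda>i. degree (p i)) ` I)"] by auto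
    qed
    then obtain i where "i \<in> I" "D = degree (p i)" using Dd' by auto
    moreover have "coeff (p i) D = 0" using fun_cong[OF c0, of i] by simp
    ultimately show False using Dd' by (metis degree_0 leading_coeff_0_iff less_zeroE)
  qed
  define u where "u = (\<lambda>i. (1 / coeff d D) * coeff (p i) D)"
  have "u \<in> cvec L I" unfolding u_def using coeff_cvec[OF p(1)] coeff_mem[OF p(2)]
    by (intro scale_cvec mems)
  moreover have "qf I A u = c" unfolding u_def qf_scale qD using \<open>coeff d D \<noteq> 0\<close> by (simp add: power2_eq_square)
  moreover have "bf I A u (w k) = a k" if k: "k \<in> K" for k
    using arg_cong[OF b[OF k], of "\<lambda>x. coeff x D"] \<open>coeff d D \<noteq> 0\<close>
    unfolding u_def bf_scale_left coeff_bf_const by simp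
  ultimately show ?thesis by blast
qed

text \<open>A vector with polynomial entries that represents a quadratic polynomial in
  \<open>t\<close> must be linear in \<open>t\<close>, and comparing coefficients yields the values
  of \<open>v0\<close> and \<open>v1\<close>.\<close>

lemma cassels_pfister:
  assumes t: "transc L t" and "finite I" and A: "\<forall>i\<in>I. \<forall>j\<in>I. A i j \<in> L" and an: "aniso L I A"
    and v: "v \<in> cvec (fext L t) I" "qf I A v = f0 + f1 * t + f2 * t\<^sup>2" and f: "f0 \<in> L" "f1 \<in> L" "f2 \<in> L"
    and w: "\<And>k. k \<in> K \<Longrightarrow> w k \<in> cvec L I \<and> a k \<in> L \<and> b k \<in> L \<and> bf I A v (w k) = a k + b k * t"
  shows "\<exists>v0\<in>cvec L I. \<exists>v1\<in>cvec L I. qf I A v0 = f0 \<and> bf I A v0 v1 = f1 \<and> qf I A v1 = f2 \<and>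
    (\<forall>k\<in>K. bf I A v0 (w k) = a k \<and> bf I A v1 (w k) = b k)"
proof -
  obtain p d where p: "p \<in> pvec L I" "d \<in> pol L" "poly d t \<noteq> 0" "v = (\<lambda>i. (1 / poly d t) * poly (p i) t)"
    using common_denominator[OF assms(2) v(1)] by blast
  define F where "F = [:f0, f1, f2:]"
  have F: "F \<in> pol L" unfolding F_def using f by (intro pols)
  have d0: "d \<noteq> 0" using p(3) by auto
  have Ft: "poly F t = f0 + f1 * t + f2 * t\<^sup>2" by (simp add: F_def power2_eq_square algebra_simps)
  have "poly (qf I (cform A) p) t = poly (F * d\<^sup>2) t"
  proof -
    have "poly (qf I (cform A) p) t = (poly d t)\<^sup>2 * qf I A v"
      using p(3) unfolding p(4) qf_scale poly_qf by (simp add: field_simps power2_eq_square)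
    thus ?thesis using v(2) Ft by simp
  qed
  hence q: "qf I (cform A) p = F * d\<^sup>2"
    using p(1,2) F A by (intro transc_eq[OF t] qf_pol pols)
  have b: "bf I (cform A) p (cpv (w k)) = [:a k, b k:] * d" if k: "k \<in> K" for k
  proof (rule transc_eq[OF t])
    show "poly (bf I (cform A) p (cpv (w k))) t = poly ([:a k, b k:] * d) t"
      using w[OF k] p(3) unfolding p(4) bf_scale_left poly_bf by (simp add: field_simps)
  next
    show "bf I (cform A) p (cpv (w k)) \<in> pol L" using w[OF k] p(1) A by (intro bf_pol cpv_pvec) auto
    show "[:a k, b k:] * d \<in> pol L" using w[OF k] p(2) by (intro pols) auto
  qed
  obtain s where s: "s \<in> pvec L I" "qf I (cform A) s = F"
      "\<forall>k\<in>K. bf I (cform A) s (cpv (w k)) = [:a k, b k:]"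
  proof -
    have "\<exists>s\<in>pvec L I. qf I (cform A) s = F \<and> (\<forall>k\<in>K. bf I (cform A) s (cpv (w k)) = [:a k, b k:])"
      by (rule cassels_pfister_poly[OF assms(2) A an F _ p(1,2) d0 q b]) (use w in auto)
    thus ?thesis using that by blast
  qed
  \<comment> \<open>Anisotropy rules out cancellation in top degree, so the value has exactly twice
    the degree of the vector, and that is at most 2.\<close>
  have deg: "degree (s i) \<le> 1" for i
  proof (cases "s = (\<lambda>_. 0)")
    case False
    then obtain D where D: "\<And>i. i \<in> I \<Longrightarrow> degree (s i) \<le> D" "(\<lambda>i. coeff (s i) D) \<noteq> (\<lambda>_. 0)"
      using top_degree[OF assms(2) s(1)] by blast
    have "coeff F (D + D) \<noteq> 0"
      using coeff_qf_top[of I s D A] D an coeff_cvec[OF s(1)] unfolding s(2) aniso_def by metis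
    moreover have "degree F \<le> 2" by (simp add: F_def)
    ultimately have "D + D \<le> 2" using le_degree order.trans by blast
    thus ?thesis using D(1)[of i] s(1) by (cases "i \<in> I") (auto simp: pvec_def)
  qed simp
  define v0 where "v0 = (\<lambda>i. coeff (s i) 0)"
  define v1 where "v1 = (\<lambda>i. coeff (s i) 1)"
  have vm: "v0 \<in> cvec L I" "v1 \<in> cvec L I" unfolding v0_def v1_def using coeff_cvec[OF s(1)] by auto
  have s_eq: "s = (\<lambda>i. cpv v0 i + [:0, 1:] * cpv v1 i)"
  proof (intro ext poly_eqI)
    fix i n show "coeff (s i) n = coeff ([:v0 i:] + [:0, 1:] * [:v1 i:]) n"
    proof (cases "n \<le> 1")
      case True thus ?thesis by (cases n) (auto simp: v0_def v1_def coeff_pCons split: nat.splits)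
    next
      case False
      thus ?thesis using deg[of i] by (cases n) (auto simp: coeff_eq_0 coeff_pCons split: nat.splits)
    qed
  qed
  have "F = [:qf I A v0:] + [:0, 1:] * [:bf I A v0 v1:] + [:0, 1:]\<^sup>2 * [:qf I A v1:]"
    unfolding s(2)[symmetric] s_eq qf_comb qf_const bf_const ..
  also have "\<dots> = [:qf I A v0, bf I A v0 v1, qf I A v1:]" by (simp add: power2_eq_square)
  finally have "qf I A v0 = f0" "bf I A v0 v1 = f1" "qf I A v1 = f2" unfolding F_def by auto
  moreover have "bf I A v0 (w k) = a k \<and> bf I A v1 (w k) = b k" if "k \<in> K" for k
    using arg_cong[OF s(3)[rule_format, OF that], of "\<lambda>x. coeff x 0"]
      arg_cong[OF s(3)[rule_format, OF that], of "\<lambda>x. coeff x 1"]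
    unfolding coeff_bf_const v0_def v1_def by simp
  ultimately show ?thesis using vm by blast
qed

end

section \<open>The subform theorem\<close>

fun tower :: "'u::field set \<Rightarrow> (nat \<Rightarrow> 'u) \<Rightarrow> nat \<Rightarrow> 'u set" where
  "tower L t 0 = L"
| "tower L t (Suc k) = fext (tower L t k) (t k)"

text \<open>Algebraic independence over \<open>L\<close>, stated stepwise so that the results on a
  single transcendental element can be iterated.\<close>

definition indep :: "'u::field set \<Rightarrow> (nat \<Rightarrow> 'u) \<Rightarrow> bool" where
  "indep L t \<longleftrightarrow> (\<forall>k. transc (tower L t k) (t k))"

text \<open>There is room for infinitely many new variables over \<open>L\<close>. Each passage to a
  function field uses up some of them, and the resulting field has to be roomy again.\<close>

definition roomy :: "'u::field set \<Rightarrow> bool" where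
  "roomy L \<longleftrightarrow> subfld L \<and> (\<exists>t. indep L t)"

lemma subfld_tower: "subfld L \<Longrightarrow> subfld (tower L t k)"
  by (induction k) (auto intro: subfld.subfld_fext)

lemma tower_mono: "subfld L \<Longrightarrow> j \<le> k \<Longrightarrow> tower L t j \<subseteq> tower L t k"
proof (induction k)
  case (Suc k)
  have "tower L t k \<subseteq> tower L t (Suc k)"
    using subfld.fext_base[OF subfld_tower[OF Suc.prems(1)]] by auto
  thus ?case using Suc by (cases "j = Suc k") auto
qed simp

lemma tower_gen: "subfld L \<Longrightarrow> j < k \<Longrightarrow> t j \<in> tower L t k"
  using tower_mono[of L "Suc j" k t] subfld.fext_gen[OF subfld_tower, of L "t j" t j] by auto

lemma tower_tower: "tower (tower L t k) (\<lambda>i. t (k + i)) j = tower L t (k + j)"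
  by (induction j) auto

lemma roomy_tower: "subfld L \<Longrightarrow> indep L t \<Longrightarrow> roomy (tower L t k)"
  unfolding roomy_def indep_def
  by (intro conjI exI[of _ "\<lambda>i. t (k + i)"]) (auto simp: tower_tower intro: subfld_tower)

lemma aniso_mono: "aniso L' I A \<Longrightarrow> L \<subseteq> L' \<Longrightarrow> aniso L I A"
  unfolding aniso_def using cvec_mono by blast

lemma aniso_tower:
  assumes "subfld L" "indep L t" "finite I" "\<forall>i\<in>I. \<forall>j\<in>I. A i j \<in> L" "aniso L I A"
  shows "aniso (tower L t k) I A"
proof (induction k)
  case (Suc k)
  have "\<forall>i\<in>I. \<forall>j\<in>I. A i j \<in> tower L t k" using assms(4) tower_mono[OF assms(1), of 0 k t] by auto
  thus ?case using subfld.aniso_fext[OF subfld_tower[OF assms(1)] _ assms(3) _ Suc] assms(2)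
    unfolding indep_def by simp
qed (use assms in simp)

text \<open>The variables are specialised from the last to the first; every stage of the tower stays
  anisotropic, so \<open>specialise\<close> applies each time.\<close>

lemma specialise_tower:
  assumes L: "subfld L" and t: "indep L t" and I: "finite I" and A: "\<forall>i\<in>I. \<forall>j\<in>I. A i j \<in> L"
    and an: "aniso L I A"
    and "v \<in> cvec (tower L t k) I" "qf I A v = c" "c \<in> L"
    and w: "\<And>k. k \<in> K \<Longrightarrow> w k \<in> cvec L I \<and> a k \<in> L"
    and "\<And>k. k \<in> K \<Longrightarrow> bf I A v (w k) = a k"
  shows "\<exists>u\<in>cvec L I. qf I A u = c \<and> (\<forall>k\<in>K. bf I A u (w k) = a k)"
  using assms(6-8,10)
proof (induction k arbitrary: v)
  case (Suc k)
  have sub: "L \<subseteq> tower L t k" using tower_mono[OF L, of 0 k t] by simp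
  have "\<exists>u\<in>cvec (tower L t k) I. qf I A u = c \<and> (\<forall>k\<in>K. bf I A u (w k) = a k)"
  proof (rule subfld.specialise[OF subfld_tower[OF L]])
    show "transc (tower L t k) (t k)" using t unfolding indep_def by blast
    show "\<forall>i\<in>I. \<forall>j\<in>I. A i j \<in> tower L t k" using A sub by blast
    show "aniso (tower L t k) I A" using aniso_tower[OF L t I A an] .
    show "v \<in> cvec (fext (tower L t k) (t k)) I" using Suc.prems by simp
    show "c \<in> tower L t k" using Suc.prems sub by blast
    show "w j \<in> cvec (tower L t k) I \<and> a j \<in> tower L t k \<and> bf I A v (w j) = a j" if "j \<in> K" for j
      using w[OF that] Suc.prems(4)[OF that] sub cvec_mono[OF sub] by blast
  qed (use I Suc.prems in auto)
  then obtain u where "u \<in> cvec (tower L t k) I" "qf I A u = c" "\<forall>k\<in>K. bf I A u (w k) = a k" by blast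
  thus ?case using Suc.IH[of u] Suc.prems(3) by blast
qed auto

section \<open>Generic values and subforms\<close>

lemma qf_Suc:
  "qf {..<Suc k} C t = qf {..<k} C t + (\<Sum>i<k. (C i k + C k i) * t i) * t k + C k k * (t k)\<^sup>2"
  unfolding qf_def
  by (simp add: sum.distrib sum_distrib_left sum_distrib_right algebra_simps power2_eq_square)

text \<open>The values of \<open>C\<close> depend only on its diagonal and on the sums
  \<open>C i j + C j i\<close>, which is why only these are prescribed.\<close>

lemma qf_lincomb:
  fixes N :: nat
  assumes "\<And>i. i < N \<Longrightarrow> qf I A (w i) = C i i"
    and "\<And>i j. i < j \<Longrightarrow> j < N \<Longrightarrow> bf I A (w i) (w j) = C i j + C j i"
  shows "qf I A (\<lambda>i. \<Sum>j<N. a j * w j i) = qf {..<N} C a"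
  using assms
proof (induction N rule: nat_induct)
  case 0
  thus ?case by (simp add: qf_def)
next
  case (Suc N)
  have b: "bf I A (\<lambda>i. \<Sum>j<k. a j * w j i) u = (\<Sum>j<k. a j * bf I A (w j) u)" for k u
    by (induction k) (auto simp: bf_comb_left)
  have "qf I A (\<lambda>i. \<Sum>j<Suc N. a j * w j i) = qf I A (\<lambda>i. (\<Sum>j<N. a j * w j i) + a N * w N i)" by simp
  also have "\<dots> = qf {..<N} C a + a N * (\<Sum>j<N. a j * bf I A (w j) (w N)) + (a N)\<^sup>2 * C N N"
    unfolding qf_comb b using Suc by simp
  also have "(\<Sum>j<N. a j * bf I A (w j) (w N)) = (\<Sum>j<N. (C j N + C N j) * a j)"
    using Suc.prems(2) by (intro sum.cong) auto
  finally show ?case unfolding qf_Suc by (simp add: algebra_simps)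
qed

text \<open>The generic value \<open>\<phi>(t)\<close> is represented by \<open>q\<close>; the variables are stripped off one by one.
  The leading vector found by the Cassels--Pfister theorem is moved to one over \<open>L\<close> by a reflection,
  which fixes the vectors over \<open>L\<close> found before.\<close>

lemma subform:
  assumes L: "subfld L" and t: "indep L t" and I: "finite I" and A: "\<forall>i\<in>I. \<forall>j\<in>I. A i j \<in> L"
    and an: "aniso L I A" and C: "\<And>i j. i < N \<Longrightarrow> j < N \<Longrightarrow> C i j \<in> L"
    and v: "v \<in> cvec (tower L t N) I" "qf I A v = qf {..<N} C t"
  shows "\<exists>w. (\<forall>i<N. w i \<in> cvec L I \<and> qf I A (w i) = C i i) \<and>
    (\<forall>i j. i < j \<longrightarrow> j < N \<longrightarrow> bf I A (w i) (w j) = C i j + C j i)"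
proof -
  have "\<exists>w v. v \<in> cvec (tower L t k) I \<and> qf I A v = qf {..<k} C t \<and>
     (\<forall>j. k \<le> j \<longrightarrow> j < N \<longrightarrow> w j \<in> cvec L I \<and> qf I A (w j) = C j j \<and>
        bf I A v (w j) = (\<Sum>i<k. (C i j + C j i) * t i)) \<and>
     (\<forall>i j. k \<le> i \<longrightarrow> i < j \<longrightarrow> j < N \<longrightarrow> bf I A (w i) (w j) = C i j + C j i)" if "k \<le> N" for k
    using that
  \<comment> \<open>The induction runs downwards from \<open>N\<close>. At stage \<open>k\<close>
    the vectors with index at least \<open>k\<close> are already over \<open>L\<close>;
    \<open>v\<close> represents the generic value in the remaining variables, and its products with
    the vectors already found are the mixed terms of \<open>C\<close>.\<close>
  proof (induction k rule: inc_induct)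
    case base
    show ?case using v by (intro exI[of _ "\<lambda>_ _. 0"] exI[of _ v]) auto
  next
    case (step k)
    then obtain w v where v: "v \<in> cvec (tower L t (Suc k)) I" "qf I A v = qf {..<Suc k} C t"
      and w: "\<And>j. Suc k \<le> j \<Longrightarrow> j < N \<Longrightarrow> w j \<in> cvec L I" "\<And>j. Suc k \<le> j \<Longrightarrow> j < N \<Longrightarrow> qf I A (w j) = C j j"
        "\<And>j. Suc k \<le> j \<Longrightarrow> j < N \<Longrightarrow> bf I A v (w j) = (\<Sum>i<Suc k. (C i j + C j i) * t i)"
      and ww: "\<And>i j. Suc k \<le> i \<Longrightarrow> i < j \<Longrightarrow> j < N \<Longrightarrow> bf I A (w i) (w j) = C i j + C j i"
      by blast
    let ?E = "tower L t k"
    interpret E: subfld ?E using subfld_tower[OF L] .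
    have LE: "L \<subseteq> ?E" using tower_mono[OF L, of 0 k t] by simp
    have AE: "\<forall>i\<in>I. \<forall>j\<in>I. A i j \<in> ?E" using A LE by blast
    have anE: "aniso ?E I A" using aniso_tower[OF L t I A an] .
    have CE: "C i j \<in> ?E" if "i < N" "j < N" for i j using C[OF that] LE by blast
    have tE: "t i \<in> ?E" if "i < k" for i using tower_gen[OF L that] .
    have kN: "k < N" using step by simp
    have s_mem: "(\<Sum>i<k. (C i j + C j i) * t i) \<in> ?E" if "j < N" for j
      using CE that kN tE by (intro E.mems) auto
    have q_mem: "qf {..<k} C t \<in> ?E"
      unfolding qf_def using CE kN tE by (intro E.mems) auto
    have "\<exists>v0\<in>cvec ?E I. \<exists>v1\<in>cvec ?E I. qf I A v0 = qf {..<k} C t \<and>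
        bf I A v0 v1 = (\<Sum>i<k. (C i k + C k i) * t i) \<and> qf I A v1 = C k k \<and>
        (\<forall>j\<in>{Suc k..<N}. bf I A v0 (w j) = (\<Sum>i<k. (C i j + C j i) * t i) \<and> bf I A v1 (w j) = C k j + C j k)"
    proof (rule E.cassels_pfister[where t = "t k" and v = v])
      show "transc ?E (t k)" using t unfolding indep_def by blast
      show "w j \<in> cvec ?E I \<and> (\<Sum>i<k. (C i j + C j i) * t i) \<in> ?E \<and> C k j + C j k \<in> ?E \<and>
          bf I A v (w j) = (\<Sum>i<k. (C i j + C j i) * t i) + (C k j + C j k) * t k" if "j \<in> {Suc k..<N}" for j
        using that w(1,3)[of j] cvec_mono[OF LE] s_mem[of j] E.add_mem[OF CE CE, of k j j k] kN
        by auto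
      show "qf I A v = qf {..<k} C t + (\<Sum>i<k. (C i k + C k i) * t i) * t k + C k k * (t k)\<^sup>2"
        unfolding v(2) qf_Suc ..
    qed (use I AE anE v(1) q_mem s_mem kN CE in auto)
    then obtain v0 v1 where v0: "v0 \<in> cvec ?E I" "qf I A v0 = qf {..<k} C t"
        "bf I A v0 v1 = (\<Sum>i<k. (C i k + C k i) * t i)"
        "\<And>j. j \<in> {Suc k..<N} \<Longrightarrow> bf I A v0 (w j) = (\<Sum>i<k. (C i j + C j i) * t i)"
      and v1: "v1 \<in> cvec ?E I" "qf I A v1 = C k k"
        "\<And>j. j \<in> {Suc k..<N} \<Longrightarrow> bf I A v1 (w j) = C k j + C j k" by blast
    \<comment> \<open>\<open>v1\<close> still lives over the tower, but all its prescribed values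
      lie in \<open>L\<close>, so it has a counterpart \<open>u\<close> over \<open>L\<close> with
      the same values.\<close>
    have "\<exists>u\<in>cvec L I. qf I A u = C k k \<and> (\<forall>j\<in>{Suc k..<N}. bf I A u (w j) = C k j + C j k)"
    proof (rule specialise_tower[OF L t I A an v1(1,2)])
      show "w j \<in> cvec L I \<and> C k j + C j k \<in> L" if "j \<in> {Suc k..<N}" for j
        using that w(1) C kN subfld.add_mem[OF L C C, of k j j k] by auto
    qed (use v1 C kN in auto)
    then obtain u where u: "u \<in> cvec L I" "qf I A u = C k k"
      "\<And>j. j \<in> {Suc k..<N} \<Longrightarrow> bf I A u (w j) = C k j + C j k" by blast
    have uE: "u \<in> cvec ?E I" using u(1) cvec_mono[OF LE] by blast
    have "\<exists>v'\<in>cvec ?E I. qf I A v' = qf I A v0 \<and> bf I A v' u = bf I A v0 v1 \<and>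
       (\<forall>j\<in>{Suc k..<N}. bf I A v' (w j) = bf I A v0 (w j))"
    proof (cases "v1 = u")
      case True thus ?thesis using v0(1) by blast
    next
      case False
      \<comment> \<open>The reflection in \<open>z\<close> takes \<open>v1\<close> to
        \<open>u\<close>, because the two have the same value. It fixes each \<open>w j\<close>, as
        \<open>v1\<close> and \<open>u\<close> have the same product with it. Applied to
        \<open>v0\<close> it gives the new \<open>v\<close>.\<close>
      define z where "z = (\<lambda>i. v1 i + (- 1) * u i)"
      have z: "z \<in> cvec ?E I" unfolding z_def using v1(1) uE by (intro E.comb_cvec E.mems)
      have "z \<noteq> (\<lambda>_. 0)" using False unfolding z_def fun_eq_iff by auto
      hence qz: "qf I A z \<noteq> 0" using anE z unfolding aniso_def by blast
      define c where "c = bf I A v0 z / qf I A z"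
      have cE: "c \<in> ?E" unfolding c_def using E.bf_mem[OF AE v0(1) z] E.qf_mem[OF AE z] by (intro E.mems)
      have zu: "bf I A z u = - qf I A z"
        unfolding z_def qf_comb bf_comb_left bf_self using v1(2) u(2) by simp
      have vz: "bf I A v0 z = bf I A v0 v1 - bf I A v0 u" unfolding z_def bf_comb_right by simp
      have zw: "bf I A z (w j) = 0" if "j \<in> {Suc k..<N}" for j
        unfolding z_def bf_comb_left using v1(3) u(3) that by simp
      show ?thesis
      proof (intro bexI[of _ "\<lambda>i. v0 i + (- c) * z i"] conjI ballI)
        show "qf I A (\<lambda>i. v0 i + (- c) * z i) = qf I A v0"
          unfolding qf_comb c_def using qz by (simp add: power2_eq_square)
        show "bf I A (\<lambda>i. v0 i + (- c) * z i) u = bf I A v0 v1"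
          unfolding bf_comb_left zu c_def using qz vz by simp
        show "bf I A (\<lambda>i. v0 i + (- c) * z i) (w j) = bf I A v0 (w j)" if "j \<in> {Suc k..<N}" for j
          unfolding bf_comb_left zw[OF that] by simp
        show "(\<lambda>i. v0 i + (- c) * z i) \<in> cvec ?E I" using v0(1) z cE by (intro E.comb_cvec E.mems)
      qed
    qed
    then obtain v' where v': "v' \<in> cvec ?E I" "qf I A v' = qf I A v0" "bf I A v' u = bf I A v0 v1"
      "\<And>j. j \<in> {Suc k..<N} \<Longrightarrow> bf I A v' (w j) = bf I A v0 (w j)" by blast
    show ?case
    proof (intro exI[of _ "w(k := u)"] exI[of _ v'] conjI allI impI)
      show "v' \<in> cvec ?E I" "qf I A v' = qf {..<k} C t" using v' v0 by auto
    next
      fix j assume j: "k \<le> j" "j < N"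
      show "(w(k := u)) j \<in> cvec L I" "qf I A ((w(k := u)) j) = C j j"
        using u(1,2) w(1,2) j by (cases "j = k"; auto)+
      show "bf I A v' ((w(k := u)) j) = (\<Sum>i<k. (C i j + C j i) * t i)"
        using v'(3) v'(4)[of j] v0(3) v0(4)[of j] j by (cases "j = k") auto
    next
      fix i j assume j: "k \<le> i" "i < j" "j < N"
      show "bf I A ((w(k := u)) i) ((w(k := u)) j) = C i j + C j i"
        using u(3)[of j] ww[of i j] j by (cases "i = k") auto
    qed
  qed
  from this[of 0] show ?thesis by (metis le0)
qed

text \<open>The vectors \<open>w i\<close> are linearly independent: a nontrivial relation among
  them would be an isotropic vector of \<open>C\<close>.\<close>

lemma subform_dim:
  assumes "subfld L" "indep L t" "finite I" "\<forall>i\<in>I. \<forall>j\<in>I. A i j \<in> L" "aniso L I A"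
    and C: "\<And>i j. i < N \<Longrightarrow> j < N \<Longrightarrow> C i j \<in> L" and anC: "aniso L {..<N} C"
    and "v \<in> cvec (tower L t N) I" "qf I A v = qf {..<N} C t"
  shows "N \<le> card I"
proof (rule ccontr)
  assume "\<not> N \<le> card I"
  interpret subfld L by fact
  obtain w where w: "\<And>i. i < N \<Longrightarrow> w i \<in> cvec L I" "\<And>i. i < N \<Longrightarrow> qf I A (w i) = C i i"
    "\<And>i j. i < j \<Longrightarrow> j < N \<Longrightarrow> bf I A (w i) (w j) = C i j + C j i"
    using subform[OF assms(1-6,8,9)] by blast
  let ?Fs = "(\<lambda>i a. \<Sum>j<N. a j * w j i) ` I"
  have "finite ?Fs" "card ?Fs < card {..<N}"
    using assms(3) card_image_le[OF assms(3), of "\<lambda>i a. \<Sum>j<N. a j * w j i"] \<open>\<not> N \<le> card I\<close> by auto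
  moreover have "lfun L (cvec L {..<N}) f" if "f \<in> ?Fs" for f
    using that w(1) unfolding lfun_def
    by (auto simp: sum_distrib_left sum.distrib[symmetric] algebra_simps cvec_def intro!: mems)
  ultimately obtain a where a: "a \<in> cvec L {..<N}" "a \<noteq> (\<lambda>_. 0)" "\<forall>f\<in>?Fs. f a = 0"
    using dimgeD[OF dimge_cvec[OF finite_lessThan[of N]]] by blast
  have "(\<Sum>j<N. a j * w j i) = 0" for i
    using a(3) w(1) by (cases "i \<in> I") (auto simp: cvec_def)
  hence "qf {..<N} C a = 0" using qf_lincomb[of N I A w C a] w(2,3) by simp
  thus False using anC a unfolding aniso_def by blast
qed

text \<open>An echelon basis: each new vector vanishes at all earlier pivots. A relation evaluated
  at the pivots in increasing order then kills its coefficients one after the other.\<close>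

lemma (in subfld) dimge_basis:
  assumes "dimge L W m" "W \<subseteq> cvec L I"
  shows "\<exists>B. (\<forall>j<m. B j \<in> W) \<and> (\<forall>a. (\<forall>i. (\<Sum>j<m. a j * B j i) = 0) \<longrightarrow> (\<forall>j<m. a j = 0))"
proof -
  have "\<exists>B piv. \<forall>j<k. B j \<in> W \<and> B j (piv j) \<noteq> 0 \<and> (\<forall>l<j. B j (piv l) = 0)" if "k \<le> m" for k
    using that
  proof (induction k)
    case (Suc k)
    then obtain B piv where B: "\<forall>j<k. B j \<in> W \<and> B j (piv j) \<noteq> 0 \<and> (\<forall>l<j. B j (piv l) = 0)" by auto
    let ?Fs = "(\<lambda>l v. v (piv l)) ` {..<k}"
    have "card ?Fs < m" using card_image_le[of "{..<k}" "\<lambda>l v. v (piv l)"] Suc.prems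
      by (metis card_lessThan finite_lessThan le_less_trans less_eq_Suc_le)
    moreover have "finite ?Fs" by simp
    moreover have "lfun L W f" if "f \<in> ?Fs" for f using that lfun_coord[OF assms(2)] by auto
    ultimately obtain v where v: "v \<in> W" "v \<noteq> (\<lambda>_. 0)" "\<forall>f\<in>?Fs. f v = 0"
      using dimgeD[OF assms(1)] by blast
    obtain i where "v i \<noteq> 0" using v(2) by auto
    thus ?case using B v(1,3)
      by (intro exI[of _ "B(k := v)"] exI[of _ "piv(k := i)"]) (auto simp: less_Suc_eq)
  qed auto
  from this[OF order.refl] obtain B piv
    where B0: "\<forall>j<m. B j \<in> W \<and> B j (piv j) \<noteq> 0 \<and> (\<forall>l<j. B j (piv l) = 0)" by (elim exE)
  hence B: "\<And>j. j < m \<Longrightarrow> B j \<in> W" "\<And>j. j < m \<Longrightarrow> B j (piv j) \<noteq> 0"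
    "\<And>j l. j < m \<Longrightarrow> l < j \<Longrightarrow> B j (piv l) = 0" by auto
  have "a j = 0" if a: "\<And>i. (\<Sum>j<m. a j * B j i) = 0" and j: "j < m" for a j
    using j
  proof (induction j rule: less_induct)
    case (less j)
    have "0 = (\<Sum>l<m. a l * B l (piv j))" using a by simp
    also have "\<dots> = (\<Sum>l<m. if l = j then a j * B j (piv j) else 0)"
      using less B(3) by (intro sum.cong refl) (metis lessThan_iff linorder_neqE_nat mult_eq_0_iff)
    also have "\<dots> = a j * B j (piv j)" using less.prems by simp
    finally show ?case using B(2)[OF less.prems] by simp
  qed
  thus ?thesis using B(1) by blast
qed

section \<open>Function fields of quadratic forms\<close>

definition qext :: "'u::field set \<Rightarrow> 'u \<Rightarrow> 'u set" where
  "qext E T = {a + b * T | a b. a \<in> E \<and> b \<in> E}"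

text \<open>The extension may be inseparable: in characteristic two, \<open>z\<close> can be zero.
  The conjugate of \<open>T\<close> is \<open>- z - T\<close> in all cases.\<close>

locale quadratic = subfld E for E :: "'u::field set" +
  fixes T z n :: 'u
  assumes z: "z \<in> E" and n: "n \<in> E" and root: "T * T + z * T + n = 0" and T: "T \<notin> E"
begin

lemma qext_unique: "a \<in> E \<Longrightarrow> b \<in> E \<Longrightarrow> a + b * T = 0 \<Longrightarrow> a = 0 \<and> b = 0"
proof -
  assume a: "a \<in> E" "b \<in> E" "a + b * T = 0"
  have "b = 0"
  proof (rule ccontr)
    assume "b \<noteq> 0"
    hence "T = - a / b" using a(3) by (simp add: field_simps eq_neg_iff_add_eq_0)
    moreover have "- a / b \<in> E" using a by (intro mems)
    ultimately show False using T by simp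
  qed
  thus ?thesis using a(3) by simp
qed

lemma root_square: "T * T = - z * T - n"
  using root by (simp add: algebra_simps eq_neg_iff_add_eq_0)

lemma qextI: "a \<in> E \<Longrightarrow> b \<in> E \<Longrightarrow> a + b * T \<in> qext E T"
  unfolding qext_def by blast

lemma base_qext: "a \<in> E \<Longrightarrow> a \<in> qext E T"
  using qextI[of a 0] zero_mem by simp

lemma gen_qext: "T \<in> qext E T"
  using qextI[of 0 1] zero_mem one_mem by simp

lemma subfld_qext: "subfld (qext E T)"
proof
  show "1 \<in> qext E T" using base_qext one_mem by blast
next
  fix x y assume "x \<in> qext E T" "y \<in> qext E T"
  then obtain a b c d where x: "a \<in> E" "b \<in> E" "x = a + b * T" and y: "c \<in> E" "d \<in> E" "y = c + d * T"
    unfolding qext_def by blast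
  have "x - y = (a - c) + (b - d) * T" unfolding x y by (simp add: algebra_simps)
  moreover have "x * y = (a * c - b * d * n) + (a * d + b * c - b * d * z) * T"
  proof -
    have "x * y = a * c + (a * d + b * c) * T + b * d * (T * T)" unfolding x y by (simp add: algebra_simps)
    thus ?thesis unfolding root_square by (simp add: algebra_simps)
  qed
  moreover have "a - c \<in> E" "b - d \<in> E" "a * c - b * d * n \<in> E" "a * d + b * c - b * d * z \<in> E"
    using x y z n by (auto intro!: mems)
  ultimately show "x - y \<in> qext E T" "x * y \<in> qext E T" using qextI by metis+
next
  fix x assume "x \<in> qext E T"
  then obtain a b where x: "a \<in> E" "b \<in> E" "x = a + b * T" unfolding qext_def by blast
  show "inverse x \<in> qext E T"
  proof (cases "x = 0")
    case True thus ?thesis using base_qext zero_mem by simp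
  next
    case False
    \<comment> \<open>\<open>y\<close> is the conjugate of \<open>x\<close>, and \<open>N\<close> is
      its norm.\<close>
    define y where "y = (a - b * z) + (- b) * T"
    define N where "N = a * a - a * b * z + b * b * n"
    have N: "N = x * y"
    proof -
      have "x * y = a * (a - b * z) - b * b * z * T - b * b * (T * T)"
        unfolding x y_def by (simp add: algebra_simps)
      thus ?thesis unfolding root_square N_def by (simp add: algebra_simps)
    qed
    have m: "a - b * z \<in> E" "- b \<in> E" "N \<in> E" unfolding N_def using x z n by (auto intro!: mems)
    have "y \<noteq> 0"
    proof
      assume "y = 0"
      hence "a - b * z = 0 \<and> - b = 0" unfolding y_def using qext_unique m by blast
      thus False using False x by simp
    qed
    moreover have e: "(a - b * z) / N + (- b / N) * T = y / N"
      unfolding y_def by (simp add: add_divide_distrib diff_divide_distrib)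
    moreover have "y / N = inverse x" unfolding N using \<open>y \<noteq> 0\<close> by (simp add: divide_inverse)
    ultimately have "inverse x = (a - b * z) / N + (- b / N) * T" by metis
    moreover have "(a - b * z) / N \<in> E" "- b / N \<in> E" using x(2) m by (auto intro!: mems)
    ultimately show ?thesis using qextI by metis
  qed
qed

text \<open>A zero of the norm form would give a root \<open>r\<close> of the polynomial of
  \<open>T\<close> in \<open>E\<close>, and then both roots \<open>r\<close> and
  \<open>- z - r\<close> would lie in \<open>E\<close>. Irreducibility is phrased as anisotropy
  because anisotropy is known to survive transcendental extensions.\<close>

lemma aniso_norm_form: "aniso E {0, 1} (\<lambda>i j. if i = (0::nat) then (if j = 0 then 1 else z) else if j = 0 then 0 else n)"
  (is "aniso E _ ?A")
  unfolding aniso_def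
proof (intro ballI impI)
  fix v assume v: "v \<in> cvec E {0, 1::nat}" "qf {0, 1} ?A v = 0"
  have q: "v 0 * v 0 + z * v 0 * v 1 + n * v 1 * v 1 = 0"
    using v(2) unfolding qf_def by (simp add: algebra_simps)
  have m: "v 0 \<in> E" "v 1 \<in> E" using v(1) unfolding cvec_def by auto
  have v1: "v 1 = 0"
  proof (rule ccontr)
    assume nz: "v 1 \<noteq> 0"
    define r where "r = v 0 / v 1"
    have r: "r \<in> E" unfolding r_def using m by (intro mems)
    have "r * r + z * r + n = (v 0 * v 0 + z * v 0 * v 1 + n * v 1 * v 1) / (v 1 * v 1)"
      unfolding r_def using nz by (simp add: field_simps)
    hence "r * r + z * r + n = 0" using q by simp
    hence "(T - r) * (T - (- z - r)) = 0" using root by (simp add: algebra_simps) (metis add.commute add_left_cancel mult.commute)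
    hence "T = r \<or> T = - z - r" by simp
    moreover have "- z - r \<in> E" using r z by (intro mems)
    ultimately show False using T r by auto
  qed
  hence "v 0 = 0" using q by simp
  hence "v i = 0" for i using v1 v(1) unfolding cvec_def by (cases "i \<in> {0, 1}") auto
  thus "v = (\<lambda>_. 0)" by blast
qed

text \<open>If \<open>T\<close> lay in \<open>F\<close>, then \<open>(T, 1)\<close> would be a zero
  of the norm form over \<open>F\<close>.\<close>

lemma quadratic_extend:
  assumes F: "subfld F" "E \<subseteq> F" and an: "aniso F {0, 1} (\<lambda>i j. if i = (0::nat) then (if j = 0 then 1 else z) else if j = 0 then 0 else n)"
  shows "quadratic F T z n"
proof -
  interpret F: subfld F by fact
  have "T \<notin> F"
  proof
    assume TF: "T \<in> F"
    define v where "v = (\<lambda>i::nat. if i = 0 then T else if i = 1 then 1 else 0)"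
    have "v \<in> cvec F {0, 1}" unfolding v_def cvec_def using TF F.one_mem by auto
    moreover have "qf {0, 1} (\<lambda>i j. if i = (0::nat) then (if j = 0 then 1 else z) else if j = 0 then 0 else n) v = 0"
      unfolding qf_def v_def using root by (simp add: algebra_simps)
    ultimately have "v = (\<lambda>_. 0)" using an unfolding aniso_def by blast
    from fun_cong[OF this, of 1] show False by (simp add: v_def)
  qed
  thus ?thesis using F z n root by unfold_locales auto
qed

text \<open>Multiplying a polynomial relation over \<open>E(T)\<close> by its conjugate gives a
  relation over \<open>E\<close>.\<close>

lemma qext_transc:
  assumes x: "transc E x"
  shows "transc (qext E T) x"
  unfolding transc_def
proof (intro ballI impI)
  fix p assume p: "p \<in> pol (qext E T)" "poly p x = 0"
  have "\<forall>k. \<exists>a b. a \<in> E \<and> b \<in> E \<and> coeff p k = a + b * T"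
    using p(1) unfolding pol_def qext_def by blast
  then obtain a b where ab: "\<And>k. a k \<in> E \<and> b k \<in> E \<and> coeff p k = a k + b k * T" by metis
  define p0 where "p0 = (\<Sum>k\<le>degree p. monom (a k) k)"
  define p1 where "p1 = (\<Sum>k\<le>degree p. monom (b k) k)"
  have pm: "p0 \<in> pol E" "p1 \<in> pol E" unfolding p0_def p1_def using ab by (auto intro!: pols)
  have pe: "p = p0 + smult T p1"
  proof -
    have "[:T:] * p1 = (\<Sum>k\<le>degree p. [:T:] * monom (b k) k)"
      unfolding p1_def by (rule sum_distrib_left)
    hence s: "smult T p1 = (\<Sum>k\<le>degree p. monom (T * b k) k)" by (simp add: smult_monom)
    have "p = (\<Sum>k\<le>degree p. monom (coeff p k) k)" by (rule poly_as_sum_of_monoms[symmetric])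
    also have "\<dots> = p0 + smult T p1"
      unfolding p0_def s sum.distrib[symmetric]
      using ab by (intro sum.cong refl) (simp add: add_monom mult.commute)
    finally show ?thesis .
  qed
  \<comment> \<open>The conjugate of \<open>p\<close>, obtained by replacing \<open>T\<close> by
    \<open>- z - T\<close> in the coefficients.\<close>
  define p' where "p' = p0 - smult z p1 - smult T p1"
  have "p * p' = p0 * p0 - smult z (p0 * p1) - smult (z * T + T * T) (p1 * p1)"
    unfolding pe p'_def by (simp add: algebra_simps smult_add_left)
  also have "z * T + T * T = - n" using root by (simp add: algebra_simps eq_neg_iff_add_eq_0)
  finally have pp: "p * p' = p0 * p0 - [:z:] * (p0 * p1) + [:n:] * (p1 * p1)" by simp
  have "p0 * p0 - [:z:] * (p0 * p1) + [:n:] * (p1 * p1) \<in> pol E" using pm z n by (intro pols)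
  hence "p * p' \<in> pol E" unfolding pp .
  moreover have "poly (p * p') x = 0" using p(2) by simp
  ultimately have "p * p' = 0" using x unfolding transc_def by blast
  moreover have "p' \<noteq> 0 \<or> p = 0"
  proof (cases "p' = 0")
    case True
    have "coeff p1 k = 0 \<and> coeff p0 k = 0" for k
    proof -
      have m: "coeff p0 k \<in> E" "coeff p1 k \<in> E" using pm by (auto intro: coeff_mem)
      have "(coeff p0 k - z * coeff p1 k) + (- coeff p1 k) * T = coeff p' k" unfolding p'_def by (simp add: algebra_simps)
      hence "(coeff p0 k - z * coeff p1 k) + (- coeff p1 k) * T = 0" using True by simp
      moreover have "coeff p0 k - z * coeff p1 k \<in> E" "- coeff p1 k \<in> E" using m z by (auto intro!: mems)
      ultimately have "coeff p0 k - z * coeff p1 k = 0 \<and> - coeff p1 k = 0" using qext_unique by blast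
      thus ?thesis by simp
    qed
    hence "p = 0" unfolding pe by (intro poly_eqI) simp
    thus ?thesis by blast
  qed blast
  ultimately show "p = 0" by auto
qed

text \<open>The same variables work: \<open>T\<close> stays outside the towers over \<open>E\<close>
  by anisotropy of the norm form, and the towers over \<open>E(T)\<close> are contained in the
  quadratic extensions of the towers over \<open>E\<close>.\<close>

lemma roomy_qext:
  assumes "\<exists>t. indep E t"
  shows "roomy (qext E T)"
proof -
  obtain t where t: "indep E t" using assms by blast
  let ?A = "\<lambda>i j. if i = (0::nat) then (if j = 0 then 1 else z) else if j = 0 then 0 else n"
  have Am: "\<forall>i\<in>{0,1}. \<forall>j\<in>{0,1}. ?A i j \<in> E" using z n mems by auto
  have q: "quadratic (tower E t k) T z n" for k
    using subfld_tower[OF subfld_axioms] tower_mono[OF subfld_axioms, of 0 k t]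
      aniso_tower[OF subfld_axioms t _ Am aniso_norm_form, of k]
    by (intro quadratic_extend) auto
  have sub: "tower (qext E T) t k \<subseteq> qext (tower E t k) T" for k
  proof (induction k)
    case (Suc k)
    interpret Q: quadratic "tower E t (Suc k)" T z n by (rule q)
    interpret Q0: quadratic "tower E t k" T z n by (rule q)
    interpret S: subfld "qext (tower E t (Suc k)) T" by (rule Q.subfld_qext)
    have "tower E t k \<subseteq> tower E t (Suc k)" using tower_mono[OF subfld_axioms, of k "Suc k" t] by simp
    hence "qext (tower E t k) T \<subseteq> qext (tower E t (Suc k)) T" unfolding qext_def by blast
    hence 1: "tower (qext E T) t k \<subseteq> qext (tower E t (Suc k)) T" using Suc by blast
    have 2: "t k \<in> qext (tower E t (Suc k)) T"
      using Q.base_qext tower_gen[OF subfld_axioms, of k "Suc k" t] by simp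
    have 3: "poly p (t k) \<in> qext (tower E t (Suc k)) T" if "p \<in> pol (tower (qext E T) t k)" for p
      using that 1 by (intro S.poly_mem 2) (auto simp: pol_def)
    show ?case
    proof
      fix x assume "x \<in> tower (qext E T) t (Suc k)"
      then obtain p q where "p \<in> pol (tower (qext E T) t k)" "q \<in> pol (tower (qext E T) t k)"
        "x = poly p (t k) / poly q (t k)" unfolding tower.simps fext_def by blast
      thus "x \<in> qext (tower E t (Suc k)) T" using 3 S.divide_mem by blast
    qed
  qed simp
  have "transc (tower (qext E T) t k) (t k)" for k
  proof -
    interpret Q: quadratic "tower E t k" T z n by (rule q)
    have "transc (qext (tower E t k) T) (t k)"
      using Q.qext_transc t unfolding indep_def by blast
    thus ?thesis using sub[of k] unfolding transc_def pol_def by blast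
  qed
  thus ?thesis unfolding roomy_def indep_def using subfld_qext by blast
qed

text \<open>The coefficient of \<open>T\<close> with respect to the basis 1, \<open>T\<close> of the
  extension.\<close>

definition imc :: "'u \<Rightarrow> 'u" where
  "imc x = (THE b. b \<in> E \<and> x - b * T \<in> E)"

lemma imc_eq: "a \<in> E \<Longrightarrow> b \<in> E \<Longrightarrow> imc (a + b * T) = b"
  unfolding imc_def
proof (rule the_equality)
  fix b' assume a: "a \<in> E" "b \<in> E" "b' \<in> E \<and> a + b * T - b' * T \<in> E"
  have "(a + b * T - b' * T - a) + (b' - b) * T = 0" by (simp add: algebra_simps)
  moreover have "a + b * T - b' * T - a \<in> E" "b' - b \<in> E"
    using diff_mem[of "a + b * T - b' * T" a] diff_mem[of b' b] a by simp_all
  ultimately have "b' - b = 0" using qext_unique by blast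
  thus "b' = b" by simp
qed simp

lemma imc_mem: "x \<in> qext E T \<Longrightarrow> imc x \<in> E" "x \<in> qext E T \<Longrightarrow> x - imc x * T \<in> E"
  unfolding qext_def using imc_eq by auto

lemma imc_comb: "x \<in> qext E T \<Longrightarrow> y \<in> qext E T \<Longrightarrow> c \<in> E \<Longrightarrow> imc (x + c * y) = imc x + c * imc y"
proof -
  assume "x \<in> qext E T" "y \<in> qext E T" and c: "c \<in> E"
  then obtain a b a' b' where x: "a \<in> E" "b \<in> E" "x = a + b * T" and y: "a' \<in> E" "b' \<in> E" "y = a' + b' * T"
    unfolding qext_def by blast
  have e: "x + c * y = (a + c * a') + (b + c * b') * T" unfolding x y by (simp add: algebra_simps)
  have "a + c * a' \<in> E" "b + c * b' \<in> E" using x y c by (auto intro!: mems)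
  thus ?thesis unfolding e using imc_eq x y by simp
qed

text \<open>A totally isotropic subspace of half dimension over \<open>E(T)\<close> has full dimension over \<open>E\<close>, so every
  vector over \<open>E\<close> is the \<open>T\<close>-component of one of its elements.\<close>

lemma hyp_quadratic:
  assumes I: "finite I" and A: "\<forall>i\<in>I. \<forall>j\<in>I. A i j \<in> E" and an: "aniso E I A"
    and h: "hyp (qext E T) I A" and w: "w \<in> cvec E I"
  shows "\<exists>v\<in>cvec E I. qf I A v = n * qf I A w \<and> bf I A v w = z * qf I A w"
proof -
  let ?L = "qext E T"
  interpret S: subfld ?L by (rule subfld_qext)
  obtain W m where W: "W \<subseteq> cvec ?L I" "lsub ?L W" "\<forall>v\<in>W. qf I A v = 0" "card I \<le> 2 * m" "dimge ?L W m"
    using h unfolding hyp_def by blast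
  obtain B where B: "\<And>j. j < m \<Longrightarrow> B j \<in> W"
    "\<And>a. (\<And>i. (\<Sum>j<m. a j * B j i) = 0) \<Longrightarrow> \<forall>j<m. a j = 0"
    using S.dimge_basis[OF W(5,1)] by blast
  \<comment> \<open>Unknowns over \<open>E\<close>: for each basis vector \<open>B j\<close> the two
    components of its coefficient, and with index \<open>None\<close> a multiplier for
    \<open>w\<close>. There are \<open>2 * m + 1\<close> of them, more than the
    \<open>card I\<close> equations to come.\<close>
  define J where "J = insert None (Some ` ({..<m} \<times> (UNIV :: bool set)))"
  have J: "finite J" "card J = Suc (2 * m)"
    unfolding J_def by (simp_all add: card_image card_cartesian_product)
  define al where "al = (\<lambda>a :: (nat \<times> bool) option \<Rightarrow> 'u. \<lambda>j. a (Some (j, False)) + a (Some (j, True)) * T)"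
  define y where "y = (\<lambda>a :: (nat \<times> bool) option \<Rightarrow> 'u. \<lambda>i. \<Sum>j<m. al a j * B j i)"
  have al_mem: "al a j \<in> ?L" if "a \<in> cvec E J" for a j
  proof -
    have "a k \<in> E" for k using that zero_mem unfolding cvec_def by (cases "k \<in> J") auto
    thus ?thesis unfolding al_def by (intro qextI)
  qed
  have comb_W: "(\<lambda>i. \<Sum>j<k. c j * B j i) \<in> W" if "\<And>j. c j \<in> ?L" "k \<le> m" for c k
    using that(2)
  proof (induction k)
    case 0 thus ?case using lsubD(1)[OF W(2)] by simp
  next
    case (Suc k)
    have "(\<lambda>i. (\<Sum>j<k. c j * B j i) + c k * B k i) \<in> W"
      using lsubD(2)[OF W(2) _ B(1) that(1)] Suc by simp
    thus ?case by simp
  qed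
  have yW: "y a \<in> W" if "a \<in> cvec E J" for a
    unfolding y_def by (rule comb_W[OF al_mem[OF that] order.refl])
  have y_mem: "y a i \<in> ?L" if "a \<in> cvec E J" for a i
    using yW[OF that] W(1) S.zero_mem unfolding cvec_def by (cases "i \<in> I") auto
  have y_comb: "y (\<lambda>k. a k + c * b k) i = y a i + c * y b i" for a b c i
    unfolding y_def al_def by (simp add: sum_distrib_left sum.distrib[symmetric] algebra_simps)
  \<comment> \<open>The equations say that the \<open>T\<close> component of the combination
    \<open>y a\<close> is the chosen multiple of \<open>w\<close>.\<close>
  let ?Fs = "(\<lambda>i a. imc (y a i) - a None * w i) ` I"
  have wm: "w i \<in> E" for i using w zero_mem unfolding cvec_def by (cases "i \<in> I") auto
  have "lfun E (cvec E J) f" if "f \<in> ?Fs" for f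
  proof -
    obtain i where f: "f = (\<lambda>a. imc (y a i) - a None * w i)" using \<open>f \<in> ?Fs\<close> by blast
    show ?thesis
      unfolding lfun_def f
    proof (intro conjI ballI)
      fix a assume a: "a \<in> cvec E J"
      have "a None \<in> E" using a unfolding cvec_def J_def by auto
      thus "imc (y a i) - a None * w i \<in> E" using imc_mem(1)[OF y_mem[OF a]] wm by (intro mems)
    next
      fix a b c assume a: "a \<in> cvec E J" "b \<in> cvec E J" "c \<in> E"
      show "imc (y (\<lambda>i. a i + c * b i) i) - (a None + c * b None) * w i
        = imc (y a i) - a None * w i + c * (imc (y b i) - b None * w i)"
        unfolding y_comb imc_comb[OF y_mem[OF a(1)] y_mem[OF a(2)] a(3)] by (simp add: algebra_simps)
    qed
  qed
  moreover have "finite ?Fs" "card ?Fs < card J"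
    using I card_image_le[OF I, of "\<lambda>i a. imc (y a i) - a None * w i"] W(4) unfolding J(2) by auto
  ultimately obtain a where a: "a \<in> cvec E J" "a \<noteq> (\<lambda>_. 0)" "\<forall>f\<in>?Fs. f a = 0"
    using dimgeD[OF dimge_cvec[OF J(1)]] by blast
  have im: "imc (y a i) = a None * w i" for i
  proof (cases "i \<in> I")
    case True thus ?thesis using a(3) by auto
  next
    case False
    hence "y a i = 0" "w i = 0" using yW[OF a(1)] W(1) w unfolding cvec_def by auto
    thus ?thesis using imc_eq[of 0 0] zero_mem by simp
  qed
  define s where "s = a None"
  have sE: "s \<in> E" using a(1) unfolding s_def cvec_def J_def by auto
  \<comment> \<open>With multiplier zero, \<open>y a\<close> would be an isotropic vector over
    \<open>E\<close>, hence zero, and independence of the \<open>B j\<close> and of 1,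
    \<open>T\<close> would make the whole solution trivial.\<close>
  have s0: "s \<noteq> 0"
  proof
    assume s0: "s = 0"
    have "y a i \<in> E" for i using imc_mem(2)[OF y_mem[OF a(1)], of i] im[of i] s0 by (simp add: s_def)
    hence "y a \<in> cvec E I" using yW[OF a(1)] W(1) unfolding cvec_def by auto
    hence "y a = (\<lambda>_. 0)" using an W(3) yW[OF a(1)] unfolding aniso_def by blast
    hence "\<forall>j<m. al a j = 0" using B(2)[of "al a"] unfolding y_def by (simp add: fun_eq_iff)
    hence "a (Some (j, False)) = 0 \<and> a (Some (j, True)) = 0" if "j < m" for j
      using qext_unique[of "a (Some (j, False))" "a (Some (j, True))"] that a(1)
      unfolding al_def cvec_def J_def by auto
    hence "a (Some (j, b)) = 0" if "j < m" for j b using that by (cases b) auto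
    hence "a k = 0" if "k \<in> J" for k using that s0 unfolding J_def s_def by auto
    hence "a k = 0" for k using a(1) unfolding cvec_def by (cases "k \<in> J") auto
    thus False using a(2) by blast
  qed
  define x where "x = (\<lambda>i. (1 / s) * y a i)"
  have sL: "1 / s \<in> ?L" using base_qext[OF divide_mem[OF one_mem sE]] .
  have xW: "x \<in> W" unfolding x_def using lsub_scale[OF W(2) yW[OF a(1)] sL] .
  \<comment> \<open>\<open>x\<close> has \<open>T\<close> component \<open>w\<close>, so
    \<open>v\<close> is its component in \<open>E\<close>. Both claims are read off from the
    components of \<open>q(v + T w) = 0\<close>.\<close>
  define v where "v = (\<lambda>i. x i + (- T) * w i)"
  have "v i \<in> E" for i
  proof -
    have "v i = (1 / s) * (y a i - imc (y a i) * T)"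
      unfolding v_def x_def im s_def[symmetric] using s0 by (simp add: field_simps)
    thus ?thesis using imc_mem(2)[OF y_mem[OF a(1)]] sE by (metis divide_mem mult_mem one_mem)
  qed
  hence v: "v \<in> cvec E I" using xW W(1) w unfolding v_def cvec_def by auto
  have "x = (\<lambda>i. v i + T * w i)" by (auto simp: v_def fun_eq_iff)
  hence "0 = qf I A v + T * bf I A v w + T\<^sup>2 * qf I A w" using W(3) xW qf_comb[of I A v T w] by metis
  also have "T\<^sup>2 = - z * T - n" using root_square by (simp add: power2_eq_square)
  finally have "(qf I A v - n * qf I A w) + (bf I A v w - z * qf I A w) * T = 0" by (simp add: algebra_simps)
  moreover have "qf I A v - n * qf I A w \<in> E" "bf I A v w - z * qf I A w \<in> E"
    using qf_mem[OF A v] qf_mem[OF A w] bf_mem[OF A v w] z n by (auto intro!: mems)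
  ultimately have "qf I A v - n * qf I A w = 0 \<and> bf I A v w - z * qf I A w = 0" using qext_unique by blast
  thus ?thesis using v by auto
qed

end

section \<open>Forms that become hyperbolic over a function field\<close>

lemma qf_insert_first:
  fixes N :: nat
  assumes "0 < N"
  shows "qf {..<N} C t = C 0 0 * (t 0)\<^sup>2 + (\<Sum>j\<in>{1..<N}. (C 0 j + C j 0) * t j) * t 0 + qf {1..<N} C t"
proof -
  have e: "{..<N} = insert 0 {1..<N}" using assms by (auto simp: Suc_le_eq)
  show ?thesis unfolding qf_def e
    by (simp add: sum.distrib sum_distrib_left sum_distrib_right algebra_simps power2_eq_square)
qed

text \<open>\<open>E(T)\<close> contains the generic zero \<open>(T, t 1, ..., t (N - 1))\<close> of
  \<open>C\<close>. Hyperbolicity of \<open>A\<close> there yields \<open>v\<close> and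
  \<open>w\<close> over \<open>E\<close> for which \<open>A(v + X w)\<close> is, up to a scalar, the
  polynomial in \<open>X\<close> whose root is \<open>T\<close>. Putting \<open>t 0\<close> for
  \<open>X\<close> shows that \<open>A\<close> represents the generic value of a multiple of
  \<open>C\<close>, and the subform theorem bounds the dimension.\<close>

lemma function_field_dim:
  fixes L :: "'u::alg_closed_field set"
  assumes L: "roomy L" and I: "finite I" "I \<noteq> {}" and A: "\<forall>i\<in>I. \<forall>j\<in>I. A i j \<in> L" and an: "aniso L I A"
    and C: "\<And>i j. i < N \<Longrightarrow> j < N \<Longrightarrow> C i j \<in> L" and N: "2 \<le> N" and anC: "aniso L {..<N} C"
    and h: "\<And>L'. roomy L' \<Longrightarrow> L \<subseteq> L' \<Longrightarrow> \<not> aniso L' {..<N} C \<Longrightarrow> hyp L' I A"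
  shows "N \<le> card I"
proof -
  obtain t where t: "indep L t" and sL: "subfld L" using L unfolding roomy_def by blast
  interpret L: subfld L by (rule sL)
  define E where "E = tower L t N"
  interpret subfld E unfolding E_def using subfld_tower[OF sL] .
  have LE: "L \<subseteq> E" unfolding E_def using tower_mono[OF sL, of 0 N t] by simp
  have tE: "t i \<in> E" if "i < N" for i unfolding E_def using tower_gen[OF sL that] .
  have C': "\<forall>i\<in>{..<N}. \<forall>j\<in>{..<N}. C i j \<in> L" using C by simp
  have anE: "aniso E I A" and anCE: "aniso E {..<N} C"
    unfolding E_def using aniso_tower[OF sL t I(1) A an] aniso_tower[OF sL t _ C' anC] by auto
  have AE: "\<forall>i\<in>I. \<forall>j\<in>I. A i j \<in> E" using A LE by blast
  have c0: "C 0 0 \<noteq> 0"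
  proof
    assume "C 0 0 = 0"
    hence "qf {..<N} C (unitv 0) = 0" using qf_unitv[of "{..<N}" 0 C] N by simp
    moreover have "unitv 0 \<in> cvec L {..<N}" using L.unitv_cvec[of 0 "{..<N}"] N by simp
    ultimately have "(unitv 0 :: nat \<Rightarrow> 'u) = (\<lambda>_. 0)" using anC unfolding aniso_def by blast
    from fun_cong[OF this, of 0] show False by (simp add: unitv_def)
  qed
  define b where "b = (\<Sum>j\<in>{1..<N}. (C 0 j + C j 0) * t j)"
  define c where "c = qf {1..<N} C t"
  have CE: "C i j \<in> E" if "i < N" "j < N" for i j using C[OF that] LE by blast
  have bm: "b \<in> E" unfolding b_def using CE tE N by (intro mems) auto
  have cm: "c \<in> E" unfolding c_def qf_def using CE tE by (intro mems) auto
  define z where "z = b / C 0 0"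
  define n where "n = c / C 0 0"
  have zn: "z \<in> E" "n \<in> E" unfolding z_def n_def using bm cm CE[of 0 0] N by (auto intro: mems)
  obtain T where "poly [:n, z, 1:] T = 0" using alg_closed_imp_poly_has_root[of "[:n, z, 1:]"] by auto
  hence T: "T * T + z * T + n = 0" by (simp add: algebra_simps)
  define u where "u = (\<lambda>i. if i = 0 then T else if i < N then t i else 0)"
  have qu: "qf {..<N} C u = 0"
  proof -
    have "qf {1..<N} C u = c" unfolding c_def u_def by (intro qf_cong) auto
    moreover have "(\<Sum>j\<in>{1..<N}. (C 0 j + C j 0) * u j) = b" unfolding b_def u_def by (intro sum.cong) auto
    ultimately have "qf {..<N} C u = C 0 0 * T\<^sup>2 + b * T + c"
      using qf_insert_first[of N C u] N by (simp add: u_def)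
    also have "\<dots> = C 0 0 * (T * T + z * T + n)" using c0 by (simp add: z_def n_def field_simps power2_eq_square)
    finally show ?thesis using T by simp
  qed
  have t1: "t 1 \<noteq> 0"
  proof
    assume "t 1 = 0"
    moreover have "[:0, 1:] \<in> pol (tower L t 1)"
      using subfld_tower[OF sL, of t 1] by (intro subfld.pols) (auto intro: subfld.zero_mem subfld.one_mem)
    moreover have "transc (tower L t 1) (t 1)" using t unfolding indep_def by blast
    ultimately have "poly [:0, 1:] (t 1) = 0 \<longrightarrow> [:0, 1::'u:] = 0" unfolding transc_def by blast
    thus False using \<open>t 1 = 0\<close> by simp
  qed
  hence u0: "u \<noteq> (\<lambda>_. 0)" using N by (auto simp: u_def fun_eq_iff intro!: exI[of _ 1])
  have TE: "T \<notin> E"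
  proof
    assume "T \<in> E"
    hence "u \<in> cvec E {..<N}" using tE N unfolding u_def cvec_def by auto
    thus False using anCE qu u0 unfolding aniso_def by blast
  qed
  interpret Q: quadratic E T z n using zn T TE by unfold_locales auto
  have "roomy E" unfolding E_def using roomy_tower[OF sL t] .
  hence "roomy (qext E T)" using Q.roomy_qext unfolding roomy_def by blast
  moreover have "L \<subseteq> qext E T" using LE Q.base_qext by blast
  moreover have "\<not> aniso (qext E T) {..<N} C"
  proof -
    have "u \<in> cvec (qext E T) {..<N}" using tE N Q.base_qext Q.gen_qext unfolding u_def cvec_def by auto
    thus ?thesis using qu u0 unfolding aniso_def by blast
  qed
  ultimately have hE: "hyp (qext E T) I A" using h by blast
  obtain i where i: "i \<in> I" using I(2) by blast
  define w where "w = (unitv i :: 'a \<Rightarrow> 'u)"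
  have wL: "w \<in> cvec L I" unfolding w_def using L.unitv_cvec[OF i] .
  have w0: "w \<noteq> (\<lambda>_. 0)" unfolding w_def by (auto simp: unitv_def fun_eq_iff)
  define k where "k = qf I A w"
  have k0: "k \<noteq> 0" using an wL w0 unfolding aniso_def k_def by blast
  have kL: "k \<in> L" unfolding k_def using L.qf_mem[OF A wL] .
  have wE: "w \<in> cvec E I" using wL cvec_mono[OF LE] by blast
  obtain v where v: "v \<in> cvec E I" "qf I A v = n * k" "bf I A v w = z * k"
    using Q.hyp_quadratic[OF I(1) AE anE hE wE] unfolding k_def by blast
  \<comment> \<open>The multiple of \<open>C\<close> whose first coefficient is \<open>k\<close>,
    the value of \<open>A\<close> at \<open>w\<close>.\<close>
  define C1 where "C1 = (\<lambda>i j. (k / C 0 0) * C i j)"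
  have qC1: "qf {..<N} C1 x = (k / C 0 0) * qf {..<N} C x" for x
    unfolding C1_def qf_def by (simp add: sum_distrib_left algebra_simps)
  show ?thesis
  proof (rule subform_dim[where C = C1 and v = "\<lambda>i. v i + t 0 * w i", OF sL t I(1) A an])
    show "C1 i j \<in> L" if "i < N" "j < N" for i j
      unfolding C1_def using C[OF that] C[of 0 0] kL N by (intro L.mems) auto
    show "aniso L {..<N} C1" using anC k0 c0 unfolding aniso_def qC1 by simp
    show "(\<lambda>i. v i + t 0 * w i) \<in> cvec (tower L t N) I"
      using v(1) wE tE[of 0] N unfolding E_def[symmetric] by (intro comb_cvec) auto
    have "qf I A (\<lambda>i. v i + t 0 * w i) = (k / C 0 0) * (C 0 0 * (t 0)\<^sup>2 + b * t 0 + c)"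
      unfolding qf_comb v(2,3) k_def[symmetric] using c0 by (simp add: z_def n_def field_simps)
    also have "C 0 0 * (t 0)\<^sup>2 + b * t 0 + c = qf {..<N} C t"
      using qf_insert_first[of N C t] N by (simp add: b_def c_def)
    finally show "qf I A (\<lambda>i. v i + t 0 * w i) = qf {..<N} C1 t" unfolding qC1 .
  qed
qed

lemma red_mono:
  assumes "red L I I' A e i j" "subfld L'" "L \<subseteq> L'"
  shows "red L' I I' A e i j"
proof -
  interpret R: red L I I' A e i j by fact
  interpret L': subfld L' by fact
  show ?thesis
    by unfold_locales (use R.fin R.A_mem R.e cvec_mono[OF assms(3)] R.iso R.I' R.ei R.bj assms(3) in blast)+
qed

text \<open>Isotropic vectors over \<open>L\<close> are split off as long as there are any, and the
  hypothesis on larger fields passes to the smaller form. An anisotropic remainder has fewer than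
  \<open>N\<close> variables, so by \<open>function_field_dim\<close> it is empty. In the borderline
  case \<open>card I = N\<close> the assumed isotropic vector provides the first reduction.\<close>

lemma descent:
  fixes L :: "'u::alg_closed_field set"
  assumes L: "roomy L" and C: "\<And>i j. i < N \<Longrightarrow> j < N \<Longrightarrow> C i j \<in> L" and N: "2 \<le> N" and anC: "aniso L {..<N} C"
    and "finite I" "\<forall>i\<in>I. \<forall>j\<in>I. A i j \<in> L" "nonsing L I A"
    and "card I < N \<or> card I \<le> N \<and> \<not> aniso L I A"
    and "\<And>L'. roomy L' \<Longrightarrow> L \<subseteq> L' \<Longrightarrow> \<not> aniso L' {..<N} C \<Longrightarrow> hyp L' I A"
  shows "hyp L I A"
  using assms(5-)
proof (induction "card I" arbitrary: I A rule: less_induct)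
  case less
  interpret subfld L using L unfolding roomy_def by blast
  show ?case
  proof (cases "aniso L I A")
    case True
    have "I = {}"
    proof (rule ccontr)
      assume "I \<noteq> {}"
      hence "N \<le> card I" using function_field_dim[OF L less.prems(1) _ less.prems(2) True C N anC less.prems(5)] by blast
      thus False using less.prems(4) True by auto
    qed
    thus ?thesis unfolding hyp_def
      by (intro exI[of _ "{\<lambda>_. 0}"] exI[of _ 0]) (auto simp: zero_cvec lsub_def dimge_def)
  next
    case False
    then obtain e where e: "e \<in> cvec L I" "e \<noteq> (\<lambda>_. 0)" "qf I A e = 0" unfolding aniso_def by blast
    obtain i j where ij: "i \<in> I" "j \<in> I" "i \<noteq> j" "e i \<noteq> 0" "beta I A e j \<noteq> 0"
      using nonsing_isotropic_coordinates[OF less.prems(1,3) e] by blast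
    define I' where "I' = I - {i, j}"
    have I': "I = insert i (insert j I')" "i \<notin> I'" "j \<notin> I'" unfolding I'_def using ij by auto
    have red: "red L I I' A e i j"
      by unfold_locales (fact less.prems(1,2) e ij I')+
    interpret R: red L I I' A e i j by (rule red)
    show ?thesis
    proof (rule R.red_hyp, rule less.hyps)
      show "card I' < card I" using R.card_I by simp
      show "finite I'" by (rule R.finI')
      show "\<forall>k\<in>I'. \<forall>l\<in>I'. R.A' k l \<in> L" by (rule R.A'_mem)
      show "nonsing L I' R.A'" using R.nonsing_red less.prems(3) .
      show "card I' < N \<or> card I' \<le> N \<and> \<not> aniso L I' R.A'" using R.card_I less.prems(4) by auto
      fix L' assume L': "roomy L'" "L \<subseteq> L'" "\<not> aniso L' {..<N} C"
      interpret R': red L' I I' A e i j using red_mono[OF red _ L'(2)] L'(1) unfolding roomy_def by blast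
      show "hyp L' I' R.A'" using R'.hyp_red less.prems(5)[OF L'] .
    qed
  qed
qed

section \<open>Removing blocks of variables one at a time\<close>

lemma sum_shift: "sum f {b..<b + N} = (\<Sum>i<N. f (b + i))" for b N :: nat
  using sum.atLeastLessThan_shift_0[of f b "b + N"] by (simp add: lessThan_atLeast0)

lemma qf_shift: "qf {b..<b + N} A v = qf {..<N} (\<lambda>i j. A (b + i) (b + j)) (\<lambda>i. v (b + i))" for b N :: nat
  unfolding qf_def sum_shift ..

lemma bf_shift:
  "bf {b..<b + N} A v w = bf {..<N} (\<lambda>i j. A (b + i) (b + j)) (\<lambda>i. v (b + i)) (\<lambda>i. w (b + i))" for b N :: nat
  unfolding bf_def sum_shift ..

context subfld
begin

definition shiftv :: "nat \<Rightarrow> nat \<Rightarrow> (nat \<Rightarrow> 'u) \<Rightarrow> nat \<Rightarrow> 'u" where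
  "shiftv b N v = (\<lambda>i. if b \<le> i \<and> i < b + N then v (i - b) else 0)"

lemma shiftv_cvec: "v \<in> cvec L {..<N} \<Longrightarrow> shiftv b N v \<in> cvec L {b..<b + N}"
  unfolding shiftv_def cvec_def by auto

lemma shiftv_eq: "v \<in> cvec L {..<N} \<Longrightarrow> shiftv b N v (b + i) = v i"
  unfolding shiftv_def cvec_def by auto

lemma shiftv_lmap: "lmap L (cvec L {..<N}) (cvec L {b..<b + N}) (shiftv b N)"
  unfolding lmap_def using shiftv_cvec by (auto simp: shiftv_def)

lemma hyp_shift:
  fixes b N :: nat
  assumes "hyp L {..<N} (\<lambda>i j. A (b + i) (b + j))"
  shows "hyp L {b..<b + N} A"
proof (rule hyp_transport[OF assms shiftv_lmap one_mem zero_mem])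
  fix v assume v: "v \<in> cvec L {..<N}"
  show "v = (\<lambda>_. 0)" if "shiftv b N v = (\<lambda>_. 0)"
  proof
    fix i show "v i = 0" using shiftv_eq[OF v, of b i] that by simp
  qed
  show "qf {b..<b + N} A (shiftv b N v) = 0" if "qf {..<N} (\<lambda>i j. A (b + i) (b + j)) v = 0"
    unfolding qf_shift shiftv_eq[OF v] using that .
qed simp

lemma nonsing_shift:
  fixes b N :: nat
  assumes "nonsing L {..<N} (\<lambda>i j. A (b + i) (b + j))"
  shows "nonsing L {b..<b + N} A"
  unfolding nonsing_def
proof (intro ballI impI)
  fix v assume v: "v \<in> cvec L {b..<b + N}" "\<forall>w\<in>cvec L {b..<b + N}. bf {b..<b + N} A v w = 0"
  have c: "(\<lambda>i. v (b + i)) \<in> cvec L {..<N}" using v(1) unfolding cvec_def by simp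
  have "bf {..<N} (\<lambda>i j. A (b + i) (b + j)) (\<lambda>i. v (b + i)) w = 0" if w: "w \<in> cvec L {..<N}" for w
  proof -
    have "bf {b..<b + N} A v (shiftv b N w) = 0" using v(2) shiftv_cvec[OF w, of b] by blast
    thus ?thesis unfolding bf_shift shiftv_eq[OF w] .
  qed
  hence 0: "(\<lambda>i. v (b + i)) = (\<lambda>_. 0)" using assms c unfolding nonsing_def by blast
  have "v i = 0" for i
  proof (cases "i \<in> {b..<b + N}")
    case True thus ?thesis using fun_cong[OF 0, of "i - b"] by simp
  next
    case False thus ?thesis using v(1) unfolding cvec_def by blast
  qed
  thus "v = (\<lambda>_. 0)" by blast
qed

end

text \<open>Over the function field of the last block \<open>C\<close> that block is hyperbolic and can be cancelled, so
  the induction hypothesis makes the form in the first \<open>n\<close> variables hyperbolic there. As this form is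
  too small to have a multiple of \<open>C\<close> as a subform, it is already hyperbolic over \<open>F\<close>.\<close>

lemma hyp_of_blocks:
  fixes F :: "'u::alg_closed_field set" and A :: "nat \<Rightarrow> nat \<Rightarrow> 'u"
  assumes "roomy F" "2 \<le> N"
    and "\<And>k l. k < n + N * R \<Longrightarrow> l < n + N * R \<Longrightarrow> A k l \<in> F"
    and "\<And>r k l. r < R \<Longrightarrow> k < n + N * r \<Longrightarrow> n + N * r \<le> l \<Longrightarrow> l < n + N * Suc r \<Longrightarrow> A k l = 0 \<and> A l k = 0"
    and "\<And>r L. r < R \<Longrightarrow> roomy L \<Longrightarrow> F \<subseteq> L \<Longrightarrow> nonsing L {..<N} (\<lambda>i j. A (n + N * r + i) (n + N * r + j))"
    and "\<And>r L. r < R \<Longrightarrow> roomy L \<Longrightarrow> F \<subseteq> L \<Longrightarrow> \<not> aniso L {..<N} (\<lambda>i j. A (n + N * r + i) (n + N * r + j)) \<Longrightarrow>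
      hyp L {..<N} (\<lambda>i j. A (n + N * r + i) (n + N * r + j))"
    and "\<And>L. roomy L \<Longrightarrow> F \<subseteq> L \<Longrightarrow> nonsing L {..<n} A"
    and "n < N \<or> n \<le> N \<and> \<not> aniso F {..<n} A"
    and "\<And>L. roomy L \<Longrightarrow> F \<subseteq> L \<Longrightarrow> hyp L {..<n + N * R} A"
  shows "hyp F {..<n} A"
  using assms
proof (induction R arbitrary: F)
  case 0
  thus ?case by auto
next
  case (Suc R)
  let ?b = "n + N * R"
  let ?C = "\<lambda>i j. A (?b + i) (?b + j)"
  have cancel: "hyp L {..<?b} A" if L: "roomy L" "F \<subseteq> L" "\<not> aniso L {..<N} ?C" for L
  proof -
    interpret subfld L using L(1) unfolding roomy_def by blast
    have e: "{..<?b} \<union> {?b..<?b + N} = {..<n + N * Suc R}" by auto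
    show ?thesis
    proof (rule hyp_cancel[of "{?b..<?b + N}" "{..<?b}"])
      show "nonsing L {?b..<?b + N} A" using Suc.prems(5)[OF lessI L(1,2)] by (rule nonsing_shift)
      show "hyp L {?b..<?b + N} A" using Suc.prems(6)[OF lessI L] by (rule hyp_shift)
      show "hyp L ({..<?b} \<union> {?b..<?b + N}) A" unfolding e using Suc.prems(9)[OF L(1,2)] .
      show "\<forall>k\<in>{..<?b} \<union> {?b..<?b + N}. \<forall>l\<in>{..<?b} \<union> {?b..<?b + N}. A k l \<in> L"
        unfolding e using Suc.prems(3) L(2) by auto
      show "\<forall>k\<in>{..<?b}. \<forall>l\<in>{?b..<?b + N}. A k l = 0 \<and> A l k = 0"
        using Suc.prems(4)[OF lessI] by auto
    qed auto
  qed
  have main: "hyp L {..<n} A" if L: "roomy L" "F \<subseteq> L" "\<not> aniso L {..<N} ?C" for L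
  proof (rule Suc.IH[OF L(1) Suc.prems(2)])
    show "A k l \<in> L" if "k < n + N * R" "l < n + N * R" for k l
      using Suc.prems(3)[of k l] that L(2) by auto
    show "A k l = 0 \<and> A l k = 0" if "r < R" "k < n + N * r" "n + N * r \<le> l" "l < n + N * Suc r" for r k l
      using Suc.prems(4)[of r k l] that by simp
    show "nonsing L' {..<N} (\<lambda>i j. A (n + N * r + i) (n + N * r + j))"
      if "r < R" "roomy L'" "L \<subseteq> L'" for r L'
      using Suc.prems(5)[of r L'] that L(2) by auto
    show "hyp L' {..<N} (\<lambda>i j. A (n + N * r + i) (n + N * r + j))"
      if "r < R" "roomy L'" "L \<subseteq> L'" "\<not> aniso L' {..<N} (\<lambda>i j. A (n + N * r + i) (n + N * r + j))" for r L'
      using Suc.prems(6)[of r L'] that L(2) by auto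
    show "nonsing L' {..<n} A" if "roomy L'" "L \<subseteq> L'" for L'
      using Suc.prems(7)[of L'] that L(2) by auto
    show "n < N \<or> n \<le> N \<and> \<not> aniso L {..<n} A"
      using Suc.prems(8) aniso_mono[of L "{..<n}" A F] L(2) by auto
    show "hyp L' {..<n + N * R} A" if "roomy L'" "L \<subseteq> L'" for L'
      using cancel[of L'] that L aniso_mono[of L' "{..<N}" ?C L] by auto
  qed
  show ?case
  proof (cases "aniso F {..<N} ?C")
    \<comment> \<open>\<open>F\<close> then plays the role of a function field of the last block
      itself.\<close>
    case False
    thus ?thesis using main[OF Suc.prems(1)] by blast
  next
    case True
    show ?thesis
    proof (rule descent[OF Suc.prems(1) _ Suc.prems(2) True])
      show "?C i j \<in> F" if "i < N" "j < N" for i j using Suc.prems(3) that by simp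
      show "\<forall>i\<in>{..<n}. \<forall>j\<in>{..<n}. A i j \<in> F" using Suc.prems(3) by (simp add: trans_less_add1)
      show "nonsing F {..<n} A" using Suc.prems(7)[OF Suc.prems(1)] by blast
      show "card {..<n} < N \<or> card {..<n} \<le> N \<and> \<not> aniso F {..<n} A" using Suc.prems(8) by simp
    qed (use main in auto)
  qed
qed

section \<open>Round forms\<close>

definition similar :: "'u::field set \<Rightarrow> nat \<Rightarrow> (nat \<Rightarrow> nat \<Rightarrow> 'u) \<Rightarrow> 'u \<Rightarrow> bool" where
  "similar L N A g \<longleftrightarrow> (\<exists>s. lmap L (cvec L {..<N}) (cvec L {..<N}) s \<and>
     (\<forall>v\<in>cvec L {..<N}. qf {..<N} A (s v) = g * qf {..<N} A v))"

text \<open>Roundness is the property of Pfister forms through which isotropy implies hyperbolicity;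
  it is inherited by \<open>double_form\<close>.\<close>

definition round_form :: "'u::field set \<Rightarrow> nat \<Rightarrow> (nat \<Rightarrow> nat \<Rightarrow> 'u) \<Rightarrow> bool" where
  "round_form L N A \<longleftrightarrow> (\<forall>x\<in>cvec L {..<N}. qf {..<N} A x \<noteq> 0 \<longrightarrow> similar L N A (qf {..<N} A x))"

text \<open>The orthogonal sum of \<open>A\<close> and \<open>b A\<close>, the step from an n-fold
  to an (n+1)-fold Pfister form.\<close>

definition double_form :: "nat \<Rightarrow> (nat \<Rightarrow> nat \<Rightarrow> 'u::field) \<Rightarrow> 'u \<Rightarrow> nat \<Rightarrow> nat \<Rightarrow> 'u" where
  "double_form N A b i j = (if i < N \<and> j < N then A i j
     else if N \<le> i \<and> N \<le> j then b * A (i - N) (j - N) else 0)"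

section \<open>Coordinates of an orthogonal sum\<close>

definition lo :: "nat \<Rightarrow> (nat \<Rightarrow> 'u::field) \<Rightarrow> nat \<Rightarrow> 'u" where
  "lo n v = (\<lambda>i. if i < n then v i else 0)"

definition hi :: "nat \<Rightarrow> nat \<Rightarrow> (nat \<Rightarrow> 'u::field) \<Rightarrow> nat \<Rightarrow> 'u" where
  "hi n m v = (\<lambda>i. if i < m then v (n + i) else 0)"

definition join :: "nat \<Rightarrow> nat \<Rightarrow> (nat \<Rightarrow> 'u::field) \<Rightarrow> (nat \<Rightarrow> 'u) \<Rightarrow> nat \<Rightarrow> 'u" where
  "join n m x y = (\<lambda>i. if i < n then x i else if i < n + m then y (i - n) else 0)"

lemma lo_join: "x \<in> cvec L {..<n} \<Longrightarrow> lo n (join n m x y) = x"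
  and hi_join: "y \<in> cvec L {..<m} \<Longrightarrow> hi n m (join n m x y) = y"
  unfolding lo_def hi_def join_def cvec_def by (auto simp: fun_eq_iff)

lemma lo_comb: "lo n (\<lambda>i. v i + c * w i) = (\<lambda>i. lo n v i + c * lo n w i)"
  and hi_comb: "hi n m (\<lambda>i. v i + c * w i) = (\<lambda>i. hi n m v i + c * hi n m w i)"
  and join_comb: "join n m (\<lambda>i. x i + c * x' i) (\<lambda>i. y i + c * y' i) = (\<lambda>i. join n m x y i + c * join n m x' y' i)"
  unfolding lo_def hi_def join_def by auto

lemma lo_cvec: "v \<in> cvec L {..<n + m} \<Longrightarrow> lo n v \<in> cvec L {..<n}"
  and hi_cvec: "v \<in> cvec L {..<n + m} \<Longrightarrow> hi n m v \<in> cvec L {..<m}"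
  and join_cvec: "x \<in> cvec L {..<n} \<Longrightarrow> y \<in> cvec L {..<m} \<Longrightarrow> join n m x y \<in> cvec L {..<n + m}"
  unfolding lo_def hi_def join_def cvec_def by auto

lemma lo_hi_zero:
  assumes "v \<in> cvec L {..<n + m}" "lo n v = (\<lambda>_. 0)" "hi n m v = (\<lambda>_. 0)"
  shows "v = (\<lambda>_. 0)"
proof
  fix i
  consider "i < n" | "n \<le> i" "i < n + m" | "n + m \<le> i" by linarith
  thus "v i = 0"
  proof cases
    case 1 thus ?thesis using fun_cong[OF assms(2), of i] by (simp add: lo_def)
  next
    case 2 thus ?thesis using fun_cong[OF assms(3), of "i - n"] by (simp add: hi_def split: if_splits)
  next
    case 3 thus ?thesis using assms(1) by (simp add: cvec_def)
  qed
qed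

lemma sum_split_add: "sum f {..<n + m} = sum f {..<n} + (\<Sum>i<m. f (n + i))" for n m :: nat
proof -
  have e: "{..<n + m} = {..<n} \<union> {n..<n + m}" by auto
  have "sum f ({..<n} \<union> {n..<n + m}) = sum f {..<n} + sum f {n..<n + m}"
    by (rule sum.union_disjoint) auto
  thus ?thesis unfolding e sum_shift .
qed

lemma qf_double: "qf {..<N + N} (double_form N A b) v = qf {..<N} A (lo N v) + b * qf {..<N} A (hi N N v)"
proof -
  have "qf {..<N + N} (double_form N A b) v
    = (\<Sum>i<N. \<Sum>j<N. A i j * v i * v j) + (\<Sum>i<N. \<Sum>j<N. b * A i j * v (N + i) * v (N + j))"
    unfolding qf_def sum_split_add by (simp add: double_form_def)
  thus ?thesis unfolding qf_def lo_def hi_def by (simp add: sum_distrib_left mult.assoc)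
qed

section \<open>Similarity factors\<close>

context subfld
begin

lemma lmap_comp: "lmap L V Y f \<Longrightarrow> lmap L Y Z g \<Longrightarrow> lmap L V Z (g \<circ> f)"
  unfolding lmap_def by auto

lemma lmap_scale: "c \<in> L \<Longrightarrow> lmap L V (cvec L I) f \<Longrightarrow> lmap L V (cvec L I) (\<lambda>v i. c * f v i)"
  unfolding lmap_def by (auto simp: algebra_simps intro!: scale_cvec)

lemma lmap_add:
  "c \<in> L \<Longrightarrow> lmap L V (cvec L I) f \<Longrightarrow> lmap L V (cvec L I) g \<Longrightarrow> lmap L V (cvec L I) (\<lambda>v i. f v i + c * g v i)"
  unfolding lmap_def by (auto simp: algebra_simps intro!: comb_cvec)

lemma lmap_join:
  "lmap L V (cvec L {..<n}) f \<Longrightarrow> lmap L V (cvec L {..<m}) g \<Longrightarrow> lmap L V (cvec L {..<n + m}) (\<lambda>v. join n m (f v) (g v))"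
  unfolding lmap_def by (auto simp: join_comb[symmetric] intro!: join_cvec)

lemma lmap_lo: "lmap L (cvec L {..<n + m}) (cvec L {..<n}) (lo n)"
  and lmap_hi: "lmap L (cvec L {..<n + m}) (cvec L {..<m}) (hi n m)"
  unfolding lmap_def using lo_cvec hi_cvec by (auto simp: lo_comb hi_comb)

text \<open>The composition has factor \<open>g * h\<close>, and scaling by \<open>1 / h\<close>
  divides this by the square of \<open>h\<close>.\<close>

lemma similar_mult_div:
  assumes "similar L N A g" "similar L N A h" "h \<in> L" "h \<noteq> 0"
  shows "similar L N A (g / h)"
proof -
  obtain s t where s: "lmap L (cvec L {..<N}) (cvec L {..<N}) s" "\<forall>v\<in>cvec L {..<N}. qf {..<N} A (s v) = g * qf {..<N} A v"
    and t: "lmap L (cvec L {..<N}) (cvec L {..<N}) t" "\<forall>v\<in>cvec L {..<N}. qf {..<N} A (t v) = h * qf {..<N} A v"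
    using assms unfolding similar_def by blast
  have "lmap L (cvec L {..<N}) (cvec L {..<N}) (\<lambda>v i. (1 / h) * (s \<circ> t) v i)"
    using lmap_scale[OF divide_mem[OF one_mem assms(3)] lmap_comp[OF t(1) s(1)]] .
  moreover have "qf {..<N} A (\<lambda>i. (1 / h) * (s \<circ> t) v i) = g / h * qf {..<N} A v" if "v \<in> cvec L {..<N}" for v
    using s(2) t(2) lmapD(1)[OF t(1) that] that assms(4) unfolding qf_scale
    by (simp add: power2_eq_square)
  ultimately show ?thesis unfolding similar_def by blast
qed

lemma similar_double:
  assumes "similar L N A g"
  shows "similar L (N + N) (double_form N A b) g"
proof -
  obtain s where s: "lmap L (cvec L {..<N}) (cvec L {..<N}) s" "\<forall>v\<in>cvec L {..<N}. qf {..<N} A (s v) = g * qf {..<N} A v"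
    using assms unfolding similar_def by blast
  let ?S = "\<lambda>v. join N N ((s \<circ> lo N) v) ((s \<circ> hi N N) v)"
  have m: "lmap L (cvec L {..<N + N}) (cvec L {..<N + N}) ?S"
    by (intro lmap_join lmap_comp[OF lmap_lo] lmap_comp[OF lmap_hi] s(1))
  have "qf {..<N + N} (double_form N A b) (?S v) = g * qf {..<N + N} (double_form N A b) v"
    if v: "v \<in> cvec L {..<N + N}" for v
    using lmapD(1)[OF s(1) lo_cvec[OF v]] lmapD(1)[OF s(1) hi_cvec[OF v]] s(2) lo_cvec[OF v] hi_cvec[OF v]
    unfolding qf_double by (simp add: lo_join hi_join algebra_simps)
  thus ?thesis using m unfolding similar_def by blast
qed

text \<open>With \<open>s = \<rho>(x)\<close>, \<open>r = \<rho>(y)\<close> and \<open>t = b r\<close>, the form \<open>\<langle>s, t\<rangle>\<close> is isometric to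
  \<open>(s + t) \<langle>1, s t\<rangle>\<close> by \<open>s (u - t v)\<^sup>2 + t (u + s v)\<^sup>2 = (s + t) (u\<^sup>2 + s t v\<^sup>2)\<close>.\<close>

lemma round_double:
  assumes A: "\<forall>i\<in>{..<N}. \<forall>j\<in>{..<N}. A i j \<in> L" and rnd: "round_form L N A" and b: "b \<in> L"
  shows "round_form L (N + N) (double_form N A b)"
  unfolding round_form_def
proof (intro ballI impI)
  fix w assume w: "w \<in> cvec L {..<N + N}" and nz: "qf {..<N + N} (double_form N A b) w \<noteq> 0"
  let ?q = "qf {..<N} A" and ?V = "cvec L {..<N}" and ?V2 = "cvec L {..<N + N}"
  define s where "s = ?q (lo N w)"
  define r where "r = ?q (hi N N w)"
  have g: "qf {..<N + N} (double_form N A b) w = s + b * r" unfolding qf_double s_def r_def ..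
  have sr: "s \<in> L" "r \<in> L" unfolding s_def r_def using qf_mem[OF A] lo_cvec[OF w] hi_cvec[OF w] by auto
  have ss: "similar L N A s" if "s \<noteq> 0"
    using rnd lo_cvec[OF w] that unfolding round_form_def s_def by blast
  have sr': "similar L N A r" if "r \<noteq> 0"
    using rnd hi_cvec[OF w] that unfolding round_form_def r_def by blast
  consider "r = 0" | "r \<noteq> 0" "s = 0" | "r \<noteq> 0" "s \<noteq> 0" by blast
  thus "similar L (N + N) (double_form N A b) (qf {..<N + N} (double_form N A b) w)"
  proof cases
    case 1
    thus ?thesis using ss nz unfolding g by (intro similar_double) auto
  next
    case 2
    obtain f where f: "lmap L ?V ?V f" "\<forall>v\<in>?V. ?q (f v) = r * ?q v"
      using sr'[OF 2(1)] unfolding similar_def by blast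
    \<comment> \<open>With \<open>s = 0\<close> the factor is \<open>b * r\<close>: the two halves
      are exchanged, and the extra \<open>b\<close> in the first component balances the
      \<open>b\<close> of the second summand.\<close>
    let ?S = "\<lambda>v. join N N (\<lambda>i. b * (f \<circ> hi N N) v i) ((f \<circ> lo N) v)"
    have m: "lmap L ?V2 ?V2 ?S"
      by (intro lmap_join lmap_scale b lmap_comp[OF lmap_lo] lmap_comp[OF lmap_hi] f(1))
    have "qf {..<N + N} (double_form N A b) (?S v) = (s + b * r) * qf {..<N + N} (double_form N A b) v"
      if v: "v \<in> ?V2" for v
    proof -
      note fm = lmapD(1)[OF f(1) lo_cvec[OF v]] lmapD(1)[OF f(1) hi_cvec[OF v]]
      have "lo N (?S v) = (\<lambda>i. b * f (hi N N v) i)" "hi N N (?S v) = f (lo N v)"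
        using lo_join[OF scale_cvec[OF fm(2) b]] hi_join[OF fm(1)] by simp_all
      thus ?thesis using f(2) lo_cvec[OF v] hi_cvec[OF v] 2(2)
        unfolding qf_double by (simp add: qf_scale power2_eq_square algebra_simps)
    qed
    thus ?thesis using m unfolding similar_def g by blast
  next
    case 3
    obtain f where f: "lmap L ?V ?V f" "\<forall>v\<in>?V. ?q (f v) = r * ?q v"
      using sr'[OF 3(1)] unfolding similar_def by blast
    obtain h where h: "lmap L ?V ?V h" "\<forall>v\<in>?V. ?q (h v) = s * ?q v"
      using ss[OF 3(2)] unfolding similar_def by blast
    define t where "t = b * r"
    have t: "t \<in> L" unfolding t_def using b sr by (intro mems)
    \<comment> \<open>A similarity with factor \<open>1 / (s * r)\<close>. It rewrites the summand
      \<open>b q\<close> as \<open>s t q\<close>, the shape required by the identity for binary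
      forms.\<close>
    define k where "k = (\<lambda>v i. (1 / (s * r)) * (h \<circ> f) v i)"
    have k: "lmap L ?V ?V k" unfolding k_def using sr by (intro lmap_scale lmap_comp[OF f(1) h(1)] mems)
    have qk: "?q (k v) = ?q v / (s * r)" if "v \<in> ?V" for v
      unfolding k_def qf_scale using f h lmapD(1)[OF f(1) that] that 3 by (simp add: power2_eq_square field_simps)
    define p where "p = (\<lambda>v i. lo N v i + (- t) * (k \<circ> hi N N) v i)"
    define q where "q = (\<lambda>v i. lo N v i + s * (k \<circ> hi N N) v i)"
    have p: "lmap L ?V2 ?V p" and q: "lmap L ?V2 ?V q"
      unfolding p_def q_def by (intro lmap_add lmap_lo lmap_comp[OF lmap_hi k] uminus_mem t sr)+
    let ?S = "\<lambda>v. join N N ((h \<circ> p) v) ((f \<circ> q) v)"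
    have m: "lmap L ?V2 ?V2 ?S"
      by (intro lmap_join lmap_comp[OF p h(1)] lmap_comp[OF q f(1)])
    have "qf {..<N + N} (double_form N A b) (?S v) = (s + b * r) * qf {..<N + N} (double_form N A b) v"
      if v: "v \<in> ?V2" for v
    proof -
      let ?u = "lo N v" and ?x = "k (hi N N v)"
      have pq: "p v \<in> ?V" "q v \<in> ?V" using lmapD(1)[OF p v] lmapD(1)[OF q v] .
      have "lo N (?S v) = h (p v)" "hi N N (?S v) = f (q v)"
        using lo_join[OF lmapD(1)[OF h(1) pq(1)]] hi_join[OF lmapD(1)[OF f(1) pq(2)]] by simp_all
      hence "qf {..<N + N} (double_form N A b) (?S v) = s * ?q (p v) + t * ?q (q v)"
        unfolding qf_double t_def using h(2) f(2) pq by simp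
      also have "?q (p v) = ?q ?u - t * bf {..<N} A ?u ?x + t\<^sup>2 * ?q ?x"
        unfolding p_def comp_def qf_comb by simp
      also have "?q (q v) = ?q ?u + s * bf {..<N} A ?u ?x + s\<^sup>2 * ?q ?x"
        unfolding q_def comp_def qf_comb by simp
      also have "s * (?q ?u - t * bf {..<N} A ?u ?x + t\<^sup>2 * ?q ?x) + t * (?q ?u + s * bf {..<N} A ?u ?x + s\<^sup>2 * ?q ?x)
        = (s + t) * (?q ?u + s * t * ?q ?x)" by (simp add: power2_eq_square algebra_simps)
      also have "s * t * ?q ?x = b * ?q (hi N N v)"
        unfolding qk[OF hi_cvec[OF v]] t_def using 3 by simp
      finally show ?thesis unfolding qf_double t_def .
    qed
    thus ?thesis using m unfolding similar_def g by blast
  qed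
qed

text \<open>The graph of a similarity with factor \<open>- b\<close> is totally isotropic of
  dimension \<open>N\<close>.\<close>

lemma hyp_double:
  assumes "similar L N A (- b)"
  shows "hyp L {..<N + N} (double_form N A b)"
proof -
  obtain s where s: "lmap L (cvec L {..<N}) (cvec L {..<N}) s" "\<forall>v\<in>cvec L {..<N}. qf {..<N} A (s v) = - b * qf {..<N} A v"
    using assms unfolding similar_def by blast
  let ?V = "cvec L {..<N}" and ?g = "\<lambda>v. join N N (s v) v"
  have id: "lmap L ?V ?V (\<lambda>v. v)" unfolding lmap_def by simp
  have g: "lmap L ?V (cvec L {..<N + N}) ?g" by (rule lmap_join[OF s(1) id])
  have h: "hi N N (?g v) = v" if "v \<in> ?V" for v using hi_join[OF that] .
  have inj: "v = (\<lambda>_. 0)" if "v \<in> ?V" "?g v = (\<lambda>_. 0)" for v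
    using h[OF that(1)] unfolding that(2) by (simp add: hi_def)
  have "dimge L ?V N" using dimge_cvec[of "{..<N}"] by simp
  hence "dimge L (?g ` ?V) N" using dimge_image[OF _ g] inj by blast
  moreover have "lsub L (?g ` ?V)" by (rule lsub_image[OF lsub_cvec g one_mem])
  moreover have "?g ` ?V \<subseteq> cvec L {..<N + N}" using lmapD(1)[OF g] by blast
  moreover have "qf {..<N + N} (double_form N A b) (?g v) = 0" if "v \<in> ?V" for v
    unfolding qf_double h[OF that] lo_join[OF lmapD(1)[OF s(1) that]] using s(2) that by simp
  ultimately show ?thesis unfolding hyp_def by (intro exI[of _ "?g ` ?V"] exI[of _ N]) auto
qed

text \<open>It suffices that \<open>- b\<close> is a similarity factor. An isotropic vector either
  shows \<open>- b\<close> as a quotient of two values, both similarity factors by roundness, or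
  makes \<open>A\<close> itself isotropic. In the latter case nonsingularity makes \<open>A\<close>
  universal, so \<open>- b\<close> is a value.\<close>

lemma isotropic_double_hyp:
  assumes A: "\<forall>i\<in>{..<N}. \<forall>j\<in>{..<N}. A i j \<in> L" and rnd: "round_form L N A"
    and ns: "nonsing L {..<N} A" and b: "b \<in> L" "b \<noteq> 0"
    and iso: "\<not> aniso L {..<N + N} (double_form N A b)"
  shows "hyp L {..<N + N} (double_form N A b)"
proof (rule hyp_double)
  let ?q = "qf {..<N} A" and ?V = "cvec L {..<N}"
  obtain w where w: "w \<in> cvec L {..<N + N}" "w \<noteq> (\<lambda>_. 0)" "?q (lo N w) + b * ?q (hi N N w) = 0"
    using iso unfolding aniso_def qf_double by blast
  have lh: "lo N w \<in> ?V" "hi N N w \<in> ?V" using lo_cvec[OF w(1)] hi_cvec[OF w(1)] .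
  show "similar L N A (- b)"
  proof (cases "?q (hi N N w) = 0")
    case False
    have e: "?q (lo N w) / ?q (hi N N w) = - b" using False w(3) by (simp add: field_simps eq_neg_iff_add_eq_0)
    hence "?q (lo N w) \<noteq> 0" using b by auto
    hence "similar L N A (?q (lo N w))" "similar L N A (?q (hi N N w))"
      using rnd lh False unfolding round_form_def by auto
    thus ?thesis using similar_mult_div[of N A "?q (lo N w)" "?q (hi N N w)"] qf_mem[OF A lh(2)] False e by simp
  next
    case True
    have "\<exists>e\<in>?V. e \<noteq> (\<lambda>_. 0) \<and> ?q e = 0"
    proof (cases "hi N N w = (\<lambda>_. 0)")
      case False thus ?thesis using True lh by blast
    next
      case h0: True
      have "lo N w \<noteq> (\<lambda>_. 0)" using lo_hi_zero[OF w(1) _ h0] w(2) by blast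
      thus ?thesis using w(3) lh True by auto
    qed
    then obtain e where e: "e \<in> ?V" "e \<noteq> (\<lambda>_. 0)" "?q e = 0" by blast
    then obtain f where f: "f \<in> ?V" "bf {..<N} A e f \<noteq> 0" using ns unfolding nonsing_def by blast
    \<comment> \<open>As \<open>e\<close> is isotropic, the value at \<open>f + c e\<close> is
      affine in \<open>c\<close>; this choice makes it \<open>- b\<close>.\<close>
    define c where "c = (- b - ?q f) / bf {..<N} A f e"
    have c: "c \<in> L" unfolding c_def using b qf_mem[OF A f(1)] bf_mem[OF A f(1) e(1)] by (intro mems)
    have "?q (\<lambda>i. f i + c * e i) = - b"
      unfolding qf_comb e(3) c_def using f(2) bf_commute[of "{..<N}" A e f] by simp
    moreover have "(\<lambda>i. f i + c * e i) \<in> ?V" using f(1) e(1) c by (rule comb_cvec)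
    ultimately show ?thesis using rnd b unfolding round_form_def by (metis neg_equal_0_iff_equal)
  qed
qed

text \<open>The form \<open>[1, a]\<close> is the norm of the algebra with basis 1, \<theta> and
  relation \<theta>^2 = \<theta> - a. The map \<open>s\<close> is multiplication by
  \<open>x\<close>, and the norm is multiplicative.\<close>

lemma round_binary:
  fixes A :: "nat \<Rightarrow> nat \<Rightarrow> 'u"
  assumes a: "a \<in> L" and A: "A 0 0 = 1" "A 0 1 = 1" "A 1 0 = 0" "A 1 1 = a"
  shows "round_form L 2 A"
  unfolding round_form_def
proof (intro ballI impI)
  have q: "qf {..<2} A v = v 0 * v 0 + v 0 * v 1 + a * v 1 * v 1" for v :: "nat \<Rightarrow> 'u"
    unfolding qf_def using A by (simp add: numeral_2_eq_2 algebra_simps)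
  fix x :: "nat \<Rightarrow> 'u" assume x: "x \<in> cvec L {..<2}"
  define s where "s = (\<lambda>(v :: nat \<Rightarrow> 'u) (i :: nat). if i = 0 then x 0 * v 0 - a * x 1 * v 1
    else if i = 1 then x 0 * v 1 + x 1 * v 0 + x 1 * v 1 else (0::'u))"
  have "s v \<in> cvec L {..<2}" if "v \<in> cvec L {..<2}" for v
  proof -
    have "x 0 \<in> L" "x 1 \<in> L" "v 0 \<in> L" "v 1 \<in> L" using x that unfolding cvec_def by auto
    thus ?thesis unfolding s_def cvec_def using a by (auto intro!: mems)
  qed
  moreover have "s (\<lambda>i. v i + c * w i) = (\<lambda>i. s v i + c * s w i)" for v w c
    by (rule ext) (simp add: s_def distrib_left distrib_right right_diff_distrib mult.assoc mult.left_commute[of c])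
  ultimately have "lmap L (cvec L {..<2}) (cvec L {..<2}) s"
    unfolding lmap_def by blast
  moreover have "qf {..<2} A (s v) = qf {..<2} A x * qf {..<2} A v" for v
    unfolding q s_def by (simp add: algebra_simps)
  ultimately show "similar L 2 A (qf {..<2} A x)" unfolding similar_def by blast
qed

lemma isotropic_binary_hyp:
  assumes "\<not> aniso L {..<2::nat} A"
  shows "hyp L {..<2} A"
proof -
  obtain e where e: "e \<in> cvec L {..<2}" "e \<noteq> (\<lambda>_. 0)" "qf {..<2} A e = 0"
    using assms unfolding aniso_def by blast
  let ?W = "{\<lambda>i. c * e i | c. c \<in> L}"
  have "?W \<subseteq> cvec L {..<2}" using scale_cvec[OF e(1)] by auto
  moreover have "lsub L ?W"
    unfolding lsub_def
  proof (intro conjI ballI)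
    show "(\<lambda>_. 0) \<in> ?W" using zero_mem by force
    fix v w c assume "v \<in> ?W" "w \<in> ?W" and c: "c \<in> L"
    then obtain x y where "x \<in> L" "y \<in> L" "v = (\<lambda>i. x * e i)" "w = (\<lambda>i. y * e i)" by blast
    moreover from this have "x + c * y \<in> L" using c by (intro mems)
    ultimately show "(\<lambda>i. v i + c * w i) \<in> ?W"
      by (intro CollectI exI[of _ "x + c * y"]) (simp add: algebra_simps)
  qed
  moreover have "\<forall>v\<in>?W. qf {..<2} A v = 0" using e(3) by (auto simp: qf_scale)
  moreover have "dimge L ?W 1"
  proof (rule dimgeI)
    fix Fs :: "((nat \<Rightarrow> 'u) \<Rightarrow> 'u) set" assume "finite Fs" "card Fs < 1"
    hence "Fs = {}" by simp
    moreover have "e \<in> ?W" using one_mem by (intro CollectI exI[of _ 1]) auto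
    ultimately show "\<exists>v\<in>?W. v \<noteq> (\<lambda>_. 0) \<and> (\<forall>f\<in>Fs. f v = 0)" using e(2) by blast
  qed
  ultimately show ?thesis unfolding hyp_def by (intro exI[of _ ?W] exI[of _ 1]) auto
qed

end

section \<open>A universal field\<close>

text \<open>Polynomials in countably many variables supply the independent elements for generic
  values; the closure of their fraction field supplies roots for the quadratic extensions.\<close>

type_synonym 'a mpol = "(nat \<Rightarrow>\<^sub>0 nat) \<Rightarrow>\<^sub>0 'a"
type_synonym 'a univ = "'a mpol fract alg_closure"

definition emb :: "'a::field mpol \<Rightarrow> 'a univ" where
  "emb p = to_ac (Fract p 1)"

definition iota :: "'a::field \<Rightarrow> 'a univ" where
  "iota a = emb (Poly_Mapping.single 0 a)"

definition gen :: "nat \<Rightarrow> 'a::field univ" where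
  "gen k = emb (Poly_Mapping.single (Poly_Mapping.single k 1) 1)"

section \<open>Algebraic independence of the variables\<close>

definition vars_below :: "nat \<Rightarrow> 'a::field mpol set" where
  "vars_below k = {p. \<forall>m\<in>Poly_Mapping.keys p. \<forall>i\<ge>k. Poly_Mapping.lookup m i = 0}"

lemma emb_add: "emb (p + q) = emb p + emb q"
  and emb_mult: "emb (p * q) = emb p * emb q"
  and emb_uminus: "emb (- p) = - emb p"
  and emb_one: "emb 1 = 1"
  and emb_zero: "emb 0 = 0"
  unfolding emb_def by (simp_all flip: to_ac_add to_ac_mult to_ac_minus to_ac_1 to_ac_0
    add: Zero_fract_def One_fract_def)

lemma emb_eq_0: "emb p = 0 \<Longrightarrow> p = 0"
proof -
  assume "emb p = 0"
  hence "Fract p 1 = 0" unfolding emb_def by simp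
  thus "p = 0" by (simp add: Zero_fract_def eq_fract)
qed

lemma emb_sum: "emb (sum f I) = (\<Sum>i\<in>I. emb (f i))"
  by (induction I rule: infinite_finite_induct) (auto simp: emb_zero emb_add)

lemma iota_add: "iota (a + b) = iota a + iota b"
  and iota_mult: "iota (a * b) = iota a * iota b"
  and iota_uminus: "iota (- a) = - iota a"
  and iota_one: "iota 1 = 1"
  and iota_zero: "iota 0 = 0"
  unfolding iota_def
  by (simp_all add: single_add emb_add emb_one emb_zero emb_uminus single_uminus flip: emb_mult mult_single)
    (simp add: mult_single)

lemma iota_diff: "iota (a - b) = iota a - iota b"
  using iota_add[of a "- b"] iota_uminus[of b] by simp

lemma iota_eq_0: "iota a = 0 \<Longrightarrow> a = 0"
  unfolding iota_def by (metis emb_eq_0 lookup_single_eq lookup_zero)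

lemma iota_inj: "iota a = iota b \<Longrightarrow> a = b"
  using iota_eq_0[of "a - b"] iota_diff[of a b] by simp

lemma iota_inverse: "iota (inverse a) = inverse (iota a)"
proof (cases "a = 0")
  case False
  hence "iota (inverse a) * iota a = 1" unfolding iota_mult[symmetric] by (simp add: iota_one)
  thus ?thesis by (metis inverse_unique mult.commute)
qed (simp add: iota_zero)

lemma subfld_iota: "subfld (range iota)"
proof
  show "1 \<in> range iota" using iota_one by (metis rangeI)
qed (auto simp flip: iota_diff iota_mult iota_inverse)

lemma vars_below_closed:
  shows "p \<in> vars_below k \<Longrightarrow> q \<in> vars_below k \<Longrightarrow> p + q \<in> vars_below k"
    and "p \<in> vars_below k \<Longrightarrow> q \<in> vars_below k \<Longrightarrow> p * q \<in> vars_below k"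
    and "p \<in> vars_below k \<Longrightarrow> - p \<in> vars_below k"
    and "Poly_Mapping.single 0 a \<in> vars_below k"
    and "Poly_Mapping.single (Poly_Mapping.single j 1) 1 \<in> vars_below (Suc j)"
    and "j \<le> k \<Longrightarrow> p \<in> vars_below j \<Longrightarrow> p \<in> vars_below k"
proof -
  show "p \<in> vars_below k \<Longrightarrow> q \<in> vars_below k \<Longrightarrow> p + q \<in> vars_below k"
    unfolding vars_below_def using keys_add[of p q] by blast
  show "p \<in> vars_below k \<Longrightarrow> - p \<in> vars_below k"
    unfolding vars_below_def by (simp add: in_keys_iff)
  show "j \<le> k \<Longrightarrow> p \<in> vars_below j \<Longrightarrow> p \<in> vars_below k"
    unfolding vars_below_def by auto
  assume pq: "p \<in> vars_below k" "q \<in> vars_below k"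
  show "p * q \<in> vars_below k"
    unfolding vars_below_def
  proof (intro CollectI ballI allI impI)
    fix m i assume "m \<in> Poly_Mapping.keys (p * q)" and i: "k \<le> i"
    then obtain a b where "a \<in> Poly_Mapping.keys p" "b \<in> Poly_Mapping.keys q" "m = a + b"
      using keys_mult[of p q] by blast
    thus "Poly_Mapping.lookup m i = 0" using pq i unfolding vars_below_def by (auto simp: lookup_add)
  qed
qed (auto simp: vars_below_def lookup_single split: if_splits)

lemma lookup_single_times:
  fixes p :: "'a::field mpol"
  shows "Poly_Mapping.lookup (Poly_Mapping.single e 1 * p) (e + m) = Poly_Mapping.lookup p m"
proof -
  have "p = (\<Sum>k\<in>Poly_Mapping.keys p. Poly_Mapping.single k (Poly_Mapping.lookup p k))"
    by (rule poly_mapping_eqI) (simp add: lookup_sum lookup_single when_def in_keys_iff)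
  hence "Poly_Mapping.single e 1 * p = (\<Sum>k\<in>Poly_Mapping.keys p. Poly_Mapping.single (e + k) (Poly_Mapping.lookup p k))"
    by (metis (no_types, lifting) mult_1 mult_single sum.cong sum_distrib_left)
  thus ?thesis by (simp add: lookup_sum lookup_single when_def in_keys_iff)
qed

lemma keys_single_times:
  fixes p :: "'a::field mpol"
  shows "x \<in> Poly_Mapping.keys (Poly_Mapping.single e 1 * p) \<Longrightarrow> \<exists>m\<in>Poly_Mapping.keys p. x = e + m"
  using keys_mult[of "Poly_Mapping.single e 1" p] by (auto split: if_splits)

text \<open>The exponent of variable \<open>k\<close> in a monomial reveals the summand it belongs
  to, so no cancellation occurs between different \<open>j\<close>.\<close>

lemma sum_var_powers_zero:
  assumes p: "\<And>j. p j \<in> vars_below k"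
    and z: "(\<Sum>j\<le>n. Poly_Mapping.single (Poly_Mapping.single k j) 1 * p j) = (0 :: 'a::field mpol)"
    and j: "j \<le> n"
  shows "p j = 0"
proof (rule poly_mapping_eqI)
  fix m
  show "Poly_Mapping.lookup (p j) m = Poly_Mapping.lookup 0 m"
  proof (cases "m \<in> Poly_Mapping.keys (p j)")
    case False thus ?thesis by (simp add: in_keys_iff)
  next
    case True
    hence mk: "Poly_Mapping.lookup m k = 0" using p[of j] unfolding vars_below_def by blast
    let ?x = "Poly_Mapping.single k j + m"
    have xk: "Poly_Mapping.lookup ?x k = j" using mk by (simp add: lookup_add)
    have "Poly_Mapping.lookup (Poly_Mapping.single (Poly_Mapping.single k i) 1 * p i) ?x = 0" if "i \<noteq> j" for i
    proof (rule ccontr)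
      assume "\<not> ?thesis"
      then obtain m' where m': "m' \<in> Poly_Mapping.keys (p i)" "?x = Poly_Mapping.single k i + m'"
        using keys_single_times[of ?x "Poly_Mapping.single k i" "p i"] by (auto simp: in_keys_iff)
      have "Poly_Mapping.lookup m' k = 0" using p[of i] m'(1) unfolding vars_below_def by blast
      hence "Poly_Mapping.lookup ?x k = i" unfolding m'(2) by (simp add: lookup_add)
      thus False using xk that by simp
    qed
    hence "Poly_Mapping.lookup (\<Sum>i\<le>n. Poly_Mapping.single (Poly_Mapping.single k i) 1 * p i) ?x
      = (\<Sum>i\<le>n. if i = j then Poly_Mapping.lookup (p j) m else 0)"
      unfolding lookup_sum by (intro sum.cong refl) (auto simp: lookup_single_times)
    also have "\<dots> = Poly_Mapping.lookup (p j) m" using j by simp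
    finally show ?thesis unfolding z by simp
  qed
qed

text \<open>The fractions in the first \<open>k\<close> variables; this field contains stage
  \<open>k\<close> of the tower built from \<open>gen\<close>.\<close>

definition frac_below :: "nat \<Rightarrow> 'a::field univ set" where
  "frac_below k = {emb p / emb q | p q. p \<in> vars_below k \<and> q \<in> vars_below k \<and> q \<noteq> 0}"

lemma subfld_frac_below: "subfld (frac_below k)"
proof
  show "(1 :: 'a univ) \<in> frac_below k"
    unfolding frac_below_def
    by (intro CollectI exI[of _ 1]) (use vars_below_closed(4)[of 1 k] in \<open>simp add: emb_one\<close>)
next
  fix a b :: "'a univ" assume "a \<in> frac_below k" "b \<in> frac_below k"
  then obtain p q p' q' where a: "p \<in> vars_below k" "q \<in> vars_below k" "q \<noteq> 0" "a = emb p / emb q"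
    and b: "p' \<in> vars_below k" "q' \<in> vars_below k" "q' \<noteq> 0" "b = emb p' / emb q'"
    unfolding frac_below_def by blast
  have nz: "emb q \<noteq> 0" "emb q' \<noteq> 0" using a b emb_eq_0 by blast+
  have "a - b = emb (p * q' + - (p' * q)) / emb (q * q')" "a * b = emb (p * p') / emb (q * q')"
    unfolding a(4) b(4) emb_add emb_mult emb_uminus using nz by (simp_all add: field_simps)
  moreover have "p * q' + - (p' * q) \<in> vars_below k" "p * p' \<in> vars_below k" "q * q' \<in> vars_below k" "q * q' \<noteq> 0"
    using a b by (auto intro!: vars_below_closed(1-3) simp del: add_uminus_conv_diff)
  ultimately show "a - b \<in> frac_below k" "a * b \<in> frac_below k" unfolding frac_below_def by blast+
next
  fix a :: "'a univ" assume "a \<in> frac_below k"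
  then obtain p q where a: "p \<in> vars_below k" "q \<in> vars_below k" "q \<noteq> 0" "a = emb p / emb q"
    unfolding frac_below_def by blast
  show "inverse a \<in> frac_below k"
  proof (cases "p = 0")
    case True
    hence "inverse a = emb p / emb q" using a by (simp add: emb_zero)
    thus ?thesis using a unfolding frac_below_def by blast
  next
    case False
    have "inverse a = emb q / emb p" using a by simp
    thus ?thesis using a False unfolding frac_below_def by blast
  qed
qed

text \<open>After multiplication with the product of all denominators, a relation for
  \<open>gen k\<close> becomes a vanishing combination of powers of variable \<open>k\<close> with
  coefficients free of that variable.\<close>

lemma transc_gen: "transc (frac_below k) (gen k :: 'a::field univ)"
  unfolding transc_def
proof (intro ballI impI)
  fix f :: "'a univ poly" assume f: "f \<in> pol (frac_below k)" "poly f (gen k) = 0"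
  have "\<forall>j. \<exists>p q. p \<in> vars_below k \<and> q \<in> vars_below k \<and> q \<noteq> 0 \<and> coeff f j = emb p / emb q"
    using f(1) unfolding pol_def frac_below_def by blast
  then obtain p q where pq: "\<And>j. p j \<in> vars_below k \<and> q j \<in> vars_below k \<and> q j \<noteq> 0 \<and> coeff f j = emb (p j) / emb (q j)"
    by metis
  define n where "n = degree f"
  define r where "r = (\<lambda>j. if j \<le> n then p j * (\<Prod>i\<in>{..n} - {j}. q i) else 0)"
  have one: "(1 :: 'a mpol) \<in> vars_below k" using vars_below_closed(4)[of 1 k] by simp
  have prod_mem: "prod q I \<in> vars_below k" for I
    by (induction I rule: infinite_finite_induct) (use one pq vars_below_closed(2) in auto)
  have r_mem: "r j \<in> vars_below k" for j
    unfolding r_def using vars_below_closed(4)[of 0 k] by (auto intro!: vars_below_closed(2) prod_mem simp: pq)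
  have r: "emb (r j) = emb (prod q {..n}) * coeff f j" if "j \<le> n" for j
  proof -
    have "prod q {..n} = q j * (\<Prod>i\<in>{..n} - {j}. q i)" using that by (simp add: prod.remove)
    moreover have "emb (q j) \<noteq> 0" using pq emb_eq_0 by blast
    ultimately show ?thesis using pq[of j] that by (simp add: r_def emb_mult)
  qed
  have genp: "gen k ^ j = emb (Poly_Mapping.single (Poly_Mapping.single k j) 1 :: 'a mpol)" for j
  proof (induction j)
    case 0 thus ?case by (simp add: emb_one)
  next
    case (Suc j)
    have "Poly_Mapping.single k (Suc j) = Poly_Mapping.single k 1 + Poly_Mapping.single k j"
      by (simp flip: single_add)
    thus ?case using Suc unfolding gen_def by (simp flip: emb_mult add: mult_single)
  qed
  have "emb (\<Sum>j\<le>n. Poly_Mapping.single (Poly_Mapping.single k j) 1 * r j) = (\<Sum>j\<le>n. gen k ^ j * (emb (prod q {..n}) * coeff f j))"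
    unfolding emb_sum emb_mult genp[symmetric] using r by (intro sum.cong refl) auto
  also have "\<dots> = emb (prod q {..n}) * poly f (gen k)"
    unfolding poly_altdef n_def sum_distrib_left by (intro sum.cong refl) (simp add: ac_simps)
  finally have "emb (\<Sum>j\<le>n. Poly_Mapping.single (Poly_Mapping.single k j) 1 * r j) = 0" using f(2) by simp
  hence "(\<Sum>j\<le>n. Poly_Mapping.single (Poly_Mapping.single k j) 1 * r j) = 0" by (rule emb_eq_0)
  hence r0: "r j = 0" if "j \<le> n" for j using sum_var_powers_zero[of r k n j] r_mem that by blast
  have "emb (prod q {..n}) \<noteq> 0"
  proof -
    have "prod q {..n} \<noteq> 0" using pq by simp
    thus ?thesis using emb_eq_0 by blast
  qed
  hence "coeff f j = 0" if "j \<le> n" for j using r[OF that] r0[OF that] by (simp add: emb_zero)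
  hence "lead_coeff f = 0" unfolding n_def by blast
  thus "f = 0" by simp
qed

text \<open>Each tower stage lies in the fractions of the earlier variables, and transcendence over
  the larger field implies it over the smaller one.\<close>

lemma roomy_iota: "roomy (range (iota :: 'a::field \<Rightarrow> 'a univ))"
proof -
  have sub: "tower (range iota) (gen :: nat \<Rightarrow> 'a univ) k \<subseteq> frac_below k" for k
  proof (induction k)
    case 0
    show ?case
    proof
      fix x :: "'a univ" assume "x \<in> tower (range iota) gen 0"
      then obtain a where "x = iota a" by auto
      hence "x = emb (Poly_Mapping.single 0 a) / emb 1" by (simp add: iota_def emb_one)
      thus "x \<in> frac_below 0" unfolding frac_below_def
        using vars_below_closed(4)[of a 0] vars_below_closed(4)[of "1::'a" 0]
        by (intro CollectI exI[of _ "Poly_Mapping.single 0 a"] exI[of _ 1]) simp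
    qed
  next
    case (Suc k)
    interpret S: subfld "frac_below (Suc k) :: 'a univ set" by (rule subfld_frac_below)
    have "frac_below k \<subseteq> (frac_below (Suc k) :: 'a univ set)"
      unfolding frac_below_def using vars_below_closed(6)[of k "Suc k"] by fastforce
    hence 1: "tower (range iota) (gen :: nat \<Rightarrow> 'a univ) k \<subseteq> frac_below (Suc k)" using Suc by blast
    have "gen k = emb (Poly_Mapping.single (Poly_Mapping.single k 1) 1) / emb (1 :: 'a mpol)"
      by (simp add: gen_def emb_one)
    hence 2: "(gen k :: 'a univ) \<in> frac_below (Suc k)" unfolding frac_below_def
      using vars_below_closed(5)[of k] vars_below_closed(4)[of "1::'a" "Suc k"]
      by (intro CollectI exI[of _ "Poly_Mapping.single (Poly_Mapping.single k 1) 1"] exI[of _ 1]) simp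
    have 3: "poly p (gen k) \<in> frac_below (Suc k)" if "p \<in> pol (tower (range iota) (gen :: nat \<Rightarrow> 'a univ) k)" for p
      using that 1 by (intro S.poly_mem 2) (auto simp: pol_def)
    show ?case
    proof
      fix x :: "'a univ" assume "x \<in> tower (range iota) gen (Suc k)"
      then obtain p q where "p \<in> pol (tower (range iota) (gen :: nat \<Rightarrow> 'a univ) k)"
        "q \<in> pol (tower (range iota) (gen :: nat \<Rightarrow> 'a univ) k)"
        "x = poly p (gen k) / poly q (gen k)" unfolding tower.simps fext_def by blast
      thus "x \<in> frac_below (Suc k)" using 3 S.divide_mem by blast
    qed
  qed
  have "transc (tower (range iota) gen k) (gen k :: 'a univ)" for k
    using transc_gen[of k] sub[of k] unfolding transc_def pol_def by blast
  thus ?thesis unfolding roomy_def indep_def using subfld_iota by blast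
qed

text \<open>\<open>iota\<close> is an isomorphism onto its range, so the isotropic subspace is
  pulled back to the original field.\<close>

lemma hyp_iota:
  assumes "hyp (range iota) {..<n} (\<lambda>i j. iota (A i j :: 'a::field))"
  shows "hyp UNIV {..<n::nat} A"
proof -
  obtain W m where W: "W \<subseteq> cvec (range iota) {..<n}" "lsub (range iota) W"
    "\<forall>v\<in>W. qf {..<n} (\<lambda>i j. iota (A i j)) v = 0" "card {..<n} \<le> 2 * m" "dimge (range iota) W m"
    using assms unfolding hyp_def by blast
  define V where "V = {v. (\<lambda>i. iota (v i)) \<in> W}"
  have retr: "(\<lambda>i. inv_into UNIV iota (w i)) \<in> V \<and> (\<lambda>i. iota (inv_into UNIV iota (w i))) = w" if "w \<in> W" for w
  proof -
    have w: "w \<in> cvec (range iota) {..<n}" using that W(1) by blast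
    have "w i \<in> range iota" for i
    proof (cases "i < n")
      case True thus ?thesis using w unfolding cvec_def by blast
    next
      case False
      hence "w i = iota 0" using w by (simp add: cvec_def iota_zero)
      thus ?thesis by blast
    qed
    hence "(\<lambda>i. iota (inv_into UNIV iota (w i))) = w" by (auto simp: f_inv_into_f)
    thus ?thesis using that unfolding V_def by simp
  qed
  have inv_iota: "inv_into UNIV iota (iota a) = a" for a :: 'a
    using iota_inj by (intro inv_into_f_f injI) auto
  have "V \<subseteq> cvec UNIV {..<n}"
    using W(1) iota_eq_0 unfolding V_def cvec_def by fastforce
  moreover have "lsub UNIV V"
    unfolding lsub_def
  proof (intro conjI ballI)
    show "(\<lambda>_. 0) \<in> V" using lsubD(1)[OF W(2)] unfolding V_def by (simp add: iota_zero)
    fix v w :: "nat \<Rightarrow> 'a" and c assume "v \<in> V" "w \<in> V"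
    thus "(\<lambda>i. v i + c * w i) \<in> V"
      using lsubD(2)[OF W(2), of "\<lambda>i. iota (v i)" "\<lambda>i. iota (w i)" "iota c"]
      unfolding V_def by (simp add: iota_add iota_mult)
  qed
  moreover have "qf {..<n} A v = 0" if "v \<in> V" for v
  proof -
    have s: "iota (sum f I) = (\<Sum>i\<in>I. iota (f i))" for f :: "nat \<Rightarrow> 'a" and I
      by (induction I rule: infinite_finite_induct) (auto simp: iota_zero iota_add)
    have "iota (qf {..<n} A v) = qf {..<n} (\<lambda>i j. iota (A i j)) (\<lambda>i. iota (v i))"
      unfolding qf_def s iota_mult ..
    also have "\<dots> = 0" using W(3) that unfolding V_def by blast
    finally show ?thesis by (rule iota_eq_0)
  qed
  moreover have "dimge UNIV V m"
  proof (rule dimgeI)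
    fix Fs :: "((nat \<Rightarrow> 'a) \<Rightarrow> 'a) set"
    assume Fs: "finite Fs" "card Fs < m" "\<And>f. f \<in> Fs \<Longrightarrow> lfun UNIV V f"
    \<comment> \<open>Functionals travel in the opposite direction: those on the pulled back
      subspace are turned into functionals on \<open>W\<close>.\<close>
    define h where "h = (\<lambda>(f :: (nat \<Rightarrow> 'a) \<Rightarrow> 'a) w. iota (f (\<lambda>i. inv_into UNIV iota (w i))) :: 'a univ)"
    have "lfun (range iota) W (h f)" if f: "f \<in> Fs" for f
      unfolding lfun_def
    proof (intro conjI ballI)
      fix v w and c :: "'a univ" assume v: "v \<in> W" "w \<in> W" and "c \<in> range iota"
      then obtain d where d: "c = iota d" by blast
      have "(\<lambda>i. inv_into UNIV iota (v i + c * w i)) = (\<lambda>i. inv_into UNIV iota (v i) + d * inv_into UNIV iota (w i))"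
      proof
        fix i
        have "v i + c * w i = iota (inv_into UNIV iota (v i) + d * inv_into UNIV iota (w i))"
          using fun_cong[OF conjunct2[OF retr[OF v(1)]], of i] fun_cong[OF conjunct2[OF retr[OF v(2)]], of i]
          by (simp add: iota_add iota_mult d)
        thus "inv_into UNIV iota (v i + c * w i) = inv_into UNIV iota (v i) + d * inv_into UNIV iota (w i)" by (simp add: inv_iota)
      qed
      thus "h f (\<lambda>i. v i + c * w i) = h f v + c * h f w"
        using lfunD(2)[OF Fs(3)[OF f], of "\<lambda>i. inv_into UNIV iota (v i)" "\<lambda>i. inv_into UNIV iota (w i)" d] retr v
        unfolding h_def d by (simp add: iota_add iota_mult)
    qed (auto simp: h_def)
    moreover have "finite (h ` Fs)" "card (h ` Fs) < m" using Fs card_image_le[OF Fs(1), of h] by auto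
    ultimately obtain w where w: "w \<in> W" "w \<noteq> (\<lambda>_. 0)" "\<forall>f\<in>h ` Fs. f w = 0"
      using dimgeD[OF W(5), of "h ` Fs"] by blast
    have "(\<lambda>i. inv_into UNIV iota (w i)) \<noteq> (\<lambda>_. 0)"
    proof
      assume 0: "(\<lambda>i. inv_into UNIV iota (w i)) = (\<lambda>_. 0 :: 'a)"
      have "w = (\<lambda>i. iota (inv_into UNIV iota (w i) :: 'a))" using retr[OF w(1)] by simp
      also have "\<dots> = (\<lambda>_. 0)" using fun_cong[OF 0] by (simp add: iota_zero)
      finally show False using w(2) by blast
    qed
    moreover have "f (\<lambda>i. inv_into UNIV iota (w i)) = 0" if "f \<in> Fs" for f
    proof -
      have "h f w = 0" using w(3) that by blast
      thus ?thesis unfolding h_def by (rule iota_eq_0)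
    qed
    ultimately show "\<exists>v\<in>V. v \<noteq> (\<lambda>_. 0) \<and> (\<forall>f\<in>Fs. f v = 0)" using retr[OF w(1)] by blast
  qed
  ultimately show ?thesis using W(4) unfolding hyp_def by blast
qed

section \<open>Forms given by matrices\<close>

interpretation univ: subfld "UNIV :: 'a::field set"
  by (rule subfld_UNIV)

abbreviation qfm :: "'a mat \<Rightarrow> nat \<Rightarrow> nat \<Rightarrow> 'a" where
  "qfm A \<equiv> (\<lambda>i j. A $$ (i, j))"

abbreviation fvec :: "nat \<Rightarrow> (nat \<Rightarrow> 'a::field) set" where
  "fvec n \<equiv> cvec UNIV {..<n}"

lemma qeval_vec:
  assumes "A \<in> carrier_mat n n"
  shows "qeval A (vec n f) = qf {..<n} (qfm A) f"
  using assms unfolding qeval_def qf_def scalar_prod_def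
  by (simp add: lessThan_atLeast0 scalar_prod_def sum_distrib_left ac_simps)

lemma vec_of_index: "v \<in> carrier_vec n \<Longrightarrow> vec n (\<lambda>i. if i < n then v $ i else 0) = v"
  by auto

lemma invertible_mat_iff_det:
  assumes P: "(P :: 'a::field mat) \<in> carrier_mat n n"
  shows "invertible_mat P \<longleftrightarrow> det P \<noteq> 0"
proof
  assume "invertible_mat P"
  then obtain B where B: "P * B = 1\<^sub>m (dim_row P)" "B * P = 1\<^sub>m (dim_row B)"
    unfolding invertible_mat_def inverts_mat_def by blast
  have "dim_col B = n" using arg_cong[OF B(1), of dim_col] P by simp
  moreover have "dim_row B = n" using arg_cong[OF B(2), of dim_col] P by simp
  ultimately have "B \<in> carrier_mat n n" by auto
  hence "det P * det B = 1" using det_mult[OF P, of B] B(1) P by simp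
  thus "det P \<noteq> 0" by auto
next
  assume "det P \<noteq> 0"
  from det_non_zero_imp_unit[OF P this, of "()"] obtain B where "B \<in> carrier_mat n n" "B * P = 1\<^sub>m n" "P * B = 1\<^sub>m n"
    unfolding Units_def ring_mat_def by auto
  thus "invertible_mat P" using P unfolding invertible_mat_def inverts_mat_def by auto
qed

lemma join_eq_0:
  assumes "x \<in> cvec L {..<n}" "y \<in> cvec L {..<m}" "join n m x y = (\<lambda>_. 0)"
  shows "x = (\<lambda>_. 0) \<and> y = (\<lambda>_. 0)"
proof -
  have "lo n (join n m x y) = (\<lambda>_. 0)" "hi n m (join n m x y) = (\<lambda>_. 0)"
    unfolding assms(3) by (simp_all add: lo_def hi_def)
  thus ?thesis unfolding lo_join[OF assms(1)] hi_join[OF assms(2)] by blast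
qed

lemma lmap_expand:
  assumes s: "lmap UNIV (fvec n) Y s" and f: "f \<in> fvec n"
  shows "s f i = (\<Sum>j<n. f j * s (unitv j) i)"
proof -
  have "s (\<lambda>i. if i < k then f i else 0) i = (\<Sum>j<k. f j * s (unitv j) i)" if "k \<le> n" for k
    using that
  proof (induction k)
    case 0
    have "s (\<lambda>_. 0) = (\<lambda>_. 0)" by (rule lmap_zero[OF s]) (auto simp: univ.zero_cvec)
    thus ?case by simp
  next
    case (Suc k)
    have m: "(\<lambda>i. if i < k then f i else 0) \<in> fvec n" "unitv k \<in> fvec n"
      using Suc.prems by (auto simp: cvec_def unitv_def)
    have e: "(\<lambda>i. if i < Suc k then f i else 0) = (\<lambda>i. (if i < k then f i else 0) + f k * unitv k i)"
      by (auto simp: unitv_def fun_eq_iff less_Suc_eq)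
    show ?case using Suc lmapD(2)[OF s m, of "f k"] unfolding e by simp
  qed
  moreover have "(\<lambda>i. if i < n then f i else 0) = f" using f by (auto simp: cvec_def fun_eq_iff)
  ultimately show ?thesis by (metis order.refl)
qed

text \<open>The bridge from linear maps on index functions to matrices: the images of the unit
  vectors are the columns, and injectivity excludes a vanishing determinant.\<close>

lemma isometricI:
  fixes A B :: "'a::field mat"
  assumes A: "A \<in> carrier_mat n n" and B: "B \<in> carrier_mat n n"
    and s: "lmap UNIV (fvec n) (fvec n) s"
    and inj: "\<And>v. v \<in> fvec n \<Longrightarrow> s v = (\<lambda>_. 0) \<Longrightarrow> v = (\<lambda>_. 0)"
    and q: "\<And>v. v \<in> fvec n \<Longrightarrow> qf {..<n} (qfm B) (s v) = qf {..<n} (qfm A) v"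
  shows "isometric A B"
proof -
  define P where "P = mat n n (\<lambda>(i, j). s (unitv j) i)"
  have P: "P \<in> carrier_mat n n" by (simp add: P_def)
  define F where "F = (\<lambda>v :: 'a vec. \<lambda>i. if i < n then v $ i else 0)"
  have F: "F v \<in> fvec n" for v by (auto simp: F_def cvec_def)
  have Pv: "P *\<^sub>v v = vec n (s (F v))" if v: "v \<in> carrier_vec n" for v
  proof (rule eq_vecI)
    fix i assume i: "i < dim_vec (vec n (s (F v)))"
    have "s (F v) i = (\<Sum>j<n. F v j * s (unitv j) i)" by (rule lmap_expand[OF s F])
    thus "(P *\<^sub>v v) $ i = vec n (s (F v)) $ i"
      using i v by (simp add: P_def scalar_prod_def F_def lessThan_atLeast0 ac_simps)
  qed (simp add: P_def)
  have inv: "det P \<noteq> 0"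
  proof
    assume "det P = 0"
    then obtain v where v: "v \<in> carrier_vec n" "v \<noteq> 0\<^sub>v n" "P *\<^sub>v v = 0\<^sub>v n"
      using det_0_iff_vec_prod_zero_field[OF P] by blast
    have "s (F v) i = 0" for i
    proof (cases "i < n")
      case True
      thus ?thesis using arg_cong[OF v(3), of "\<lambda>x. vec_index x i"] unfolding Pv[OF v(1)] by simp
    next
      case False thus ?thesis using lmapD(1)[OF s F] by (simp add: cvec_def)
    qed
    hence F0: "F v = (\<lambda>_. 0)" using inj[OF F] by blast
    have "v = 0\<^sub>v n"
      by (rule eq_vecI) (use v(1) F0 in \<open>auto simp: F_def fun_eq_iff split: if_splits\<close>)
    thus False using v(2) by blast
  qed
  have "qeval B (P *\<^sub>v v) = qeval A v" if v: "v \<in> carrier_vec n" for v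
  proof -
    have "vec n (F v) = v" unfolding F_def by (rule vec_of_index[OF v])
    hence "qeval A v = qf {..<n} (qfm A) (F v)" using qeval_vec[OF A, of "F v"] by simp
    thus ?thesis unfolding Pv[OF v] qeval_vec[OF B] q[OF F] by simp
  qed
  thus ?thesis using A B P inv invertible_mat_iff_det[OF P] unfolding isometric_def by auto
qed

lemma isometricE:
  fixes A B :: "'a::field mat"
  assumes "isometric A B" "A \<in> carrier_mat n n"
  obtains s where "lmap UNIV (fvec n) (fvec n) s"
    "\<And>v. v \<in> fvec n \<Longrightarrow> s v = (\<lambda>_. 0) \<Longrightarrow> v = (\<lambda>_. 0)"
    "\<And>v. v \<in> fvec n \<Longrightarrow> qf {..<n} (qfm B) (s v) = qf {..<n} (qfm A) v" "B \<in> carrier_mat n n"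
proof -
  obtain P where P: "P \<in> carrier_mat n n" "invertible_mat P" "\<forall>v\<in>carrier_vec n. qeval B (P *\<^sub>v v) = qeval A v"
    and B: "B \<in> carrier_mat n n"
  proof -
    have d: "dim_row A = n" using assms(2) by simp
    from assms(1)[unfolded isometric_def d] have "square_mat B" "n = dim_row B"
      and ex: "\<exists>P\<in>carrier_mat n n. invertible_mat P \<and> (\<forall>v\<in>carrier_vec n. qeval B (P *\<^sub>v v) = qeval A v)"
      by blast+
    hence "B \<in> carrier_mat n n" by auto
    thus ?thesis using ex that by blast
  qed
  define s where "s = (\<lambda>v i. if i < n then (P *\<^sub>v vec n v) $ i else (0::'a))"
  have si: "s v i = (\<Sum>j<n. P $$ (i, j) * v j)" if "i < n" for v i
    using that P(1) by (simp add: s_def scalar_prod_def lessThan_atLeast0)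
  have "lmap UNIV (fvec n) (fvec n) s"
    unfolding lmap_def
  proof (intro conjI ballI ext)
    fix v w c i
    show "s (\<lambda>i. v i + c * w i) i = s v i + c * s w i"
    proof (cases "i < n")
      case True thus ?thesis unfolding si[OF True]
        by (simp add: sum.distrib sum_distrib_left algebra_simps)
    qed (simp add: s_def)
  qed (auto simp: s_def cvec_def)
  moreover have "v = (\<lambda>_. 0)" if v: "v \<in> fvec n" "s v = (\<lambda>_. 0)" for v
  proof -
    have "P *\<^sub>v vec n v = 0\<^sub>v n"
    proof (rule eq_vecI)
      fix i assume "i < dim_vec (0\<^sub>v n :: 'a vec)"
      thus "(P *\<^sub>v vec n v) $ i = 0\<^sub>v n $ i" using fun_cong[OF v(2), of i] by (simp add: s_def)
    qed (use P(1) in simp)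
    moreover have "det P \<noteq> 0" using P(2) invertible_mat_iff_det[OF P(1)] by blast
    ultimately have 0: "vec n v = 0\<^sub>v n"
      using det_0_iff_vec_prod_zero_field[OF P(1)] vec_carrier[of n v] by blast
    show ?thesis
    proof
      fix i show "v i = 0"
      proof (cases "i < n")
        case True thus ?thesis using arg_cong[OF 0, of "\<lambda>x. vec_index x i"] by simp
      next
        case False thus ?thesis using v(1) by (simp add: cvec_def)
      qed
    qed
  qed
  moreover have "qf {..<n} (qfm B) (s v) = qf {..<n} (qfm A) v" if "v \<in> fvec n" for v
  proof -
    have "vec n (s v) = P *\<^sub>v vec n v" using P(1) by (intro eq_vecI) (auto simp: s_def)
    hence "qf {..<n} (qfm B) (s v) = qeval B (P *\<^sub>v vec n v)" using qeval_vec[OF B] by metis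
    thus ?thesis using P(3) qeval_vec[OF assms(2)] by simp
  qed
  ultimately show ?thesis using that B by blast
qed

section \<open>Isometry as an equivalence relation\<close>

lemma isometric_carrier: "isometric A B \<Longrightarrow> A \<in> carrier_mat n n \<Longrightarrow> B \<in> carrier_mat n n"
  unfolding isometric_def by auto

lemma isometric_refl: "A \<in> carrier_mat n n \<Longrightarrow> isometric A A"
  by (rule isometricI[of _ n _ "\<lambda>v. v"]) (auto simp: lmap_def)

lemma isometric_trans [trans]: "isometric A B \<Longrightarrow> isometric B C \<Longrightarrow> isometric A C"
proof -
  assume AB: "isometric A B" and BC: "isometric B C"
  define n where "n = dim_row A"
  have A: "A \<in> carrier_mat n n" using AB unfolding isometric_def n_def by auto
  obtain s where s: "lmap UNIV (fvec n) (fvec n) s"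
    "\<And>v. v \<in> fvec n \<Longrightarrow> s v = (\<lambda>_. 0) \<Longrightarrow> v = (\<lambda>_. 0)"
    "\<And>v. v \<in> fvec n \<Longrightarrow> qf {..<n} (qfm B) (s v) = qf {..<n} (qfm A) v" "B \<in> carrier_mat n n"
    using isometricE[OF AB A] by blast
  obtain t where t: "lmap UNIV (fvec n) (fvec n) t"
    "\<And>v. v \<in> fvec n \<Longrightarrow> t v = (\<lambda>_. 0) \<Longrightarrow> v = (\<lambda>_. 0)"
    "\<And>v. v \<in> fvec n \<Longrightarrow> qf {..<n} (qfm C) (t v) = qf {..<n} (qfm B) v" "C \<in> carrier_mat n n"
    using isometricE[OF BC s(4)] by blast
  show ?thesis
    using lmapD(1)[OF s(1)] s(2,3) t(2,3)
    by (intro isometricI[OF A t(4) univ.lmap_comp[OF s(1) t(1)]]) auto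
qed

lemma isometric_sym: "isometric A B \<Longrightarrow> isometric B A"
proof -
  assume AB: "isometric A B"
  define n where "n = dim_row A"
  have A: "A \<in> carrier_mat n n" and B: "B \<in> carrier_mat n n" using AB unfolding isometric_def n_def by auto
  obtain P where P: "P \<in> carrier_mat n n" "invertible_mat P" "\<forall>v\<in>carrier_vec n. qeval B (P *\<^sub>v v) = qeval A v"
    using AB unfolding isometric_def n_def by blast
  have "det P \<noteq> 0" using P invertible_mat_iff_det by blast
  from det_non_zero_imp_unit[OF P(1) this, of "()"] obtain R where R: "R \<in> carrier_mat n n" "R * P = 1\<^sub>m n" "P * R = 1\<^sub>m n"
    unfolding Units_def ring_mat_def by auto
  have "qeval A (R *\<^sub>v v) = qeval B v" if v: "v \<in> carrier_vec n" for v
  proof -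
    have "P *\<^sub>v (R *\<^sub>v v) = v" using assoc_mult_mat_vec[OF P(1) R(1) v] R(3) v by simp
    thus ?thesis using P(3) mult_mat_vec_carrier[OF R(1) v] by metis
  qed
  moreover have "invertible_mat R" using R P(1) unfolding invertible_mat_def inverts_mat_def by auto
  ultimately show ?thesis using A B R(1) unfolding isometric_def by auto
qed

section \<open>Orthogonal sums and hyperbolic forms\<close>

lemma orth_sum_carrier [simp]:
  "A \<in> carrier_mat n n \<Longrightarrow> B \<in> carrier_mat m m \<Longrightarrow> orth_sum A B \<in> carrier_mat (n + m) (n + m)"
  unfolding orth_sum_def by auto

lemma qf_orth_sum:
  assumes A: "A \<in> carrier_mat n n" and B: "B \<in> carrier_mat m m"
  shows "qf {..<n + m} (qfm (orth_sum A B)) v = qf {..<n} (qfm A) (lo n v) + qf {..<m} (qfm B) (hi n m v)"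
proof -
  have "qf {..<n + m} (qfm (orth_sum A B)) v
    = (\<Sum>i<n. \<Sum>j<n. A $$ (i, j) * v i * v j) + (\<Sum>i<m. \<Sum>j<m. B $$ (i, j) * v (n + i) * v (n + j))"
    unfolding qf_def sum_split_add using A B by (simp add: orth_sum_def)
  thus ?thesis unfolding qf_def by (simp add: lo_def hi_def)
qed

lemma orth_sum_assoc:
  assumes "A \<in> carrier_mat n n" "B \<in> carrier_mat m m" "C \<in> carrier_mat k k"
  shows "orth_sum (orth_sum A B) C = orth_sum A (orth_sum B C)"
  by (rule eq_matI) (use assms in \<open>auto simp: orth_sum_def\<close>)

lemma orth_sum_empty:
  "A \<in> carrier_mat n n \<Longrightarrow> E \<in> carrier_mat 0 0 \<Longrightarrow> orth_sum A E = A"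
  "A \<in> carrier_mat n n \<Longrightarrow> E \<in> carrier_mat 0 0 \<Longrightarrow> orth_sum E A = A"
  by (rule eq_matI; auto simp: orth_sum_def)+

lemma isometric_orth_sum:
  fixes A B :: "'a::field mat"
  assumes AA: "isometric A A'" and BB: "isometric B B'"
  shows "isometric (orth_sum A B) (orth_sum A' B')"
proof -
  define n where "n = dim_row A"
  define m where "m = dim_row B"
  have A: "A \<in> carrier_mat n n" and B: "B \<in> carrier_mat m m"
    using assms unfolding isometric_def n_def m_def by auto
  obtain s where s: "lmap UNIV (fvec n) (fvec n) s"
    "\<And>v. v \<in> fvec n \<Longrightarrow> s v = (\<lambda>_. 0) \<Longrightarrow> v = (\<lambda>_. 0)"
    "\<And>v. v \<in> fvec n \<Longrightarrow> qf {..<n} (qfm A') (s v) = qf {..<n} (qfm A) v" "A' \<in> carrier_mat n n"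
    using isometricE[OF AA A] by blast
  obtain t where t: "lmap UNIV (fvec m) (fvec m) t"
    "\<And>v. v \<in> fvec m \<Longrightarrow> t v = (\<lambda>_. 0) \<Longrightarrow> v = (\<lambda>_. 0)"
    "\<And>v. v \<in> fvec m \<Longrightarrow> qf {..<m} (qfm B') (t v) = qf {..<m} (qfm B) v" "B' \<in> carrier_mat m m"
    using isometricE[OF BB B] by blast
  let ?S = "\<lambda>v. join n m ((s \<circ> lo n) v) ((t \<circ> hi n m) v)"
  have S: "lmap UNIV (fvec (n + m)) (fvec (n + m)) ?S"
    by (intro univ.lmap_join univ.lmap_comp[OF univ.lmap_lo] univ.lmap_comp[OF univ.lmap_hi] s(1) t(1))
  have lh: "lo n (?S v) = s (lo n v)" "hi n m (?S v) = t (hi n m v)" if v: "v \<in> fvec (n + m)" for v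
    using lo_join[OF lmapD(1)[OF s(1) lo_cvec[OF v]]] hi_join[OF lmapD(1)[OF t(1) hi_cvec[OF v]]] by auto
  show ?thesis
  proof (rule isometricI[OF orth_sum_carrier[OF A B] orth_sum_carrier[OF s(4) t(4)] S])
    fix v :: "nat \<Rightarrow> 'a" assume v: "v \<in> fvec (n + m)"
    show "v = (\<lambda>_. 0)" if z: "?S v = (\<lambda>_. 0)"
    proof (rule lo_hi_zero[OF v])
      show "lo n v = (\<lambda>_. 0)" using lh(1)[OF v] s(2)[OF lo_cvec[OF v]] unfolding z by (simp add: lo_def)
      show "hi n m v = (\<lambda>_. 0)" using lh(2)[OF v] t(2)[OF hi_cvec[OF v]] unfolding z by (simp add: hi_def)
    qed
    show "qf {..<n + m} (qfm (orth_sum A' B')) (?S v) = qf {..<n + m} (qfm (orth_sum A B)) v"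
      unfolding qf_orth_sum[OF A B] qf_orth_sum[OF s(4) t(4)] lh[OF v] s(3)[OF lo_cvec[OF v]] t(3)[OF hi_cvec[OF v]] ..
  qed
qed

lemma isometric_orth_sum_comm:
  fixes A B :: "'a::field mat"
  assumes A: "A \<in> carrier_mat n n" and B: "B \<in> carrier_mat m m"
  shows "isometric (orth_sum A B) (orth_sum B A)"
proof -
  let ?S = "\<lambda>v. join m n (hi n m v) (lo n v)"
  have S: "lmap UNIV (fvec (n + m)) (fvec (n + m)) ?S"
    using univ.lmap_join[OF univ.lmap_hi[of n m] univ.lmap_lo[of n m]] by (simp only: add.commute[of m n])
  have BA: "orth_sum B A \<in> carrier_mat (n + m) (n + m)" using orth_sum_carrier[OF B A] by (simp add: add.commute)
  have lh: "lo m (?S v) = hi n m v" "hi m n (?S v) = lo n v" if v: "v \<in> fvec (n + m)" for v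
    using lo_join[OF hi_cvec[OF v]] hi_join[OF lo_cvec[OF v]] by auto
  show ?thesis
  proof (rule isometricI[OF orth_sum_carrier[OF A B] BA S])
    fix v :: "nat \<Rightarrow> 'a" assume v: "v \<in> fvec (n + m)"
    show "v = (\<lambda>_. 0)" if z: "?S v = (\<lambda>_. 0)"
    proof (rule lo_hi_zero[OF v])
      show "lo n v = (\<lambda>_. 0)" using lh(2)[OF v] unfolding z by (simp add: hi_def)
      show "hi n m v = (\<lambda>_. 0)" using lh(1)[OF v] unfolding z by (simp add: lo_def)
    qed
    have "qf {..<n + m} (qfm (orth_sum B A)) (?S v) = qf {..<m + n} (qfm (orth_sum B A)) (?S v)"
      by (simp add: add.commute)
    also have "\<dots> = qf {..<n + m} (qfm (orth_sum A B)) v"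
      unfolding qf_orth_sum[OF A B] qf_orth_sum[OF B A] lh[OF v] by (rule add.commute)
    finally show "qf {..<n + m} (qfm (orth_sum B A)) (?S v) = qf {..<n + m} (qfm (orth_sum A B)) v" .
  qed
qed

lemma hyperbolic_form_carrier [simp]: "hyperbolic_form m \<in> carrier_mat (m + m) (m + m)"
  unfolding hyperbolic_form_def by simp

lemma qf_hyperbolic_form:
  "qf {..<m + m} (qfm (hyperbolic_form m)) v = (\<Sum>i<m. lo m v i * hi m m v i)"
proof -
  have "qf {..<m + m} (qfm (hyperbolic_form m)) v = (\<Sum>i<m. \<Sum>j<m. if j = i then v i * v (m + j) else 0)"
    unfolding qf_def sum_split_add by (simp add: hyperbolic_form_def)
      (intro sum.cong refl, simp add: if_distrib[of "\<lambda>x. x * _"] eq_commute cong: if_cong)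
  also have "\<dots> = (\<Sum>i<m. lo m v i * hi m m v i)" by (intro sum.cong refl) (simp add: lo_def hi_def)
  finally show ?thesis .
qed

text \<open>A permutation of blocks: the coordinates come as \<open>(x, y, x', y')\<close> and are
  rearranged to \<open>(x, x', y, y')\<close>.\<close>

lemma isometric_hyperbolic_add:
  "isometric (orth_sum (hyperbolic_form m) (hyperbolic_form k)) (hyperbolic_form (m + k) :: 'a::field mat)"
proof -
  let ?H = "hyperbolic_form :: nat \<Rightarrow> 'a mat"
  have e: "m + m + (k + k) = (m + k) + (m + k)" by simp
  define a b where "a = (\<lambda>v :: nat \<Rightarrow> 'a. lo (m + m) v)" and "b = (\<lambda>v :: nat \<Rightarrow> 'a. hi (m + m) (k + k) v)"
  define p where "p = (\<lambda>v. join m k ((lo m \<circ> lo (m + m)) v) ((lo k \<circ> hi (m + m) (k + k)) v :: nat \<Rightarrow> 'a))"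
  define q where "q = (\<lambda>v. join m k ((hi m m \<circ> lo (m + m)) v) ((hi k k \<circ> hi (m + m) (k + k)) v :: nat \<Rightarrow> 'a))"
  let ?S = "\<lambda>v. join (m + k) (m + k) (p v) (q v)"
  have pq: "lmap UNIV (fvec (m + m + (k + k))) (fvec (m + k)) p" "lmap UNIV (fvec (m + m + (k + k))) (fvec (m + k)) q"
    unfolding p_def q_def
    by (intro univ.lmap_join univ.lmap_comp[OF univ.lmap_lo univ.lmap_lo] univ.lmap_comp[OF univ.lmap_hi univ.lmap_lo]
        univ.lmap_comp[OF univ.lmap_lo univ.lmap_hi] univ.lmap_comp[OF univ.lmap_hi univ.lmap_hi])+
  have S: "lmap UNIV (fvec (m + m + (k + k))) (fvec (m + m + (k + k))) ?S"
    using univ.lmap_join[OF pq] unfolding e .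
  show ?thesis
  proof (rule isometricI[OF orth_sum_carrier _ S])
    show "?H (m + k) \<in> carrier_mat (m + m + (k + k)) (m + m + (k + k))" unfolding e by simp
    fix v :: "nat \<Rightarrow> 'a" assume v: "v \<in> fvec (m + m + (k + k))"
    have av: "a v \<in> fvec (m + m)" and bv: "b v \<in> fvec (k + k)"
      unfolding a_def b_def using lo_cvec[OF v] hi_cvec[OF v] .
    have lh: "lo (m + k) (?S v) = p v" "hi (m + k) (m + k) (?S v) = q v"
      using lo_join[OF lmapD(1)[OF pq(1) v]] hi_join[OF lmapD(1)[OF pq(2) v]] by auto
    have pe: "p v = join m k (lo m (a v)) (lo k (b v))" and qe: "q v = join m k (hi m m (a v)) (hi k k (b v))"
      unfolding p_def q_def a_def b_def by simp_all
    show "v = (\<lambda>_. 0)" if z: "?S v = (\<lambda>_. 0)"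
    proof -
      have "lo (m + k) (?S v) = (\<lambda>_. 0)" "hi (m + k) (m + k) (?S v) = (\<lambda>_. 0)"
        unfolding z by (simp_all add: lo_def hi_def)
      hence p0: "p v = (\<lambda>_. 0)" and q0: "q v = (\<lambda>_. 0)" unfolding lh .
      have "lo m (a v) = (\<lambda>_. 0) \<and> lo k (b v) = (\<lambda>_. 0)"
        by (rule join_eq_0[OF lo_cvec[OF av] lo_cvec[OF bv]]) (use p0 pe in simp)
      moreover have "hi m m (a v) = (\<lambda>_. 0) \<and> hi k k (b v) = (\<lambda>_. 0)"
        by (rule join_eq_0[OF hi_cvec[OF av] hi_cvec[OF bv]]) (use q0 qe in simp)
      ultimately have "a v = (\<lambda>_. 0)" "b v = (\<lambda>_. 0)" using lo_hi_zero[OF av] lo_hi_zero[OF bv] by auto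
      thus ?thesis using lo_hi_zero[OF v] unfolding a_def b_def by blast
    qed
    have "qf {..<m + m + (k + k)} (qfm (?H (m + k))) (?S v) = (\<Sum>i<m + k. p v i * q v i)"
      unfolding e qf_hyperbolic_form lh ..
    also have "\<dots> = (\<Sum>i<m. lo m (a v) i * hi m m (a v) i) + (\<Sum>i<k. lo k (b v) i * hi k k (b v) i)"
      unfolding sum_split_add pe qe by (simp add: join_def)
    also have "\<dots> = qf {..<m + m + (k + k)} (qfm (orth_sum (?H m) (?H k))) v"
      unfolding qf_orth_sum[OF hyperbolic_form_carrier hyperbolic_form_carrier] qf_hyperbolic_form a_def b_def ..
    finally show "qf {..<m + m + (k + k)} (qfm (?H (m + k))) (?S v)
      = qf {..<m + m + (k + k)} (qfm (orth_sum (?H m) (?H k))) v" .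
  qed simp_all
qed

text \<open>\<open>G\<close> is the Gram matrix of the polar form. Its determinant stays nonzero
  under field embeddings, so nonsingularity carries over to every larger field.\<close>

lemma nonsing_of_det:
  assumes L: "subfld L" and G: "G \<in> carrier_mat n n" "det G \<noteq> 0"
    and B: "\<And>i j. i < n \<Longrightarrow> j < n \<Longrightarrow> B i j + B j i = G $$ (i, j)"
  shows "nonsing L {..<n} B"
  unfolding nonsing_def
proof (intro ballI impI)
  fix v assume v: "v \<in> cvec L {..<n}" "\<forall>w\<in>cvec L {..<n}. bf {..<n} B v w = 0"
  have "G *\<^sub>v vec n v = 0\<^sub>v n"
  proof (rule eq_vecI)
    fix i assume "i < dim_vec (0\<^sub>v n)"
    hence i: "i < n" by simp
    have "0 = bf {..<n} B (unitv i) v"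
      using v(2) subfld.unitv_cvec[OF L, of i "{..<n}"] i bf_commute[of "{..<n}" B] by auto
    also have "\<dots> = (\<Sum>l<n. G $$ (i, l) * v l)"
      using i B bf_unitv[of "{..<n}" i B v] by (simp add: beta_def)
    finally show "(G *\<^sub>v vec n v) $ i = 0\<^sub>v n $ i"
      using i G(1) by (simp add: scalar_prod_def lessThan_atLeast0)
  qed (use G in simp)
  hence 0: "vec n v = 0\<^sub>v n" using det_0_iff_vec_prod_zero_field[OF G(1)] G(2) vec_carrier[of n v] by blast
  show "v = (\<lambda>_. 0)"
  proof
    fix i show "v i = 0"
    proof (cases "i < n")
      case True thus ?thesis using arg_cong[OF 0, of "\<lambda>x. vec_index x i"] by simp
    next
      case False thus ?thesis using v(1) by (simp add: cvec_def)
    qed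
  qed
qed

lemma nonsingular_form_iff:
  assumes "A \<in> carrier_mat n n"
  shows "nonsingular_form A \<longleftrightarrow> det (A + transpose_mat A) \<noteq> 0"
  using assms invertible_mat_iff_det[of "A + transpose_mat A" n]
  unfolding nonsingular_form_def by auto

lemma nonsingular_form_nonsing:
  assumes A: "A \<in> carrier_mat n n" and "nonsingular_form A"
  shows "nonsing UNIV {..<n} (qfm A)"
  using assms nonsingular_form_iff[OF A]
  by (intro nonsing_of_det[OF subfld_UNIV, of "A + transpose_mat A"]) auto

lemma nonsingular_orth_sum:
  assumes A: "A \<in> carrier_mat n n" "nonsingular_form A" and B: "B \<in> carrier_mat m m" "nonsingular_form B"
  shows "nonsingular_form (orth_sum A B)"
proof -
  let ?GA = "A + transpose_mat A" and ?GB = "B + transpose_mat B"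
  have "orth_sum A B + transpose_mat (orth_sum A B) = four_block_mat ?GA (0\<^sub>m n m) (0\<^sub>m m n) ?GB"
    by (rule eq_matI) (use A(1) B(1) in \<open>auto simp: orth_sum_def\<close>)
  moreover have "det (four_block_mat ?GA (0\<^sub>m n m) (0\<^sub>m m n) ?GB) = det ?GA * det ?GB"
    by (rule det_four_block_mat_lower_left_zero) (use A(1) B(1) in auto)
  ultimately show ?thesis
    using A B nonsingular_form_iff[OF A(1)] nonsingular_form_iff[OF B(1)]
      nonsingular_form_iff[OF orth_sum_carrier[OF A(1) B(1)]] by simp
qed

lemma nonsingular_smult:
  assumes A: "A \<in> carrier_mat n n" "nonsingular_form A" and c: "c \<noteq> 0"
  shows "nonsingular_form (c \<cdot>\<^sub>m A)"
proof -
  have "c \<cdot>\<^sub>m A + transpose_mat (c \<cdot>\<^sub>m A) = c \<cdot>\<^sub>m (A + transpose_mat A)"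
    by (rule eq_matI) (use A(1) in \<open>auto simp: algebra_simps\<close>)
  moreover have "c \<cdot>\<^sub>m A \<in> carrier_mat n n" using A(1) by simp
  ultimately show ?thesis
    using nonsingular_form_iff[OF A(1)] nonsingular_form_iff[of "c \<cdot>\<^sub>m A" n] A(2) c by simp
qed

lemma qf_smult:
  assumes "A \<in> carrier_mat n n"
  shows "qf {..<n} (qfm (c \<cdot>\<^sub>m A)) v = c * qf {..<n} (qfm A) v"
proof -
  have "qf {..<n} (qfm (c \<cdot>\<^sub>m A)) v = qf {..<n} (\<lambda>i j. c * A $$ (i, j)) v"
    using assms by (intro qf_cong) auto
  thus ?thesis unfolding qf_def by (simp add: sum_distrib_left mult.assoc)
qed

text \<open>Substituting \<open>(x, x + y)\<close> into \<open>A \<bottom> -A\<close> gives \<open>- b(x, y) - A(y)\<close>, which is linear in \<open>x\<close>.\<close>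

lemma isometric_orth_sum_neg:
  fixes A :: "'a::field mat"
  assumes A: "A \<in> carrier_mat n n" "nonsingular_form A"
  shows "isometric (orth_sum A ((- 1) \<cdot>\<^sub>m A)) (hyperbolic_form n)"
proof -
  let ?Q = "qfm A" and ?I = "{..<n}"
  define y where "y = (\<lambda>(v :: nat \<Rightarrow> 'a) i. hi n n v i + (- 1) * lo n v i)"
  define x where "x = (\<lambda>(v :: nat \<Rightarrow> 'a) i. if i < n then - (beta ?I ?Q (lo n v) i + (\<Sum>j<n. A $$ (i, j) * y v j)) else 0)"
  have y: "lmap UNIV (fvec (n + n)) (fvec n) y"
    unfolding y_def by (intro univ.lmap_add univ.lmap_hi univ.lmap_lo) simp
  have x: "lmap UNIV (fvec (n + n)) (fvec n) x"
    unfolding lmap_def x_def beta_def y_def lo_comb hi_comb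
    by (auto simp: cvec_def fun_eq_iff sum_distrib_left sum.distrib algebra_simps sum_subtractf)
  let ?S = "\<lambda>v. join n n (x v) (y v)"
  have S: "lmap UNIV (fvec (n + n)) (fvec (n + n)) ?S" by (rule univ.lmap_join[OF x y])
  have N: "(- 1) \<cdot>\<^sub>m A \<in> carrier_mat n n" using A by simp
  show ?thesis
  proof (rule isometricI[OF orth_sum_carrier[OF A(1) N] hyperbolic_form_carrier S])
    fix v :: "nat \<Rightarrow> 'a" assume v: "v \<in> fvec (n + n)"
    have lh: "lo n (?S v) = x v" "hi n n (?S v) = y v"
      using lo_join[OF lmapD(1)[OF x v]] hi_join[OF lmapD(1)[OF y v]] by auto
    have h: "hi n n v = (\<lambda>i. lo n v i + 1 * y v i)" by (auto simp: y_def)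
    show "v = (\<lambda>_. 0)" if z: "?S v = (\<lambda>_. 0)"
    proof -
      have "lo n (?S v) = (\<lambda>_. 0)" "hi n n (?S v) = (\<lambda>_. 0)"
        unfolding z by (simp_all add: lo_def hi_def)
      hence x0: "x v = (\<lambda>_. 0)" and y0: "y v = (\<lambda>_. 0)" unfolding lh .
      have "beta ?I ?Q (lo n v) i = 0" if "i < n" for i
        using fun_cong[OF x0, of i] that unfolding x_def y0 by simp
      hence "bf ?I ?Q w (lo n v) = 0" for w unfolding bf_expand by simp
      hence "\<forall>w\<in>fvec n. bf ?I ?Q (lo n v) w = 0" using bf_commute[of ?I ?Q "lo n v"] by simp
      hence l0: "lo n v = (\<lambda>_. 0)"
        using nonsingular_form_nonsing[OF A] lo_cvec[OF v] unfolding nonsing_def by blast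
      moreover have "hi n n v = (\<lambda>_. 0)" using h unfolding l0 y0 by simp
      ultimately show ?thesis using lo_hi_zero[OF v] by blast
    qed
    have "qf {..<n + n} (qfm (hyperbolic_form n)) (?S v) = (\<Sum>i<n. x v i * y v i)"
      unfolding qf_hyperbolic_form lh ..
    also have "\<dots> = - bf ?I ?Q (y v) (lo n v) - qf ?I ?Q (y v)"
      unfolding bf_expand qf_def x_def
      unfolding sum_negf[symmetric] sum_subtractf[symmetric] sum_distrib_left sum_distrib_right
      by (intro sum.cong refl) (simp add: sum_distrib_left sum_distrib_right sum_negf algebra_simps)
    also have "\<dots> = qf {..<n + n} (qfm (orth_sum A ((- 1) \<cdot>\<^sub>m A))) v"
      unfolding qf_orth_sum[OF A(1) N] qf_smult[OF A(1)]
      unfolding h qf_comb bf_commute[of ?I ?Q "y v"] by simp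
    finally show "qf {..<n + n} (qfm (hyperbolic_form n)) (?S v) = qf {..<n + n} (qfm (orth_sum A ((- 1) \<cdot>\<^sub>m A))) v" .
  qed
qed

section \<open>Dual vectors and hyperbolic coordinates\<close>

lemma bf_sum_left: "bf I A (\<lambda>i. \<Sum>j<k. a j * w j i) u = (\<Sum>j<(k::nat). a j * bf I A (w j) u)"
  by (induction k) (auto simp: bf_comb_left)

lemma bf_sum_right: "bf I A u (\<lambda>i. \<Sum>j<k. a j * w j i) = (\<Sum>j<(k::nat). a j * bf I A u (w j))"
  by (induction k) (auto simp: bf_comb_right)

lemma bf_unitv_unitv:
  "finite I \<Longrightarrow> i \<in> I \<Longrightarrow> j \<in> I \<Longrightarrow> bf I A (unitv i) (unitv j) = A i j + A j i"
  by (subst bf_unitv) (auto simp: beta_def unitv_def if_distrib[of "\<lambda>x. _ * x"] cong: if_cong)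

lemma fvec_sum: "(\<And>j. j < k \<Longrightarrow> c j \<in> fvec n) \<Longrightarrow> x \<in> fvec n \<Longrightarrow> (\<lambda>i. x i + (\<Sum>j<(k::nat). a j * c j i)) \<in> fvec n"
  unfolding cvec_def by auto

lemma lfun_sum:
  assumes f: "lfun UNIV (fvec n) f" and "\<And>j. j < k \<Longrightarrow> c j \<in> fvec n" and x: "x \<in> fvec n"
  shows "f (\<lambda>i. x i + (\<Sum>j<(k::nat). a j * c j i)) = f x + (\<Sum>j<k. a j * f (c j))"
  using assms(2)
proof (induction k rule: nat_induct)
  case (Suc k)
  have m: "(\<lambda>i. x i + (\<Sum>j<k. a j * c j i)) \<in> fvec n" using Suc.prems x by (intro fvec_sum) auto
  have "f (\<lambda>i. x i + (\<Sum>j<Suc k. a j * c j i)) = f (\<lambda>i. (x i + (\<Sum>j<k. a j * c j i)) + a k * c k i)"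
    by (simp add: add.assoc)
  also have "\<dots> = f (\<lambda>i. x i + (\<Sum>j<k. a j * c j i)) + a k * f (c k)"
    using lfunD(2)[OF f m Suc.prems[OF lessI]] by simp
  finally show ?case using Suc by simp
qed simp

text \<open>A vector on which only the last functional is nonzero is obtained by correcting
  \<open>x\<close> with the dual vectors found so far; it is normalised and then used to correct
  those in turn.\<close>

lemma dual_vectors:
  fixes f :: "nat \<Rightarrow> (nat \<Rightarrow> 'a::field) \<Rightarrow> 'a"
  assumes "\<And>j. j < m \<Longrightarrow> lfun UNIV (fvec n) (f j)"
    and "\<And>a. (\<And>v. v \<in> fvec n \<Longrightarrow> (\<Sum>j<m. a j * f j v) = 0) \<Longrightarrow> \<forall>j<m. a j = 0"
  shows "\<exists>c. \<forall>j<m. c j \<in> fvec n \<and> (\<forall>k<m. f k (c j) = (if k = j then 1 else 0))"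
  using assms
proof (induction m rule: nat_induct)
  case (Suc m)
  have "\<exists>c. \<forall>j<m. c j \<in> fvec n \<and> (\<forall>k<m. f k (c j) = (if k = j then 1 else 0))"
  proof (rule Suc.IH)
    fix a assume a: "\<And>v. v \<in> fvec n \<Longrightarrow> (\<Sum>j<m. a j * f j v) = 0"
    have "\<forall>j<Suc m. (if j < m then a j else 0) = 0" using a by (intro Suc.prems(2)) simp
    thus "\<forall>j<m. a j = 0" by (metis less_SucI)
  qed (use Suc.prems(1) in auto)
  then obtain c where c: "\<And>j. j < m \<Longrightarrow> c j \<in> fvec n"
    "\<And>j k. j < m \<Longrightarrow> k < m \<Longrightarrow> f k (c j) = (if k = j then 1 else 0)" by blast
  \<comment> \<open>Otherwise the last functional would be a combination of the earlier ones, with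
    coefficients \<open>f m (c j)\<close>, against independence.\<close>
  have "\<exists>x\<in>fvec n. f m x - (\<Sum>j<m. f m (c j) * f j x) \<noteq> 0"
  proof (rule ccontr)
    assume n: "\<not> ?thesis"
    have "\<forall>j<Suc m. (if j < m then - f m (c j) else 1) = 0"
    proof (rule Suc.prems(2))
      fix v :: "nat \<Rightarrow> 'a" assume "v \<in> fvec n"
      hence "f m v - (\<Sum>j<m. f m (c j) * f j v) = 0" using n by blast
      thus "(\<Sum>j<Suc m. (if j < m then - f m (c j) else 1) * f j v) = 0"
        by (simp add: sum_negf)
    qed
    thus False by (metis lessI less_irrefl zero_neq_one)
  qed
  then obtain x where x: "x \<in> fvec n" "f m x - (\<Sum>j<m. f m (c j) * f j x) \<noteq> 0" by blast
  define y where "y = (\<lambda>i. x i + (\<Sum>j<m. (- f j x) * c j i))"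
  have y: "y \<in> fvec n" unfolding y_def by (rule fvec_sum[OF c(1) x(1)])
  have fy: "f k y = f k x + (\<Sum>j<m. (- f j x) * f k (c j))" if "k < Suc m" for k
    unfolding y_def by (rule lfun_sum[OF Suc.prems(1)[OF that] c(1) x(1)])
  have fy0: "f k y = 0" if "k < m" for k
  proof -
    have "(\<Sum>j<m. (- f j x) * f k (c j)) = (\<Sum>j<m. if j = k then - f k x else 0)"
      using c(2) that by (intro sum.cong) auto
    thus ?thesis using fy[of k] that by simp
  qed
  have fym: "f m y \<noteq> 0"
    using fy[of m] x(2) by (simp add: sum_negf mult.commute)
  define z where "z = (\<lambda>i. (1 / f m y) * y i)"
  have z: "z \<in> fvec n" unfolding z_def by (rule univ.scale_cvec[OF y UNIV_I])
  have fz: "f k z = (if k = m then 1 else 0)" if "k < Suc m" for k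
  proof -
    have "f k z = f k (\<lambda>i. (\<lambda>_. 0) i + (1 / f m y) * y i)" by (simp add: z_def)
    also have "\<dots> = f k (\<lambda>_. 0) + (1 / f m y) * f k y"
      by (rule lfunD(2)[OF Suc.prems(1)[OF that] univ.zero_cvec y UNIV_I])
    also have "f k (\<lambda>_. 0) = 0" by (rule lfun_zero[OF Suc.prems(1)[OF that]]) (auto simp: univ.zero_cvec)
    finally show ?thesis using fy0 fym that by (auto simp: less_Suc_eq)
  qed
  define d where "d = (\<lambda>j. if j < m then (\<lambda>i. c j i + (- f m (c j)) * z i) else z)"
  have "d j \<in> fvec n" if "j < Suc m" for j
  proof (cases "j < m")
    case True
    thus ?thesis unfolding d_def using univ.comb_cvec[OF c(1)[OF True] z, of "- f m (c j)"] by simp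
  next
    case False thus ?thesis using z by (simp add: d_def)
  qed
  moreover have "f k (d j) = (if k = j then 1 else 0)" if k: "k < Suc m" and j: "j < Suc m" for k j
  proof (cases "j < m")
    case True
    have "f k (d j) = f k (c j) + (- f m (c j)) * f k z"
      unfolding d_def using True lfunD(2)[OF Suc.prems(1)[OF k] c(1)[OF True] z UNIV_I, of "- f m (c j)"] by simp
    thus ?thesis using fz[OF k] c(2)[OF True, of k] k True by (auto simp: less_Suc_eq)
  next
    case False
    thus ?thesis using fz[OF k] j by (auto simp: d_def less_Suc_eq)
  qed
  ultimately show ?case by blast
qed simp

text \<open>A totally isotropic subspace of half dimension with basis \<open>B\<close>, together with vectors \<open>c\<close> dual
  to \<open>B\<close>, gives coordinates \<open>(x, y)\<close> in which the form is \<open>\<Sum>\<^sub>j y\<^sub>j (x\<^sub>j + \<Sum>\<^sub>l D\<^sub>j\<^sub>l y\<^sub>l)\<close>.\<close>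

lemma isometric_hyperbolic_of_hyp:
  fixes A :: "'a::field mat"
  assumes A: "A \<in> carrier_mat (m + m) (m + m)" and ns: "nonsingular_form A"
    and h: "hyp UNIV {..<m + m} (qfm A)"
  shows "isometric (hyperbolic_form m) A"
proof -
  let ?n = "m + m" and ?q = "qf {..<m + m} (qfm A)" and ?b = "bf {..<m + m} (qfm A)"
  obtain W m' where W: "W \<subseteq> fvec ?n" "lsub UNIV W" "\<forall>v\<in>W. ?q v = 0" "card {..<?n} \<le> 2 * m'" "dimge UNIV W m'"
    using h unfolding hyp_def by blast
  have "dimge UNIV W m" using dimge_mono[OF W(5), of m] W(4) by simp
  then obtain B where B: "\<And>j. j < m \<Longrightarrow> B j \<in> W"
    "\<And>a. (\<And>i. (\<Sum>j<m. a j * B j i) = 0) \<Longrightarrow> \<forall>j<m. a j = 0"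
    using univ.dimge_basis[OF _ W(1)] by blast
  have Bn: "B j \<in> fvec ?n" if "j < m" for j using B(1)[OF that] W(1) by blast
  have bW: "?b v w = 0" if v: "v \<in> W" and w: "w \<in> W" for v w
    unfolding bf_polar using W(3) v w lsubD(2)[OF W(2) v w, of 1] by simp
  have "\<exists>c. \<forall>j<m. c j \<in> fvec ?n \<and> (\<forall>k<m. ?b (c j) (B k) = (if k = j then 1 else 0))"
  proof (rule dual_vectors)
    show "lfun UNIV (fvec ?n) (\<lambda>v. ?b v (B j))" if "j < m" for j
      by (rule univ.lfun_bf) (use Bn[OF that] in auto)
    fix a assume a: "\<And>v. v \<in> fvec ?n \<Longrightarrow> (\<Sum>j<m. a j * ?b v (B j)) = 0"
    let ?x = "\<lambda>i. \<Sum>j<m. a j * B j i"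
    have "?x \<in> fvec ?n" using fvec_sum[where k = m and c = B and x = "\<lambda>_. 0" and a = a, OF Bn univ.zero_cvec] by simp
    moreover have "?b ?x w = 0" if "w \<in> fvec ?n" for w
      using a[OF that] bf_sum_right[of "{..<?n}" "qfm A" w a B m] bf_commute[of "{..<?n}" "qfm A" ?x w] by simp
    ultimately have "?x = (\<lambda>_. 0)" using nonsingular_form_nonsing[OF A ns] unfolding nonsing_def by blast
    thus "\<forall>j<m. a j = 0" using B(2) fun_cong by metis
  qed
  then obtain c where c: "\<And>j. j < m \<Longrightarrow> c j \<in> fvec ?n"
    "\<And>j k. j < m \<Longrightarrow> k < m \<Longrightarrow> ?b (c j) (B k) = (if k = j then 1 else 0)" by blast
  \<comment> \<open>An upper triangular matrix of the form restricted to the span of the dual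
    vectors. The definition of \<open>x\<close> subtracts \<open>D\<close> applied to the second
    half of the coordinates, which makes this restriction disappear.\<close>
  define D where "D = (\<lambda>k l. if k = l then ?q (c k) else if k < l then ?b (c k) (c l) else 0)"
  define x where "x = (\<lambda>(v :: nat \<Rightarrow> 'a) j. lo m v j + (- 1) * (\<Sum>l<m. D j l * hi m m v l))"
  define P where "P = (\<lambda>v i. \<Sum>j<m. x v j * B j i)"
  define Q where "Q = (\<lambda>v i. \<Sum>k<m. hi m m v k * c k i)"
  let ?S = "\<lambda>v i. P v i + 1 * Q v i"
  have x_comb: "x (\<lambda>i. v i + d * w i) j = x v j + d * x w j" for v w d j
    unfolding x_def lo_comb hi_comb by (simp add: sum.distrib sum_distrib_left algebra_simps)
  have Pm: "P v \<in> fvec ?n" for v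
    unfolding P_def using fvec_sum[where k = m and c = B and x = "\<lambda>_. 0" and a = "x v", OF Bn univ.zero_cvec] by simp
  have Qm: "Q v \<in> fvec ?n" for v
    unfolding Q_def using fvec_sum[where k = m and c = c and x = "\<lambda>_. 0" and a = "hi m m v", OF c(1) univ.zero_cvec] by simp
  have comb_W: "(\<lambda>i. \<Sum>j<k. a j * B j i) \<in> W" if "k \<le> m" for a k
    using that
  proof (induction k)
    case 0 thus ?case using lsubD(1)[OF W(2)] by simp
  next
    case (Suc k)
    thus ?case using lsubD(2)[OF W(2) Suc.IH B(1), of k "a k"] by simp
  qed
  have PW: "P v \<in> W" for v unfolding P_def using comb_W by blast
  have S: "lmap UNIV (fvec ?n) (fvec ?n) ?S"
    unfolding lmap_def
  proof (intro conjI ballI ext)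
    fix v :: "nat \<Rightarrow> 'a" show "?S v \<in> fvec ?n" using univ.comb_cvec[OF Pm Qm] by blast
  next
    fix v w :: "nat \<Rightarrow> 'a" and d i
    show "?S (\<lambda>i. v i + d * w i) i = ?S v i + d * ?S w i"
      unfolding P_def Q_def x_comb hi_comb by (simp add: sum.distrib sum_distrib_left algebra_simps)
  qed
  have bBQ: "?b (B j) (Q v) = hi m m v j" if j: "j < m" for j v
  proof -
    have "?b (B j) (Q v) = (\<Sum>k<m. hi m m v k * ?b (B j) (c k))" unfolding Q_def by (rule bf_sum_right)
    also have "\<dots> = (\<Sum>k<m. if k = j then hi m m v j else 0)"
      using c(2) j bf_commute[of "{..<?n}" "qfm A" "B j"] by (intro sum.cong) auto
    finally show ?thesis using j by simp
  qed
  show ?thesis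
  proof (rule isometricI[OF hyperbolic_form_carrier A S])
    fix v :: "nat \<Rightarrow> 'a" assume v: "v \<in> fvec ?n"
    show "v = (\<lambda>_. 0)" if z: "?S v = (\<lambda>_. 0)"
    proof -
      have "hi m m v j = 0" if j: "j < m" for j
      proof -
        have "0 = ?b (B j) (?S v)" unfolding z by simp
        also have "\<dots> = hi m m v j" unfolding bf_comb_right bW[OF B(1)[OF j] PW] bBQ[OF j] by simp
        finally show ?thesis by simp
      qed
      hence h0: "hi m m v = (\<lambda>_. 0)" by (auto simp: hi_def fun_eq_iff)
      hence "x v = lo m v" "Q v = (\<lambda>_. 0)" by (simp_all add: x_def Q_def)
      hence "(\<Sum>j<m. lo m v j * B j i) = 0" for i using fun_cong[OF z, of i] by (simp add: P_def)
      hence "\<forall>j<m. lo m v j = 0" by (rule B(2))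
      hence "lo m v = (\<lambda>_. 0)" by (auto simp: lo_def fun_eq_iff)
      thus ?thesis using lo_hi_zero[OF v _ h0] by blast
    qed
    have "?b (P v) (Q v) = (\<Sum>j<m. x v j * hi m m v j)"
      unfolding P_def bf_sum_left using bBQ by (intro sum.cong) auto
    moreover have "?q (Q v) = (\<Sum>j<m. (\<Sum>l<m. D j l * hi m m v l) * hi m m v j)"
    proof -
      have "?q (Q v) = qf {..<m} D (hi m m v)"
        unfolding Q_def by (rule qf_lincomb) (auto simp: D_def)
      thus ?thesis unfolding qf_def by (simp add: sum_distrib_right sum_distrib_left ac_simps)
    qed
    ultimately have "?q (?S v) = (\<Sum>j<m. x v j * hi m m v j + (\<Sum>l<m. D j l * hi m m v l) * hi m m v j)"
      unfolding qf_comb using W(3) PW[of v] by (simp add: sum.distrib)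
    also have "\<dots> = (\<Sum>j<m. lo m v j * hi m m v j)"
      by (intro sum.cong refl) (simp add: x_def algebra_simps)
    finally show "?q (?S v) = qf {..<?n} (qfm (hyperbolic_form m)) v" unfolding qf_hyperbolic_form .
  qed
qed

lemma nonsingular_hyperbolic_form: "nonsingular_form (hyperbolic_form m :: 'a::field mat)"
proof -
  let ?H = "hyperbolic_form m :: 'a mat"
  define G where "G = ?H + transpose_mat ?H"
  have G: "G \<in> carrier_mat (m + m) (m + m)" by (simp add: G_def)
  have "G = four_block_mat (0\<^sub>m m m) (1\<^sub>m m) (1\<^sub>m m) (0\<^sub>m m m)"
    unfolding G_def hyperbolic_form_def by (rule eq_matI) auto
  moreover have "four_block_mat (0\<^sub>m m m) (1\<^sub>m m) (1\<^sub>m m) (0\<^sub>m m m) * four_block_mat (0\<^sub>m m m) (1\<^sub>m m) (1\<^sub>m m) (0\<^sub>m m m)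
    = four_block_mat (1\<^sub>m m) (0\<^sub>m m m) (0\<^sub>m m m) (1\<^sub>m m :: 'a mat)"
    by (subst mult_four_block_mat) auto
  ultimately have "G * G = 1\<^sub>m (m + m)" by simp
  hence "det G * det G = 1" using det_mult[OF G G] by simp
  hence "det G \<noteq> 0" by auto
  thus ?thesis using nonsingular_form_iff[OF hyperbolic_form_carrier, of m] unfolding G_def by blast
qed

section \<open>Pfister forms\<close>

lemma kronecker_carrier:
  "M \<in> carrier_mat n n \<Longrightarrow> A \<in> carrier_mat m m \<Longrightarrow> kronecker M A \<in> carrier_mat (n * m) (n * m)"
  unfolding kronecker_def by auto

lemma bilinear_pfister_carrier: "bilinear_pfister bs \<in> carrier_mat (2 ^ length bs) (2 ^ length bs)"
proof (induction bs)
  case (Cons b bs)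
  have D: "mat_of_rows_list 2 [[1, 0], [0, b]] \<in> carrier_mat 2 2" by (simp add: mat_of_rows_list_def numeral_2_eq_2)
  show ?case using kronecker_carrier[OF D Cons] by simp
qed simp

lemma binary_form_carrier: "binary_form a b \<in> carrier_mat 2 2"
  by (simp add: binary_form_def mat_of_rows_list_def numeral_2_eq_2)

lemma quadratic_pfister_carrier:
  "quadratic_pfister bs a \<in> carrier_mat (2 ^ Suc (length bs)) (2 ^ Suc (length bs))"
  unfolding quadratic_pfister_def
  using kronecker_carrier[OF bilinear_pfister_carrier binary_form_carrier] by (simp add: mult.commute)

lemma quadratic_pfister_Nil: "quadratic_pfister [] a = binary_form 1 a"
  unfolding quadratic_pfister_def kronecker_def using binary_form_carrier[of 1 a]
  by (intro eq_matI) auto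

text \<open>Associativity of the Kronecker product, checked on indices. This recursion is what makes
  induction over the slots of a Pfister form possible.\<close>

lemma quadratic_pfister_Cons:
  "quadratic_pfister (b # bs) a = orth_sum (quadratic_pfister bs a) (b \<cdot>\<^sub>m quadratic_pfister bs a)"
proof -
  define m :: nat where "m = 2 ^ length bs"
  have m0: "m > 0" by (simp add: m_def)
  let ?M = "bilinear_pfister bs" and ?A = "binary_form 1 a" and ?D = "mat_of_rows_list 2 [[1, 0], [0, b]]"
  have M: "dim_row ?M = m" "dim_col ?M = m" using bilinear_pfister_carrier[of bs] by (auto simp: m_def)
  have A: "dim_row ?A = 2" "dim_col ?A = 2" using binary_form_carrier[of 1 a] by auto
  have D: "dim_row ?D = 2" "dim_col ?D = 2" by (simp_all add: mat_of_rows_list_def numeral_2_eq_2)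
  have X: "quadratic_pfister bs a \<in> carrier_mat (m * 2) (m * 2)"
    using quadratic_pfister_carrier[of bs a] by (simp add: m_def mult.commute)
  have X_eq: "quadratic_pfister bs a $$ (i, j) = ?M $$ (i div 2, j div 2) * ?A $$ (i mod 2, j mod 2)"
    if "i < m * 2" "j < m * 2" for i j
    using that unfolding quadratic_pfister_def kronecker_def by (simp add: M A)
  have K_eq: "quadratic_pfister (b # bs) a $$ (i, j)
    = ?D $$ (i div 2 div m, j div 2 div m) * ?M $$ (i div 2 mod m, j div 2 mod m) * ?A $$ (i mod 2, j mod 2)"
    if "i < 2 * m * 2" "j < 2 * m * 2" for i j
    using that unfolding quadratic_pfister_def bilinear_pfister.simps kronecker_def by (simp add: M A D less_mult_imp_div_less)
  \<comment> \<open>The leading digit of \<open>i\<close> selects one of the two diagonal blocks,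
    and the remaining digits are those of the position inside that block.\<close>
  have split: "i div 2 div m = (if i < m * 2 then 0 else 1) \<and>
      i div 2 mod m = (if i < m * 2 then i else i - m * 2) div 2 \<and>
      i mod 2 = (if i < m * 2 then i else i - m * 2) mod 2" if i: "i < 2 * m * 2" for i
  proof (cases "i < m * 2")
    case True
    hence "i div 2 < m" by (simp add: less_mult_imp_div_less)
    thus ?thesis using True by simp
  next
    case False
    define k where "k = i - m * 2"
    have k: "i = m * 2 + k" "k < m * 2" using False i by (auto simp: k_def)
    have "i div 2 = m + k div 2" "k div 2 < m" "i mod 2 = k mod 2"
      using k by (auto simp: less_mult_imp_div_less)
    moreover from this have "(m + k div 2) div m = 1" "(m + k div 2) mod m = k div 2"
      using m0 by (simp_all add: div_add_self1)
    ultimately show ?thesis using False by (simp add: k_def)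
  qed
  have D_eq: "?D $$ (0, 0) = 1" "?D $$ (0, Suc 0) = 0" "?D $$ (Suc 0, 0) = 0" "?D $$ (Suc 0, Suc 0) = b"
    by (simp_all add: mat_of_rows_list_def)
  show ?thesis
  proof (rule eq_matI)
    fix i j assume "i < dim_row (orth_sum (quadratic_pfister bs a) (b \<cdot>\<^sub>m quadratic_pfister bs a))"
      "j < dim_col (orth_sum (quadratic_pfister bs a) (b \<cdot>\<^sub>m quadratic_pfister bs a))"
    hence ij: "i < 2 * m * 2" "j < 2 * m * 2" using X by (auto simp: orth_sum_def)
    define i' j' where "i' = (if i < m * 2 then i else i - m * 2)" and "j' = (if j < m * 2 then j else j - m * 2)"
    have ij': "i' < m * 2" "j' < m * 2" using ij by (auto simp: i'_def j'_def)
    have "quadratic_pfister (b # bs) a $$ (i, j)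
      = ?D $$ (if i < m * 2 then 0 else 1, if j < m * 2 then 0 else 1) * quadratic_pfister bs a $$ (i', j')"
      unfolding K_eq[OF ij] X_eq[OF ij'] using split[OF ij(1)] split[OF ij(2)]
      unfolding i'_def[symmetric] j'_def[symmetric] by simp
    moreover have "orth_sum (quadratic_pfister bs a) (b \<cdot>\<^sub>m quadratic_pfister bs a) $$ (i, j)
      = ?D $$ (if i < m * 2 then 0 else 1, if j < m * 2 then 0 else 1) * quadratic_pfister bs a $$ (i', j')"
      using ij X D_eq unfolding orth_sum_def i'_def j'_def by (cases "i < m * 2"; cases "j < m * 2") simp_all
    ultimately show "quadratic_pfister (b # bs) a $$ (i, j)
      = orth_sum (quadratic_pfister bs a) (b \<cdot>\<^sub>m quadratic_pfister bs a) $$ (i, j)" by simp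
  qed (use X quadratic_pfister_carrier[of "b # bs" a] in \<open>auto simp: orth_sum_def m_def\<close>)
qed

lemma nonsingular_quadratic_pfister:
  "0 \<notin> set bs \<Longrightarrow> nonsingular_form (binary_form 1 a) \<Longrightarrow> nonsingular_form (quadratic_pfister bs a)"
proof (induction bs)
  case Nil thus ?case by (simp add: quadratic_pfister_Nil)
next
  case (Cons b bs)
  thus ?case unfolding quadratic_pfister_Cons
    using quadratic_pfister_carrier[of bs a] nonsingular_smult[OF quadratic_pfister_carrier[of bs a], of b]
    by (intro nonsingular_orth_sum[OF quadratic_pfister_carrier _ smult_carrier_mat[OF quadratic_pfister_carrier]]) auto
qed

text \<open>Instances are the identity on \<open>'a\<close> and \<open>iota\<close> into any
  subfield containing its range, so that each fact about matrices over \<open>'a\<close> is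
  available over all extensions at once.\<close>

locale field_embedding = comm_ring_hom h + subfld L
  for h :: "'a::field \<Rightarrow> 'u::field" and L :: "'u set" +
  assumes h_mem: "h a \<in> L" and h_eq_0: "h a = 0 \<Longrightarrow> a = 0"
begin

abbreviation hm :: "'a mat \<Rightarrow> nat \<Rightarrow> nat \<Rightarrow> 'u" where
  "hm A \<equiv> (\<lambda>i j. h (A $$ (i, j)))"

lemma nonsing_hom:
  assumes A: "A \<in> carrier_mat n n" and ns: "nonsingular_form A"
  shows "nonsing L {..<n} (hm A)"
proof (rule nonsing_of_det[OF subfld_axioms])
  let ?G = "A + transpose_mat A"
  show "map_mat h ?G \<in> carrier_mat n n" using A by simp
  show "det (map_mat h ?G) \<noteq> 0"
    using nonsingular_form_iff[OF A] ns h_eq_0 by auto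
  show "hm A i j + hm A j i = map_mat h ?G $$ (i, j)" if "i < n" "j < n" for i j
    using A that by (simp add: hom_add)
qed

lemma dimge_kers:
  assumes "finite Gs" "lsub L V" "dimge L V m" "\<And>g. g \<in> Gs \<Longrightarrow> lfun L V g"
  shows "lsub L {v \<in> V. \<forall>g\<in>Gs. g v = 0} \<and> dimge L {v \<in> V. \<forall>g\<in>Gs. g v = 0} (m - card Gs)"
  using assms(1,4)
proof (induction Gs)
  case empty thus ?case using assms(2,3) by simp
next
  case (insert g Gs)
  let ?V = "{v \<in> V. \<forall>g\<in>Gs. g v = 0}"
  have g: "lfun L ?V g" using lfun_subset[OF insert.prems[of g], of ?V] by auto
  have "{v \<in> V. \<forall>g\<in>insert g Gs. g v = 0} = {v \<in> ?V. g v = 0}" by auto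
  moreover have "lsub L ?V" "dimge L ?V (m - card Gs)" using insert by simp_all
  moreover from this have "lsub L {v \<in> ?V. g v = 0}" "dimge L {v \<in> ?V. g v = 0} (m - card Gs - 1)"
    using dimge_ker[OF _ _ g] lsub_ker[OF _ g one_mem] by blast+
  moreover have "m - card (insert g Gs) = m - card Gs - 1" using insert by simp
  ultimately show ?case by (simp only: simp_thms)
qed

text \<open>The isometry is an identity of values over \<open>'a\<close>, which has to be moved to
  \<open>L\<close>. Written in the linear forms given by the rows of the isometry, the form is a sum
  of \<open>b\<close> products; the common kernel of the second factors is totally isotropic over
  \<open>L\<close> and has at least half the dimension.\<close>

lemma hyp_of_isometric_hyperbolic:
  fixes M :: "'a mat"
  assumes M: "M \<in> carrier_mat (b + b) (b + b)" and iso: "isometric M (hyperbolic_form b)"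
  shows "hyp L {..<b + b} (hm M)"
proof -
  let ?n = "b + b" and ?I = "{..<b + b}"
  obtain s where s: "lmap UNIV (fvec ?n) (fvec ?n) s"
    "\<And>v. v \<in> fvec ?n \<Longrightarrow> qf ?I (qfm (hyperbolic_form b)) (s v) = qf ?I (qfm M) v"
    using isometricE[OF iso M] by metis
  define p where "p = (\<lambda>i j. s (unitv j) i)"
  define C where "C = (\<lambda>i j. \<Sum>k<b. p k i * p (b + k) j)"
  have sp: "s v i = (\<Sum>j<?n. p i j * v j)" if "v \<in> fvec ?n" for v i
    using lmap_expand[OF s(1) that, of i] by (simp add: p_def mult.commute)
  have gen: "qf ?I (\<lambda>i j. \<Sum>k<b. p k i * p (b + k) j) v = (\<Sum>k<b. (\<Sum>i<?n. p k i * v i) * (\<Sum>j<?n. p (b + k) j * v j))"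
    for p :: "nat \<Rightarrow> nat \<Rightarrow> 'c::field" and v
  proof -
    have "qf ?I (\<lambda>i j. \<Sum>k<b. p k i * p (b + k) j) v = (\<Sum>i<?n. \<Sum>j<?n. \<Sum>k<b. (p k i * v i) * (p (b + k) j * v j))"
      unfolding qf_def sum_distrib_right by (intro sum.cong refl) (simp add: ac_simps)
    also have "\<dots> = (\<Sum>i<?n. \<Sum>k<b. \<Sum>j<?n. (p k i * v i) * (p (b + k) j * v j))"
      by (intro sum.cong refl sum.swap)
    also have "\<dots> = (\<Sum>k<b. \<Sum>i<?n. \<Sum>j<?n. (p k i * v i) * (p (b + k) j * v j))" by (rule sum.swap)
    finally show ?thesis unfolding sum_product .
  qed
  have qC: "qf ?I C v = qf ?I (qfm M) v" if v: "v \<in> fvec ?n" for v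
    unfolding s(2)[OF v, symmetric] qf_hyperbolic_form C_def gen
    by (intro sum.cong refl) (simp add: sp[OF v, symmetric] lo_def hi_def)
  \<comment> \<open>Values at unit vectors and polar values at pairs of them turn the equality of
    values into equalities of coefficients, to which \<open>h\<close> can be applied even when
    \<open>'a\<close> is finite.\<close>
  have diag: "C i i = M $$ (i, i)" if "i < ?n" for i
    using qC[OF univ.unitv_cvec[of i]] that by (simp add: qf_unitv)
  have off: "C i j + C j i = M $$ (i, j) + M $$ (j, i)" if "i < ?n" "j < ?n" for i j
  proof -
    have u: "unitv i \<in> fvec ?n" "unitv j \<in> fvec ?n" using that univ.unitv_cvec[of _ ?I] by auto
    have "bf ?I C (unitv i) (unitv j) = bf ?I (qfm M) (unitv i) (unitv j)"
      unfolding bf_polar qC[OF univ.comb_cvec[OF u UNIV_I, of 1]] qC[OF u(1)] qC[OF u(2)] ..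
    thus ?thesis using that by (simp add: bf_unitv_unitv)
  qed
  have qh: "qf ?I (hm M) v = qf ?I (\<lambda>i j. h (C i j)) v" for v
  proof -
    have "qf ?I (hm M) (\<lambda>i. \<Sum>j<?n. v j * unitv j i) = qf ?I (\<lambda>i j. h (C i j)) v"
      by (rule qf_lincomb) (use diag off in \<open>auto simp: qf_unitv bf_unitv_unitv hom_add[symmetric]\<close>)
    moreover have "qf ?I (hm M) (\<lambda>i. \<Sum>j<?n. v j * unitv j i) = qf ?I (hm M) v"
      by (rule qf_cong) (auto simp: unitv_def if_distrib[of "\<lambda>x. _ * x"] cong: if_cong)
    ultimately show ?thesis by simp
  qed
  let ?g = "\<lambda>k (v :: nat \<Rightarrow> 'u). \<Sum>j<?n. h (p (b + k) j) * v j"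
  let ?Gs = "?g ` {..<b}"
  let ?W = "{v \<in> cvec L ?I. \<forall>g\<in>?Gs. g v = 0}"
  have g: "lfun L (cvec L ?I) f" if "f \<in> ?Gs" for f
    using that unfolding lfun_def
    by (auto simp: sum_distrib_left sum.distrib[symmetric] algebra_simps cvec_def intro!: mems h_mem)
  have d: "dimge L (cvec L ?I) ?n" using dimge_cvec[of ?I] by simp
  have k: "lsub L ?W" "dimge L ?W (?n - card ?Gs)"
    using dimge_kers[OF _ lsub_cvec d g, of ?Gs] by auto
  have "card ?Gs \<le> b" using card_image_le[of "{..<b}" ?g] by simp
  hence "dimge L ?W b" using dimge_mono[OF k(2), of b] by simp
  moreover have "qf ?I (hm M) v = 0" if "v \<in> ?W" for v
  proof -
    have "h (C i j) = (\<Sum>k<b. h (p k i) * h (p (b + k) j))" for i j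
      unfolding C_def by (simp add: hom_sum hom_mult)
    hence "qf ?I (hm M) v = (\<Sum>k<b. (\<Sum>i<?n. h (p k i) * v i) * ?g k v)"
      unfolding qh using gen[of "\<lambda>i j. h (p i j)" v] by simp
    thus ?thesis using that by simp
  qed
  ultimately show ?thesis using k(1) unfolding hyp_def
    by (intro exI[of _ ?W] exI[of _ b]) auto
qed

lemma qf_fun_cong:
  "(\<And>i j. i < N \<Longrightarrow> j < N \<Longrightarrow> A i j = A' i j) \<Longrightarrow> qf {..<N::nat} A = qf {..<N} (A' :: nat \<Rightarrow> nat \<Rightarrow> 'u)"
  by (rule ext) (auto intro!: qf_cong)

text \<open>Roundness is carried through the induction because hyperbolicity of an isotropic double
  rests on roundness of its half.\<close>

lemma quadratic_pfister_round:
  assumes "0 \<notin> set bs" and ns: "nonsingular_form (binary_form 1 a)"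
  shows "round_form L (2 ^ Suc (length bs)) (hm (quadratic_pfister bs a)) \<and>
    (\<not> aniso L {..<2 ^ Suc (length bs)} (hm (quadratic_pfister bs a)) \<longrightarrow>
      hyp L {..<2 ^ Suc (length bs)} (hm (quadratic_pfister bs a)))"
  using assms(1)
proof (induction bs)
  case Nil
  have "round_form L 2 (hm (binary_form 1 a))"
    by (rule round_binary[OF h_mem[of a]]) (simp_all add: binary_form_def mat_of_rows_list_def)
  thus ?case using isotropic_binary_hyp by (simp add: quadratic_pfister_Nil)
next
  case (Cons b bs)
  let ?X = "quadratic_pfister bs a" and ?N = "2 ^ Suc (length bs) :: nat"
  have X: "?X \<in> carrier_mat ?N ?N" by (rule quadratic_pfister_carrier)
  have eN: "2 ^ Suc (length (b # bs)) = ?N + ?N" by simp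
  have q: "qf {..<?N + ?N} (hm (quadratic_pfister (b # bs) a)) = qf {..<?N + ?N} (double_form ?N (hm ?X) (h b))"
    by (rule qf_fun_cong) (use X in \<open>auto simp: quadratic_pfister_Cons orth_sum_def double_form_def hom_mult\<close>)
  have rnd: "round_form L ?N (hm ?X)" and mem: "\<forall>i\<in>{..<?N}. \<forall>j\<in>{..<?N}. hm ?X i j \<in> L"
    using Cons h_mem by auto
  have nsX: "nonsing L {..<?N} (hm ?X)"
    using nonsing_hom[OF X nonsingular_quadratic_pfister] Cons.prems ns by simp
  have hb: "h b \<in> L" "h b \<noteq> 0" using h_mem h_eq_0 Cons.prems by auto
  have "round_form L (?N + ?N) (double_form ?N (hm ?X) (h b))" by (rule round_double[OF mem rnd hb(1)])
  moreover have "\<not> aniso L {..<?N + ?N} (double_form ?N (hm ?X) (h b)) \<longrightarrow> hyp L {..<?N + ?N} (double_form ?N (hm ?X) (h b))"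
    using isotropic_double_hyp[OF mem rnd nsX hb] by blast
  ultimately show ?case
    unfolding eN round_form_def similar_def aniso_def hyp_def q by (rule conjI)
qed

lemma isotropic_pfister_hyp:
  assumes A: "A \<in> pfister_forms n" and c: "c \<noteq> 0"
    and an: "\<not> aniso L {..<2 ^ n} (hm (c \<cdot>\<^sub>m A))"
  shows "hyp L {..<2 ^ n} (hm (c \<cdot>\<^sub>m A))"
proof -
  obtain bs a where bs: "A = quadratic_pfister bs a" "Suc (length bs) = n" "0 \<notin> set bs" "nonsingular_form (binary_form 1 a)"
    using A unfolding pfister_forms_def by blast
  have q: "qf {..<2 ^ n} (hm (c \<cdot>\<^sub>m A)) v = h c * qf {..<2 ^ n} (hm A) v" for v
  proof -
    have "qf {..<2 ^ n} (hm (c \<cdot>\<^sub>m A)) v = qf {..<2 ^ n} (\<lambda>i j. h c * hm A i j) v"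
      using quadratic_pfister_carrier[of bs a] bs by (intro qf_cong) (auto simp: hom_mult)
    thus ?thesis unfolding qf_def by (simp add: sum_distrib_left mult.assoc)
  qed
  have hc: "h c \<noteq> 0" using c h_eq_0 by blast
  have "\<not> aniso L {..<2 ^ n} (hm A)" using an hc unfolding aniso_def q by simp
  hence "hyp L {..<2 ^ n} (hm A)" using quadratic_pfister_round[OF bs(3,4)] bs(1,2) by blast
  thus ?thesis using hc unfolding hyp_def q by simp
qed

end

lemma embedding_id: "field_embedding (\<lambda>x. x) (UNIV :: 'a::field set)"
  by unfold_locales auto

lemma embedding_iota: "subfld L \<Longrightarrow> range iota \<subseteq> L \<Longrightarrow> field_embedding (iota :: 'a::field \<Rightarrow> 'a univ) L"
proof -
  assume L: "subfld L" "range iota \<subseteq> L"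
  interpret subfld L by fact
  show ?thesis
    by unfold_locales (use L iota_add iota_mult iota_one iota_zero iota_eq_0 in auto)
qed

lemma nonsing_cong:
  assumes "\<And>i j. i \<in> I \<Longrightarrow> j \<in> I \<Longrightarrow> A i j = A' i j" "nonsing L I A"
  shows "nonsing L I A'"
proof -
  have "bf I A v w = bf I A' v w" for v w by (rule bf_cong) (auto simp: assms(1))
  thus ?thesis using assms(2) unfolding nonsing_def by simp
qed

lemma aniso_cong:
  assumes "\<And>i j. i \<in> I \<Longrightarrow> j \<in> I \<Longrightarrow> A i j = A' i j" "aniso L I A"
  shows "aniso L I A'"
proof -
  have "qf I A v = qf I A' v" for v by (rule qf_cong) (auto simp: assms(1))
  thus ?thesis using assms(2) unfolding aniso_def by simp
qed

lemma (in field_embedding) hom_qf: "h (qf I A v) = qf I (\<lambda>i j. h (A i j)) (\<lambda>i. h (v i))"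
  unfolding qf_def by (simp add: hom_sum hom_mult)

lemma hyperbolic_form_dim [simp]:
  "dim_row (hyperbolic_form m) = m + m" "dim_col (hyperbolic_form m) = m + m"
  using carrier_matD[OF hyperbolic_form_carrier[of m]] by auto

lemma pfister_formsE:
  assumes "A \<in> pfister_forms n"
  shows "A \<in> carrier_mat (2 ^ n) (2 ^ n)" "nonsingular_form A" "A $$ (0, 0) = 1" "n \<ge> 1"
proof -
  obtain bs a where A: "A = quadratic_pfister bs a" "Suc (length bs) = n" "0 \<notin> set bs" "nonsingular_form (binary_form 1 a)"
    using assms unfolding pfister_forms_def by blast
  show "A \<in> carrier_mat (2 ^ n) (2 ^ n)" using quadratic_pfister_carrier[of bs a] A by simp
  show "nonsingular_form A" using nonsingular_quadratic_pfister A by blast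
  show "n \<ge> 1" using A by simp
  have "quadratic_pfister bs a $$ (0, 0) = 1"
  proof (induction bs)
    case Nil thus ?case by (simp add: quadratic_pfister_Nil binary_form_def mat_of_rows_list_def)
  next
    case (Cons b bs)
    thus ?case using quadratic_pfister_carrier[of bs a] by (simp add: quadratic_pfister_Cons orth_sum_def)
  qed
  thus "A $$ (0, 0) = 1" using A by simp
qed

text \<open>The layout of the entries in the form expected by \<open>hyp_of_blocks\<close>: block
  \<open>r\<close> starts at index \<open>n + N * r\<close>.\<close>

lemma foldl_orth_sum:
  assumes A: "A \<in> carrier_mat n n" and "\<forall>R\<in>set Rs. R \<in> carrier_mat N N"
  shows "foldl orth_sum A Rs \<in> carrier_mat (n + N * length Rs) (n + N * length Rs) \<and>
    (\<forall>k<n. \<forall>l<n. foldl orth_sum A Rs $$ (k, l) = A $$ (k, l)) \<and>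
    (\<forall>r<length Rs. \<forall>i<N. \<forall>j<N. foldl orth_sum A Rs $$ (n + N * r + i, n + N * r + j) = (Rs ! r) $$ (i, j)) \<and>
    (\<forall>r<length Rs. \<forall>k<n + N * r. \<forall>l. n + N * r \<le> l \<longrightarrow> l < n + N * Suc r \<longrightarrow>
      foldl orth_sum A Rs $$ (k, l) = 0 \<and> foldl orth_sum A Rs $$ (l, k) = 0)"
  using assms(2)
proof (induction Rs rule: rev_induct)
  case Nil
  thus ?case using A by simp
next
  case (snoc R Rs)
  define Q where "Q = foldl orth_sum A Rs"
  define d where "d = n + N * length Rs"
  have IH: "Q \<in> carrier_mat d d" "\<And>k l. k < n \<Longrightarrow> l < n \<Longrightarrow> Q $$ (k, l) = A $$ (k, l)"
    "\<And>r i j. r < length Rs \<Longrightarrow> i < N \<Longrightarrow> j < N \<Longrightarrow> Q $$ (n + N * r + i, n + N * r + j) = (Rs ! r) $$ (i, j)"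
    "\<And>r k l. r < length Rs \<Longrightarrow> k < n + N * r \<Longrightarrow> n + N * r \<le> l \<Longrightarrow> l < n + N * Suc r \<Longrightarrow> Q $$ (k, l) = 0 \<and> Q $$ (l, k) = 0"
    using snoc unfolding Q_def d_def by auto
  have R: "R \<in> carrier_mat N N" using snoc.prems by simp
  have Q': "foldl orth_sum A (Rs @ [R]) = orth_sum Q R" by (simp add: Q_def)
  have e: "orth_sum Q R $$ (k, l) = (if k < d then (if l < d then Q $$ (k, l) else 0) else if l < d then 0 else R $$ (k - d, l - d))"
    if "k < d + N" "l < d + N" for k l
    using that IH(1) R by (auto simp: orth_sum_def)
  have le: "n + N * Suc r \<le> d" if "r < length Rs" for r
    using that mult_le_mono2[of "Suc r" "length Rs" N] unfolding d_def by simp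
  have d': "n + N * length (Rs @ [R]) = d + N" by (simp add: d_def)
  show ?case
    unfolding Q' d'
  proof (intro conjI allI impI)
    show "orth_sum Q R \<in> carrier_mat (d + N) (d + N)" using IH(1) R by simp
  next
    fix k l assume "k < n" "l < n"
    moreover have "n \<le> d" by (simp add: d_def)
    ultimately show "orth_sum Q R $$ (k, l) = A $$ (k, l)" using e[of k l] IH(2)[of k l] by simp
  next
    fix r i j assume r: "r < length (Rs @ [R])" "i < N" "j < N"
    show "orth_sum Q R $$ (n + N * r + i, n + N * r + j) = (Rs @ [R]) ! r $$ (i, j)"
    proof (cases "r < length Rs")
      case True
      thus ?thesis using r e[of "n + N * r + i" "n + N * r + j"] IH(3)[OF True r(2,3)] le[OF True]
        by (simp add: nth_append)
    next
      case False
      hence "n + N * r = d" using r by (simp add: d_def)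
      thus ?thesis using False r e[of "d + i" "d + j"] by (simp add: nth_append)
    qed
  next
    fix r k l assume r: "r < length (Rs @ [R])" "k < n + N * r" "n + N * r \<le> l" "l < n + N * Suc r"
    have "orth_sum Q R $$ (k, l) = 0 \<and> orth_sum Q R $$ (l, k) = 0"
    proof (cases "r < length Rs")
      case True
      thus ?thesis using r e[of k l] e[of l k] IH(4)[OF True r(2-4)] le[OF True] by simp
    next
      case False
      hence "n + N * r = d" "n + N * Suc r = d + N" using r by (simp_all add: d_def)
      thus ?thesis using r e[of k l] e[of l k] by simp
    qed
    thus "orth_sum Q R $$ (k, l) = 0" "orth_sum Q R $$ (l, k) = 0" by auto
  qed
qed

text \<open>The case of the Arason--Pfister Hauptsatz that makes the representing Pfister form of a class
  in \<open>I\<^sub>q\<^sup>n / I\<^sub>q\<^sup>n\<^sup>+\<^sup>1\<close> unique.\<close>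

lemma hauptsatz:
  fixes A B :: "'a::field mat" and i :: 'a
  assumes i: "i\<^sup>2 = - 1" and A: "A \<in> pfister_forms n" and B: "B \<in> pfister_forms n"
    and Rs: "\<And>R. R \<in> set Rs \<Longrightarrow> \<exists>c C. R = c \<cdot>\<^sub>m C \<and> c \<noteq> 0 \<and> C \<in> pfister_forms (Suc n)"
    and we: "witt_equiv (foldl orth_sum (orth_sum A B) Rs) (0\<^sub>m 0 0)"
  shows "isometric (hyperbolic_form (2 ^ n)) (orth_sum A B)"
proof -
  define p :: nat where "p = 2 ^ n"
  define d where "d = p + p"
  define Q where "Q = foldl orth_sum (orth_sum A B) Rs"
  define r where "r = length Rs"
  have A': "A \<in> carrier_mat p p" and B': "B \<in> carrier_mat p p"
    unfolding p_def using pfister_formsE(1) A B by auto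
  have AB: "orth_sum A B \<in> carrier_mat d d" unfolding d_def using orth_sum_carrier[OF A' B'] .
  have nsAB: "nonsingular_form (orth_sum A B)"
    using nonsingular_orth_sum[OF A' _ B'] pfister_formsE(2) A B by blast
  have N: "2 ^ Suc n = d" by (simp add: d_def p_def)
  have p1: "p \<ge> 1" by (simp add: p_def)
  have RC: "R \<in> carrier_mat d d \<and> nonsingular_form R" if R: "R \<in> set Rs" for R
  proof -
    obtain c C where c: "R = c \<cdot>\<^sub>m C" "c \<noteq> 0" "C \<in> pfister_forms (Suc n)" using Rs[OF R] by blast
    have C: "C \<in> carrier_mat d d" using pfister_formsE(1)[OF c(3)] unfolding N .
    show ?thesis using nonsingular_smult[OF C pfister_formsE(2)[OF c(3)] c(2)] C c(1) by simp
  qed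
  have Q: "Q \<in> carrier_mat (d + d * r) (d + d * r)"
    "\<And>k l. k < d \<Longrightarrow> l < d \<Longrightarrow> Q $$ (k, l) = orth_sum A B $$ (k, l)"
    "\<And>s i j. s < r \<Longrightarrow> i < d \<Longrightarrow> j < d \<Longrightarrow> Q $$ (d + d * s + i, d + d * s + j) = (Rs ! s) $$ (i, j)"
    "\<And>s k l. s < r \<Longrightarrow> k < d + d * s \<Longrightarrow> d + d * s \<le> l \<Longrightarrow> l < d + d * Suc s \<Longrightarrow> Q $$ (k, l) = 0 \<and> Q $$ (l, k) = 0"
    using foldl_orth_sum[OF AB, of Rs d] RC unfolding Q_def r_def by blast+
  obtain m k where "isometric (orth_sum Q (hyperbolic_form m)) (orth_sum (0\<^sub>m 0 0) (hyperbolic_form k))"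
    using we unfolding witt_equiv_def Q_def by blast
  hence iso: "isometric (orth_sum Q (hyperbolic_form m)) (hyperbolic_form k)"
    unfolding orth_sum_empty(2)[OF hyperbolic_form_carrier zero_carrier_mat] .
  let ?D = "d + d * r" and ?H = "hyperbolic_form m :: 'a mat"
  have QH: "orth_sum Q ?H \<in> carrier_mat (?D + (m + m)) (?D + (m + m))"
    using Q(1) by simp
  have eD: "?D + (m + m) = k + k"
    using isometric_carrier[OF iso QH] hyperbolic_form_carrier[of k] by (metis carrier_matD(1))
  \<comment> \<open>Witt equivalence allows an additional hyperbolic summand; over each extension it
    is removed by cancellation.\<close>
  have hypL: "hyp L {..<?D} (\<lambda>i j. iota (Q $$ (i, j)))" if L: "roomy L" "range iota \<subseteq> L" for L
  proof -
    have sL: "subfld L" using L(1) unfolding roomy_def by blast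
    interpret E: field_embedding iota L using embedding_iota[OF sL L(2)] .
    have e1: "E.hm (orth_sum Q ?H) (?D + i) (?D + j) = E.hm ?H i j" if "i < m + m" "j < m + m" for i j
      using that Q(1) by (auto simp: orth_sum_def)
    have "hyp L {..<?D} (E.hm (orth_sum Q ?H))"
    proof (rule E.hyp_cancel[of "{?D..<?D + (m + m)}" "{..<?D}"])
      have e: "{..<?D} \<union> {?D..<?D + (m + m)} = {..<k + k}" unfolding eD[symmetric] by auto
      show "hyp L ({..<?D} \<union> {?D..<?D + (m + m)}) (E.hm (orth_sum Q ?H))"
        unfolding e by (rule E.hyp_of_isometric_hyperbolic[OF _ iso]) (use QH in \<open>simp add: eD\<close>)
      show "nonsing L {?D..<?D + (m + m)} (E.hm (orth_sum Q ?H))"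
        by (rule E.nonsing_shift, rule nonsing_cong[OF _ E.nonsing_hom[OF hyperbolic_form_carrier nonsingular_hyperbolic_form]])
          (use e1 in auto)
      show "hyp L {?D..<?D + (m + m)} (E.hm (orth_sum Q ?H))"
        by (rule E.hyp_shift, rule hyp_cong[OF _ E.hyp_of_isometric_hyperbolic[OF hyperbolic_form_carrier isometric_refl[OF hyperbolic_form_carrier]]])
          (use e1 in auto)
      show "\<forall>k\<in>{..<?D}. \<forall>l\<in>{?D..<?D + (m + m)}. E.hm (orth_sum Q ?H) k l = 0 \<and> E.hm (orth_sum Q ?H) l k = 0"
        using Q(1) by (auto simp: orth_sum_def iota_zero)
    qed (auto simp: E.h_mem)
    thus ?thesis by (rule hyp_cong[rotated]) (use Q(1) in \<open>auto simp: orth_sum_def\<close>)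
  qed
  have main: "hyp (range iota) {..<d} (\<lambda>i j. iota (Q $$ (i, j)))"
  proof (rule hyp_of_blocks[where N = d and R = r])
    show "roomy (range (iota :: 'a \<Rightarrow> 'a univ))" by (rule roomy_iota)
    show "2 \<le> d" unfolding d_def using p1 by simp
    show "iota (Q $$ (k, l)) = 0 \<and> iota (Q $$ (l, k)) = 0"
      if "s < r" "k < d + d * s" "d + d * s \<le> l" "l < d + d * Suc s" for s k l
      using Q(4)[OF that] by (simp add: iota_zero)
  next
    fix s and L :: "'a univ set" assume s: "s < r" and L: "roomy L" "range iota \<subseteq> L"
    have sL: "subfld L" using L(1) unfolding roomy_def by blast
    interpret E: field_embedding iota L using embedding_iota[OF sL L(2)] .
    have R: "Rs ! s \<in> set Rs" using s unfolding r_def by simp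
    show "nonsing L {..<d} (\<lambda>i j. iota (Q $$ (d + d * s + i, d + d * s + j)))"
      by (rule nonsing_cong[OF _ E.nonsing_hom]) (use RC[OF R] Q(3)[OF s] in auto)
    assume an: "\<not> aniso L {..<d} (\<lambda>i j. iota (Q $$ (d + d * s + i, d + d * s + j)))"
    obtain c C where c: "Rs ! s = c \<cdot>\<^sub>m C" "c \<noteq> 0" "C \<in> pfister_forms (Suc n)" using Rs[OF R] by blast
    have "\<not> aniso L {..<d} (E.hm (Rs ! s))"
      using an aniso_cong[of "{..<d}" "E.hm (Rs ! s)" "\<lambda>i j. iota (Q $$ (d + d * s + i, d + d * s + j))" L] Q(3)[OF s] by auto
    hence "hyp L {..<d} (E.hm (Rs ! s))"
      using E.isotropic_pfister_hyp[OF c(3,2)] unfolding N c(1) by blast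
    thus "hyp L {..<d} (\<lambda>i j. iota (Q $$ (d + d * s + i, d + d * s + j)))"
      by (rule hyp_cong[rotated]) (use Q(3)[OF s] in auto)
  next
    fix L :: "'a univ set" assume L: "roomy L" "range iota \<subseteq> L"
    have sL: "subfld L" using L(1) unfolding roomy_def by blast
    interpret E: field_embedding iota L using embedding_iota[OF sL L(2)] .
    show "nonsing L {..<d} (\<lambda>i j. iota (Q $$ (i, j)))"
      by (rule nonsing_cong[OF _ E.nonsing_hom[OF AB nsAB]]) (use Q(2) in auto)
    show "hyp L {..<d + d * r} (\<lambda>i j. iota (Q $$ (i, j)))" using hypL[OF L] .
  next
    interpret E: field_embedding iota "range (iota :: 'a \<Rightarrow> 'a univ)"
      using embedding_iota[OF subfld_iota] by blast
    let ?u = "unitv 0 :: nat \<Rightarrow> 'a"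
    \<comment> \<open>Both Pfister forms take the value 1 at the first unit vector, so this vector
      has value \<open>1 + i^2 = 0\<close>.\<close>
    define v where "v = join p p ?u (\<lambda>j. i * ?u j)"
    have u: "?u \<in> fvec p" using univ.unitv_cvec[of 0 "{..<p}"] p1 by simp
    have iu: "(\<lambda>j. i * ?u j) \<in> fvec p" using univ.scale_cvec[OF u] by blast
    have v: "v \<in> fvec d" unfolding v_def d_def by (rule join_cvec[OF u iu])
    have qu: "qf {..<p} (qfm A) ?u = 1" "qf {..<p} (qfm B) ?u = 1"
      using qf_unitv[of "{..<p}" 0 "qfm A"] qf_unitv[of "{..<p}" 0 "qfm B"] p1 pfister_formsE(3)[OF A] pfister_formsE(3)[OF B] by simp_all
    have "qf {..<d} (qfm (orth_sum A B)) v = 0"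
      unfolding d_def qf_orth_sum[OF A' B'] v_def lo_join[OF u] hi_join[OF iu] qf_scale qu i by simp
    moreover have "qf {..<d} (\<lambda>i j. iota (Q $$ (i, j))) (\<lambda>i. iota (v i)) = iota (qf {..<d} (qfm (orth_sum A B)) v)"
      unfolding E.hom_qf by (rule qf_cong) (auto simp: Q(2))
    moreover have "(\<lambda>i. iota (v i)) \<in> cvec (range iota) {..<d}"
      using v by (auto simp: cvec_def iota_zero)
    moreover have "(\<lambda>i. iota (v i)) \<noteq> (\<lambda>_. 0)"
    proof
      assume "(\<lambda>i. iota (v i)) = (\<lambda>_. 0)"
      from fun_cong[OF this, of 0] have "v 0 = 0" using iota_eq_0 by blast
      thus False using p1 by (simp add: v_def join_def unitv_def)
    qed
    ultimately show "d < d \<or> d \<le> d \<and> \<not> aniso (range iota) {..<d} (\<lambda>i j. iota (Q $$ (i, j)))"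
      unfolding aniso_def by (metis iota_zero order.refl)
  qed auto
  have "hyp (range iota) {..<d} (\<lambda>i j. iota (orth_sum A B $$ (i, j)))"
    by (rule hyp_cong[OF _ main]) (auto simp: Q(2))
  hence "hyp UNIV {..<d} (qfm (orth_sum A B))" by (rule hyp_iota)
  thus ?thesis using isometric_hyperbolic_of_hyp[of "orth_sum A B" p] AB nsAB unfolding d_def p_def by blast
qed

section \<open>The group of Witt classes\<close>

lemma hyperbolic_form_0: "hyperbolic_form 0 \<in> carrier_mat 0 0"
  using hyperbolic_form_carrier[of 0] by simp

section \<open>Witt equivalence\<close>

lemma isometric_witt_equiv: "A \<in> carrier_mat n n \<Longrightarrow> isometric A B \<Longrightarrow> witt_equiv A B"
  unfolding witt_equiv_def
  using orth_sum_empty(1)[OF _ hyperbolic_form_0] isometric_carrier by metis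

lemma isometric_hyperbolic_witt_equiv:
  "A \<in> carrier_mat n n \<Longrightarrow> isometric A (hyperbolic_form k) \<Longrightarrow> witt_equiv A (0\<^sub>m 0 0)"
  unfolding witt_equiv_def
  using orth_sum_empty(1)[OF _ hyperbolic_form_0] orth_sum_empty(2)[OF hyperbolic_form_carrier, of "0\<^sub>m 0 0"]
  by (metis zero_carrier_mat)

lemma witt_equiv_sym: "witt_equiv A B \<Longrightarrow> witt_equiv B A"
  unfolding witt_equiv_def using isometric_sym by blast

lemma isometric_orth_hyperbolic_add:
  assumes A: "A \<in> carrier_mat n n"
  shows "isometric (orth_sum (orth_sum A (hyperbolic_form m)) (hyperbolic_form k)) (orth_sum A (hyperbolic_form (m + k)))"
  unfolding orth_sum_assoc[OF A hyperbolic_form_carrier hyperbolic_form_carrier]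
  by (rule isometric_orth_sum[OF isometric_refl[OF A] isometric_hyperbolic_add])

lemma isometric_orth_hyperbolic_swap:
  assumes A: "A \<in> carrier_mat n n"
  shows "isometric (orth_sum (orth_sum A (hyperbolic_form m)) (hyperbolic_form k))
    (orth_sum (orth_sum A (hyperbolic_form k)) (hyperbolic_form m))"
  using isometric_trans[OF isometric_orth_hyperbolic_add[OF A, of m k]
      isometric_sym[OF isometric_orth_hyperbolic_add[OF A, of k m, unfolded add.commute[of k m]]]] .

lemma witt_equiv_trans:
  assumes A: "A \<in> carrier_mat n n" and B: "B \<in> carrier_mat n' n'" and C: "C \<in> carrier_mat n'' n''"
    and "witt_equiv A B" "witt_equiv B C"
  shows "witt_equiv A C"
proof -
  let ?H = "hyperbolic_form"
  obtain m k m' k' where 1: "isometric (orth_sum A (?H m)) (orth_sum B (?H k))"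
    and 2: "isometric (orth_sum B (?H m')) (orth_sum C (?H k'))"
    using assms(4,5) unfolding witt_equiv_def by blast
  have "isometric (orth_sum A (?H (m + m'))) (orth_sum (orth_sum A (?H m)) (?H m'))"
    by (rule isometric_sym[OF isometric_orth_hyperbolic_add[OF A]])
  also have "isometric \<dots> (orth_sum (orth_sum B (?H k)) (?H m'))"
    by (rule isometric_orth_sum[OF 1 isometric_refl[OF hyperbolic_form_carrier]])
  also have "isometric \<dots> (orth_sum (orth_sum B (?H m')) (?H k))"
    by (rule isometric_orth_hyperbolic_swap[OF B])
  also have "isometric \<dots> (orth_sum (orth_sum C (?H k')) (?H k))"
    by (rule isometric_orth_sum[OF 2 isometric_refl[OF hyperbolic_form_carrier]])
  also have "isometric \<dots> (orth_sum C (?H (k' + k)))"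
    by (rule isometric_orth_hyperbolic_add[OF C])
  finally show ?thesis unfolding witt_equiv_def by blast
qed

lemma isometric_orth_hyperbolic_shuffle:
  assumes A: "A \<in> carrier_mat n n" and B: "B \<in> carrier_mat n' n'"
  shows "isometric (orth_sum (orth_sum A B) (hyperbolic_form (m + k)))
    (orth_sum (orth_sum A (hyperbolic_form m)) (orth_sum B (hyperbolic_form k)))"
proof -
  let ?H = "hyperbolic_form"
  note H = hyperbolic_form_carrier
  have "isometric (orth_sum (orth_sum A B) (?H (m + k))) (orth_sum (orth_sum (orth_sum A B) (?H m)) (?H k))"
    by (rule isometric_sym[OF isometric_orth_hyperbolic_add[OF orth_sum_carrier[OF A B]]])
  also have "orth_sum (orth_sum (orth_sum A B) (?H m)) (?H k) = orth_sum (orth_sum A (orth_sum B (?H m))) (?H k)"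
    using orth_sum_assoc[OF A B H] by simp
  finally have "isometric (orth_sum (orth_sum A B) (?H (m + k))) (orth_sum (orth_sum A (orth_sum B (?H m))) (?H k))" .
  also have "isometric \<dots> (orth_sum (orth_sum A (orth_sum (?H m) B)) (?H k))"
    by (intro isometric_orth_sum isometric_refl[OF A] isometric_refl[OF H] isometric_orth_sum_comm[OF B H])
  finally have 1: "isometric (orth_sum (orth_sum A B) (?H (m + k))) (orth_sum (orth_sum A (orth_sum (?H m) B)) (?H k))" .
  have "orth_sum (orth_sum A (orth_sum (?H m) B)) (?H k) = orth_sum (orth_sum (orth_sum A (?H m)) B) (?H k)"
    using orth_sum_assoc[OF A H B] by simp
  also have "\<dots> = orth_sum (orth_sum A (?H m)) (orth_sum B (?H k))"
    by (rule orth_sum_assoc[OF orth_sum_carrier[OF A H] B H])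
  finally show ?thesis using 1 by simp
qed

lemma witt_equiv_orth_sum:
  assumes A: "A \<in> carrier_mat n n" "A' \<in> carrier_mat n' n'" and B: "B \<in> carrier_mat m m" "B' \<in> carrier_mat m' m'"
    and "witt_equiv A A'" "witt_equiv B B'"
  shows "witt_equiv (orth_sum A B) (orth_sum A' B')"
proof -
  let ?H = "hyperbolic_form"
  obtain a a' b b' where 1: "isometric (orth_sum A (?H a)) (orth_sum A' (?H a'))"
    and 2: "isometric (orth_sum B (?H b)) (orth_sum B' (?H b'))"
    using assms(5,6) unfolding witt_equiv_def by blast
  have "isometric (orth_sum (orth_sum A B) (?H (a + b))) (orth_sum (orth_sum A (?H a)) (orth_sum B (?H b)))"
    by (rule isometric_orth_hyperbolic_shuffle[OF A(1) B(1)])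
  also have "isometric \<dots> (orth_sum (orth_sum A' (?H a')) (orth_sum B' (?H b')))"
    by (rule isometric_orth_sum[OF 1 2])
  also have "isometric \<dots> (orth_sum (orth_sum A' B') (?H (a' + b')))"
    by (rule isometric_sym[OF isometric_orth_hyperbolic_shuffle[OF A(2) B(2)]])
  finally show ?thesis unfolding witt_equiv_def by blast
qed

section \<open>The group structure on Witt classes\<close>

lemma even_nonsingularD:
  "A \<in> even_nonsingular_forms \<Longrightarrow> A \<in> carrier_mat (dim_row A) (dim_row A)"
  "A \<in> even_nonsingular_forms \<Longrightarrow> nonsingular_form A"
  unfolding even_nonsingular_forms_def nonsingular_form_def by auto

lemma even_nonsingularI:
  "A \<in> carrier_mat n n \<Longrightarrow> even n \<Longrightarrow> nonsingular_form A \<Longrightarrow> A \<in> even_nonsingular_forms"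
  unfolding even_nonsingular_forms_def by auto

lemma even_nonsingular_orth_sum:
  assumes "A \<in> even_nonsingular_forms" "B \<in> even_nonsingular_forms"
  shows "orth_sum A B \<in> even_nonsingular_forms"
proof (rule even_nonsingularI)
  note A = even_nonsingularD[OF assms(1)] and B = even_nonsingularD[OF assms(2)]
  show "orth_sum A B \<in> carrier_mat (dim_row A + dim_row B) (dim_row A + dim_row B)"
    by (rule orth_sum_carrier[OF A(1) B(1)])
  show "even (dim_row A + dim_row B)" using assms unfolding even_nonsingular_forms_def by simp
  show "nonsingular_form (orth_sum A B)" by (rule nonsingular_orth_sum[OF A B])
qed

lemma even_nonsingular_smult:
  assumes "A \<in> even_nonsingular_forms" "c \<noteq> 0"
  shows "c \<cdot>\<^sub>m A \<in> even_nonsingular_forms"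
  using even_nonsingularI[OF smult_carrier_mat[OF even_nonsingularD(1)[OF assms(1)]]]
    nonsingular_smult[OF even_nonsingularD[OF assms(1)] assms(2)] assms(1)
  unfolding even_nonsingular_forms_def by simp

lemma even_nonsingular_zero: "(0\<^sub>m 0 0 :: 'a::field mat) \<in> even_nonsingular_forms"
proof (rule even_nonsingularI)
  show "nonsingular_form (0\<^sub>m 0 0 :: 'a mat)"
    using nonsingular_form_iff[of "0\<^sub>m 0 0 :: 'a mat" 0] by (simp add: det_def)
qed auto

lemma witt_class_eq_iff:
  assumes A: "A \<in> even_nonsingular_forms" and B: "B \<in> even_nonsingular_forms"
  shows "witt_class A = witt_class B \<longleftrightarrow> witt_equiv A B"
proof
  assume "witt_class A = witt_class B"
  moreover have "B \<in> witt_class B"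
    using B isometric_witt_equiv[OF even_nonsingularD(1)[OF B] isometric_refl[OF even_nonsingularD(1)[OF B]]]
    unfolding witt_class_def by blast
  ultimately show "witt_equiv A B" unfolding witt_class_def by blast
next
  assume "witt_equiv A B"
  thus "witt_class A = witt_class B"
    using witt_equiv_trans[OF even_nonsingularD(1)[OF A] even_nonsingularD(1)[OF B] even_nonsingularD(1)]
      witt_equiv_trans[OF even_nonsingularD(1)[OF B] even_nonsingularD(1)[OF A] even_nonsingularD(1)] witt_equiv_sym
    unfolding witt_class_def by blast
qed

lemma witt_class_eqI:
  "A \<in> even_nonsingular_forms \<Longrightarrow> B \<in> even_nonsingular_forms \<Longrightarrow> isometric A B \<Longrightarrow> witt_class A = witt_class B"
  using witt_class_eq_iff isometric_witt_equiv even_nonsingularD(1) by blast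

lemma Iq1_carrier: "carrier Iq1_group = witt_class ` even_nonsingular_forms"
  and Iq1_one: "\<one>\<^bsub>Iq1_group\<^esub> = witt_class (0\<^sub>m 0 0)"
  unfolding Iq1_group_def by simp_all

lemma Iq1_mult:
  assumes A: "A \<in> even_nonsingular_forms" and B: "B \<in> even_nonsingular_forms"
  shows "witt_class A \<otimes>\<^bsub>Iq1_group\<^esub> witt_class B = witt_class (orth_sum A B)"
proof -
  have 1: "witt_class (orth_sum A' B') = witt_class (orth_sum A B)"
    if "A' \<in> witt_class A" "B' \<in> witt_class B" for A' B'
  proof -
    have m: "A' \<in> even_nonsingular_forms" "B' \<in> even_nonsingular_forms" "witt_equiv A A'" "witt_equiv B B'"
      using that unfolding witt_class_def by auto
    have "witt_equiv (orth_sum A B) (orth_sum A' B')"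
      by (rule witt_equiv_orth_sum[OF even_nonsingularD(1)[OF A] even_nonsingularD(1)[OF m(1)]
            even_nonsingularD(1)[OF B] even_nonsingularD(1)[OF m(2)] m(3,4)])
    thus ?thesis using witt_class_eq_iff even_nonsingular_orth_sum A B m by blast
  qed
  have 2: "A \<in> witt_class A" "B \<in> witt_class B"
    using witt_class_eq_iff[OF A A] witt_class_eq_iff[OF B B] A B unfolding witt_class_def by auto
  have "witt_class A \<otimes>\<^bsub>Iq1_group\<^esub> witt_class B = (\<Union>A'\<in>witt_class A. \<Union>B'\<in>witt_class B. witt_class (orth_sum A' B'))"
    by (simp add: Iq1_group_def)
  also have "\<dots> = (\<Union>A'\<in>witt_class A. \<Union>B'\<in>witt_class B. witt_class (orth_sum A B))"
    using 1 by (intro SUP_cong refl)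
  also have "\<dots> = witt_class (orth_sum A B)" using 2 by auto
  finally show ?thesis .
qed

lemma witt_class_neg_inverse:
  assumes A: "A \<in> even_nonsingular_forms"
  shows "witt_class (orth_sum A ((- 1) \<cdot>\<^sub>m A)) = \<one>\<^bsub>Iq1_group\<^esub>"
proof -
  have m: "orth_sum A ((- 1) \<cdot>\<^sub>m A) \<in> even_nonsingular_forms"
    using even_nonsingular_orth_sum[OF A even_nonsingular_smult[OF A, of "- 1"]] by simp
  show ?thesis
    unfolding Iq1_one witt_class_eq_iff[OF m even_nonsingular_zero]
    by (rule isometric_hyperbolic_witt_equiv[OF even_nonsingularD(1)[OF m] isometric_orth_sum_neg[OF even_nonsingularD[OF A]]])
qed

lemma comm_group_Iq1: "comm_group (Iq1_group :: 'a::field mat set monoid)"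
proof (rule comm_groupI)
  let ?G = "Iq1_group :: 'a mat set monoid"
  fix x y assume "x \<in> carrier ?G" "y \<in> carrier ?G"
  then obtain A B where A: "A \<in> even_nonsingular_forms" "x = witt_class A"
    and B: "B \<in> even_nonsingular_forms" "y = witt_class B" unfolding Iq1_carrier by blast
  show "x \<otimes>\<^bsub>?G\<^esub> y \<in> carrier ?G"
    unfolding A(2) B(2) Iq1_mult[OF A(1) B(1)] Iq1_carrier using even_nonsingular_orth_sum[OF A(1) B(1)] by blast
  show "x \<otimes>\<^bsub>?G\<^esub> y = y \<otimes>\<^bsub>?G\<^esub> x"
    unfolding A(2) B(2) Iq1_mult[OF A(1) B(1)] Iq1_mult[OF B(1) A(1)]
    by (intro witt_class_eqI even_nonsingular_orth_sum A B isometric_orth_sum_comm[OF even_nonsingularD(1)[OF A(1)] even_nonsingularD(1)[OF B(1)]])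
  fix z assume "z \<in> carrier ?G"
  then obtain C where C: "C \<in> even_nonsingular_forms" "z = witt_class C" unfolding Iq1_carrier by blast
  show "x \<otimes>\<^bsub>?G\<^esub> y \<otimes>\<^bsub>?G\<^esub> z = x \<otimes>\<^bsub>?G\<^esub> (y \<otimes>\<^bsub>?G\<^esub> z)"
    unfolding A(2) B(2) C(2) using Iq1_mult even_nonsingular_orth_sum A(1) B(1) C(1)
      orth_sum_assoc[OF even_nonsingularD(1)[OF A(1)] even_nonsingularD(1)[OF B(1)] even_nonsingularD(1)[OF C(1)]]
    by metis
next
  let ?G = "Iq1_group :: 'a mat set monoid"
  show "\<one>\<^bsub>?G\<^esub> \<in> carrier ?G" unfolding Iq1_carrier Iq1_one using even_nonsingular_zero by blast
  fix x assume "x \<in> carrier ?G"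
  then obtain A where A: "A \<in> even_nonsingular_forms" "x = witt_class A" unfolding Iq1_carrier by blast
  show "\<one>\<^bsub>?G\<^esub> \<otimes>\<^bsub>?G\<^esub> x = x"
    unfolding A(2) Iq1_one Iq1_mult[OF even_nonsingular_zero A(1)]
    using orth_sum_empty(2)[OF even_nonsingularD(1)[OF A(1)], of "0\<^sub>m 0 0"] by simp
  have N: "(- 1) \<cdot>\<^sub>m A \<in> even_nonsingular_forms" using even_nonsingular_smult[OF A(1), of "- 1"] by simp
  have "witt_class ((- 1) \<cdot>\<^sub>m A) \<otimes>\<^bsub>?G\<^esub> x = witt_class (orth_sum A ((- 1) \<cdot>\<^sub>m A))"
    unfolding A(2) Iq1_mult[OF N A(1)]
    by (intro witt_class_eqI even_nonsingular_orth_sum A N isometric_orth_sum_comm[OF even_nonsingularD(1)[OF N] even_nonsingularD(1)[OF A(1)]])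
  thus "\<exists>y\<in>carrier ?G. y \<otimes>\<^bsub>?G\<^esub> x = \<one>\<^bsub>?G\<^esub>"
    using witt_class_neg_inverse[OF A(1)] N unfolding Iq1_carrier by (metis imageI)
qed

interpretation Iq1: comm_group "Iq1_group :: 'a::field mat set monoid"
  by (rule comm_group_Iq1)

lemma Iq1_square:
  fixes i :: "'a::field"
  assumes i: "i\<^sup>2 = - 1" and x: "x \<in> carrier (Iq1_group :: 'a mat set monoid)"
  shows "x \<otimes>\<^bsub>Iq1_group\<^esub> x = \<one>\<^bsub>Iq1_group\<^esub>"
proof -
  obtain A where A: "A \<in> even_nonsingular_forms" "x = witt_class A" using x unfolding Iq1_carrier by blast
  note cA = even_nonsingularD(1)[OF A(1)]
  have i0: "i \<noteq> 0" using i by auto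
  have "isometric A ((- 1) \<cdot>\<^sub>m A)"
  proof (rule isometricI[OF cA smult_carrier_mat[OF cA]])
    show "lmap UNIV (fvec (dim_row A)) (fvec (dim_row A)) (\<lambda>v j. i * v j)"
      by (rule univ.lmap_scale) (auto simp: lmap_def)
    show "v = (\<lambda>_. 0)" if "(\<lambda>j. i * v j) = (\<lambda>_. 0)" for v :: "nat \<Rightarrow> 'a"
      using that i0 by (simp add: fun_eq_iff)
    show "qf {..<dim_row A} (qfm ((- 1) \<cdot>\<^sub>m A)) (\<lambda>j. i * v j) = qf {..<dim_row A} (qfm A) v" for v
      unfolding qf_smult[OF cA] qf_scale i by simp
  qed
  hence "isometric (orth_sum A A) (orth_sum A ((- 1) \<cdot>\<^sub>m A))"
    by (intro isometric_orth_sum isometric_refl[OF cA])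
  moreover have "(- 1) \<cdot>\<^sub>m A \<in> even_nonsingular_forms" using even_nonsingular_smult[OF A(1), of "- 1"] by simp
  ultimately have "witt_class (orth_sum A A) = \<one>\<^bsub>Iq1_group\<^esub>"
    using witt_class_eqI even_nonsingular_orth_sum A(1) witt_class_neg_inverse[OF A(1)] by metis
  thus ?thesis unfolding A(2) Iq1_mult[OF A(1) A(1)] .
qed

section \<open>The filtration generated by scaled Pfister forms\<close>

definition scaled_pfister :: "nat \<Rightarrow> 'a::field mat set" where
  "scaled_pfister n = {c \<cdot>\<^sub>m A | c A. c \<noteq> 0 \<and> A \<in> pfister_forms n}"

lemma Iq_eq: "Iq n = generate Iq1_group (witt_class ` scaled_pfister n)"
  unfolding Iq_def scaled_pfister_def by (rule arg_cong[of _ _ "generate Iq1_group"]) auto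

lemma pfister_even_nonsingular: "A \<in> pfister_forms n \<Longrightarrow> A \<in> even_nonsingular_forms"
  using pfister_formsE[of A n] by (intro even_nonsingularI[of A "2 ^ n"]) auto

lemma scaled_pfister_even_nonsingular: "scaled_pfister n \<subseteq> even_nonsingular_forms"
  unfolding scaled_pfister_def using pfister_even_nonsingular even_nonsingular_smult by blast

lemma scaled_pfister_carrier: "witt_class ` scaled_pfister n \<subseteq> carrier Iq1_group"
  unfolding Iq1_carrier using scaled_pfister_even_nonsingular by blast

lemma subgroup_Iq: "subgroup (Iq n) Iq1_group"
  unfolding Iq_eq by (rule Iq1.generate_is_subgroup[OF scaled_pfister_carrier])

lemma pfister_classes_Iq: "pfister_classes n \<subseteq> Iq n"
proof
  fix x :: "'a mat set" assume "x \<in> pfister_classes n"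
  then obtain A where A: "A \<in> pfister_forms n" "x = witt_class A" unfolding pfister_classes_def by blast
  have "1 \<cdot>\<^sub>m A = A" by (rule eq_matI) auto
  hence "A \<in> scaled_pfister n" unfolding scaled_pfister_def using A(1) one_neq_zero by (metis (mono_tags, lifting) mem_Collect_eq)
  thus "x \<in> Iq n" unfolding Iq_eq A(2) by (intro generate.incl) blast
qed

text \<open>With one bilinear slot \<open>b\<close> split off, a scaled (n+1)-fold form is the sum
  of the n-fold forms with scalars \<open>c\<close> and \<open>c * b\<close>.\<close>

lemma Iq_Suc_subset:
  assumes "n \<ge> 1"
  shows "Iq (Suc n) \<subseteq> (Iq n :: 'a::field mat set set)"
  unfolding Iq_eq[of "Suc n"]
proof (rule Iq1.generate_subgroup_incl[OF _ subgroup_Iq], rule image_subsetI)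
  fix x :: "'a mat" assume "x \<in> scaled_pfister (Suc n)"
  then obtain c bs a where c: "x = c \<cdot>\<^sub>m quadratic_pfister bs a" "c \<noteq> 0" "length bs = n" "0 \<notin> set bs"
    "nonsingular_form (binary_form 1 a)"
    unfolding scaled_pfister_def pfister_forms_def by auto
  obtain b bs' where bs: "bs = b # bs'" using c(3) assms by (cases bs) auto
  let ?Y = "quadratic_pfister bs' a"
  have Y: "?Y \<in> pfister_forms n" unfolding pfister_forms_def using c bs by auto
  have b: "b \<noteq> 0" using c(4) bs by auto
  have "x = orth_sum (c \<cdot>\<^sub>m ?Y) ((c * b) \<cdot>\<^sub>m ?Y)"
    unfolding c(1) bs quadratic_pfister_Cons
    by (rule eq_matI) (use quadratic_pfister_carrier[of bs' a] in \<open>auto simp: orth_sum_def\<close>)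
  moreover have m: "c \<cdot>\<^sub>m ?Y \<in> scaled_pfister n" "(c * b) \<cdot>\<^sub>m ?Y \<in> scaled_pfister n"
    unfolding scaled_pfister_def
    by (intro CollectI exI[of _ c] exI[of _ ?Y]; use Y c(2) in simp)
      (intro CollectI exI[of _ "c * b"] exI[of _ ?Y]; use Y c(2) b in simp)
  ultimately have "witt_class x = witt_class (c \<cdot>\<^sub>m ?Y) \<otimes>\<^bsub>Iq1_group\<^esub> witt_class ((c * b) \<cdot>\<^sub>m ?Y)"
    using Iq1_mult scaled_pfister_even_nonsingular by (metis subsetD)
  moreover have "witt_class (c \<cdot>\<^sub>m ?Y) \<in> Iq n" "witt_class ((c * b) \<cdot>\<^sub>m ?Y) \<in> Iq n"
    unfolding Iq_eq using m by (auto intro: generate.incl)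
  ultimately show "witt_class x \<in> Iq n" using subgroup.m_closed[OF subgroup_Iq] by metis
qed

lemma foldl_orth_sum_even_nonsingular:
  "Y \<in> even_nonsingular_forms \<Longrightarrow> set Rs \<subseteq> even_nonsingular_forms \<Longrightarrow> foldl orth_sum Y Rs \<in> even_nonsingular_forms"
  by (induction Rs arbitrary: Y) (auto intro: even_nonsingular_orth_sum)

text \<open>Inverses of generators cost nothing, since every class is its own inverse. Adding to an
  arbitrary \<open>Y\<close> makes the product of two elements correspond to the concatenation of
  their lists.\<close>

lemma Iq_element_list:
  fixes i :: "'a::field"
  assumes i: "i\<^sup>2 = - 1" and x: "x \<in> (Iq n :: 'a mat set set)"
  shows "\<exists>Rs. set Rs \<subseteq> scaled_pfister n \<and>
    (\<forall>Y\<in>even_nonsingular_forms. witt_class Y \<otimes>\<^bsub>Iq1_group\<^esub> x = witt_class (foldl orth_sum Y Rs))"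
  using x unfolding Iq_eq
proof (induction rule: generate.induct)
  case one
  show ?case
    by (intro exI[of _ "[]"]) (auto simp: Iq1_carrier)
next
  case (incl h)
  then obtain R where R: "R \<in> scaled_pfister n" "h = witt_class R" by blast
  hence "R \<in> even_nonsingular_forms" using scaled_pfister_even_nonsingular by blast
  thus ?case using R by (intro exI[of _ "[R]"]) (simp add: Iq1_mult)
next
  case (inv h)
  then obtain R where R: "R \<in> scaled_pfister n" "h = witt_class R" by blast
  have h: "h \<in> carrier Iq1_group" using inv scaled_pfister_carrier by blast
  have "inv\<^bsub>Iq1_group\<^esub> h = h" using Iq1.inv_equality[OF Iq1_square[OF i h] h h] .
  moreover have "R \<in> even_nonsingular_forms" using R scaled_pfister_even_nonsingular by blast
  ultimately show ?case using R by (intro exI[of _ "[R]"]) (simp add: Iq1_mult)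
next
  case (eng x y)
  obtain Rs where Rs: "set Rs \<subseteq> scaled_pfister n"
    "\<And>Y. Y \<in> even_nonsingular_forms \<Longrightarrow> witt_class Y \<otimes>\<^bsub>Iq1_group\<^esub> x = witt_class (foldl orth_sum Y Rs)"
    using eng.IH(1) by blast
  obtain Ss where Ss: "set Ss \<subseteq> scaled_pfister n"
    "\<And>Y. Y \<in> even_nonsingular_forms \<Longrightarrow> witt_class Y \<otimes>\<^bsub>Iq1_group\<^esub> y = witt_class (foldl orth_sum Y Ss)"
    using eng.IH(2) by blast
  have xy: "x \<in> carrier Iq1_group" "y \<in> carrier Iq1_group"
    using eng.hyps Iq1.generate_in_carrier[OF scaled_pfister_carrier] by auto
  have "witt_class Y \<otimes>\<^bsub>Iq1_group\<^esub> (x \<otimes>\<^bsub>Iq1_group\<^esub> y) = witt_class (foldl orth_sum Y (Rs @ Ss))"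
    if Y: "Y \<in> even_nonsingular_forms" for Y
  proof -
    have "witt_class Y \<in> carrier Iq1_group" using Y by (auto simp: Iq1_carrier)
    moreover have "foldl orth_sum Y Rs \<in> even_nonsingular_forms"
      using foldl_orth_sum_even_nonsingular[OF Y] Rs(1) scaled_pfister_even_nonsingular by blast
    ultimately show ?thesis using Rs(2)[OF Y] Ss(2) xy by (simp add: Iq1.m_assoc[symmetric])
  qed
  thus ?case using Rs(1) Ss(1) by (intro exI[of _ "Rs @ Ss"]) auto
qed

text \<open>If \<open>f\<close> and \<open>g\<close> differ by \<open>x\<close> in the next group,
  then \<open>f\<close>, \<open>g\<close> and \<open>x\<close> add up to zero because the group has
  exponent two. With \<open>x\<close> written as a list of scaled Pfister forms this is the
  situation of \<open>hauptsatz\<close>, which makes the sum of \<open>f\<close> and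
  \<open>g\<close> vanish.\<close>

lemma pfister_class_unique:
  fixes i :: "'a::field"
  assumes i: "i\<^sup>2 = - 1" and n: "n \<ge> 1"
    and f: "f \<in> (pfister_classes n :: 'a mat set set)" and g: "g \<in> pfister_classes n"
    and eq: "Iq_proj n f = Iq_proj n g"
  shows "f = g"
proof -
  let ?G = "Iq1_group :: 'a mat set monoid"
  obtain A B where A: "A \<in> pfister_forms n" "f = witt_class A" and B: "B \<in> pfister_forms n" "g = witt_class B"
    using f g unfolding pfister_classes_def by blast
  note eA = pfister_even_nonsingular[OF A(1)] and eB = pfister_even_nonsingular[OF B(1)]
  have fc: "f \<in> carrier ?G" "g \<in> carrier ?G" using eA eB A B by (auto simp: Iq1_carrier)
  have "\<one>\<^bsub>?G\<^esub> \<otimes>\<^bsub>?G\<^esub> f \<in> Iq_proj n f"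
    unfolding Iq_proj_def r_coset_def Iq_group_def using subgroup.one_closed[OF subgroup_Iq] by auto
  hence "f \<in> Iq_proj n g" using fc eq by simp
  then obtain x where x: "x \<in> Iq (Suc n)" "f = x \<otimes>\<^bsub>?G\<^esub> g"
    unfolding Iq_proj_def r_coset_def Iq_group_def by auto
  have xc: "x \<in> carrier ?G" using subgroup.mem_carrier[OF subgroup_Iq x(1)] .
  obtain Rs where Rs: "set Rs \<subseteq> scaled_pfister (Suc n)"
    "\<And>Y. Y \<in> even_nonsingular_forms \<Longrightarrow> witt_class Y \<otimes>\<^bsub>?G\<^esub> x = witt_class (foldl orth_sum Y Rs)"
    using Iq_element_list[OF i x(1)] by blast
  have AB: "orth_sum A B \<in> even_nonsingular_forms" using even_nonsingular_orth_sum[OF eA eB] .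
  have F: "foldl orth_sum (orth_sum A B) Rs \<in> even_nonsingular_forms"
    using foldl_orth_sum_even_nonsingular[OF AB] Rs(1) scaled_pfister_even_nonsingular by blast
  have "witt_class (foldl orth_sum (orth_sum A B) Rs) = (f \<otimes>\<^bsub>?G\<^esub> g) \<otimes>\<^bsub>?G\<^esub> x"
    using Rs(2)[OF AB] Iq1_mult[OF eA eB] A B by simp
  also have "\<dots> = f \<otimes>\<^bsub>?G\<^esub> (x \<otimes>\<^bsub>?G\<^esub> g)" 
    using fc xc Iq1.m_assoc[of f g x] Iq1.m_comm[of g x] by simp
  also have "\<dots> = \<one>\<^bsub>?G\<^esub>" using x(2) Iq1_square[OF i fc(1)] by simp
  finally have "witt_equiv (foldl orth_sum (orth_sum A B) Rs) (0\<^sub>m 0 0)"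
    unfolding Iq1_one using witt_class_eq_iff[OF F even_nonsingular_zero] by blast
  hence "isometric (hyperbolic_form (2 ^ n)) (orth_sum A B)"
    using hauptsatz[OF i A(1) B(1), of Rs] Rs(1) unfolding scaled_pfister_def by blast
  hence "witt_equiv (orth_sum A B) (0\<^sub>m 0 0)"
    using isometric_hyperbolic_witt_equiv[OF even_nonsingularD(1)[OF AB]] isometric_sym by blast
  hence "f \<otimes>\<^bsub>?G\<^esub> g = \<one>\<^bsub>?G\<^esub>"
    unfolding A(2) B(2) Iq1_mult[OF eA eB] Iq1_one using witt_class_eq_iff[OF AB even_nonsingular_zero] by blast
  hence "f \<otimes>\<^bsub>?G\<^esub> g = g \<otimes>\<^bsub>?G\<^esub> g" using Iq1_square[OF i fc(2)] by simp
  thus ?thesis using fc Iq1.r_cancel by blast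
qed

text \<open>All bilinear slots are 1 and the last one is 0. The form is isotropic because
  \<open>[1, 0]\<close> vanishes at \<open>(0, 1)\<close>, hence hyperbolic. Having zero among the
  Pfister classes lets uniqueness show that nonzero ones stay nonzero in the quotient.\<close>

lemma one_pfister_class:
  assumes n: "n \<ge> 1"
  shows "\<one>\<^bsub>Iq1_group\<^esub> \<in> (pfister_classes n :: 'a::field mat set set)"
proof -
  let ?bs = "replicate (n - 1) 1 :: 'a list"
  define A where "A = quadratic_pfister ?bs (0 :: 'a)"
  have ns: "nonsingular_form (binary_form 1 0 :: 'a mat)"
  proof -
    define G where "G = binary_form 1 0 + transpose_mat (binary_form 1 (0 :: 'a))"
    have G: "G \<in> carrier_mat 2 2" unfolding G_def using binary_form_carrier[of 1 "0 :: 'a"] by simp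
    have Ge: "G $$ (0, 0) = 2" "G $$ (0, 1) = 1" "G $$ (1, 0) = 1" "G $$ (1, 1) = 0"
      unfolding G_def binary_form_def by (simp_all add: mat_of_rows_list_def)
    have "v = 0\<^sub>v 2" if v: "v \<in> carrier_vec 2" "G *\<^sub>v v = 0\<^sub>v 2" for v
    proof -
      have e: "G $$ (k, 0) * v $ 0 + G $$ (k, 1) * v $ 1 = 0" if k: "k < 2" for k
        using arg_cong[OF v(2), of "\<lambda>x. vec_index x k"] k G v(1) by (simp add: scalar_prod_def numeral_2_eq_2)
      have "v $ 0 = 0" "v $ 1 = 0" using e[of 0] e[of 1] Ge by simp_all
      thus ?thesis using v(1) by (intro eq_vecI) (auto simp: less_Suc_eq numeral_2_eq_2)
    qed
    hence "det G \<noteq> 0" using det_0_iff_vec_prod_zero_field[OF G] by blast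
    thus ?thesis using nonsingular_form_iff[OF binary_form_carrier[of 1 "0 :: 'a"]] unfolding G_def by blast
  qed
  have A: "A \<in> pfister_forms n" unfolding pfister_forms_def A_def using n ns
    by (intro CollectI exI[of _ ?bs] exI[of _ 0]) auto
  have cA: "A \<in> carrier_mat (2 ^ n) (2 ^ n)" using pfister_formsE(1)[OF A] .
  have "A $$ (1, 1) = 0 \<and> 1 < dim_row A"
  proof -
    have "quadratic_pfister bs (0 :: 'a) $$ (1, 1) = 0" for bs
    proof (induction bs)
      case Nil thus ?case by (simp add: quadratic_pfister_Nil binary_form_def mat_of_rows_list_def)
    next
      case (Cons b bs)
      have "(1::nat) < 2 ^ Suc (length bs)" by (rule one_less_power) auto
      thus ?case using Cons quadratic_pfister_carrier[of bs "0 :: 'a"] by (simp add: quadratic_pfister_Cons orth_sum_def)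
    qed
    moreover have "(1::nat) < 2 ^ n" using n by (intro one_less_power) auto
    ultimately show ?thesis using cA unfolding A_def by simp
  qed
  hence 1: "qf {..<2 ^ n} (qfm A) (unitv 1) = 0" "(unitv 1 :: nat \<Rightarrow> 'a) \<in> fvec (2 ^ n)"
    using qf_unitv[of "{..<(2::nat) ^ n}" 1 "qfm A"] cA univ.unitv_cvec[of "1::nat" "{..<2 ^ n}"] by auto
  have s1: "1 \<cdot>\<^sub>m A = A" by (rule eq_matI) auto
  have "\<not> aniso UNIV {..<2 ^ n} (qfm A)"
  proof
    assume "aniso UNIV {..<2 ^ n} (qfm A)"
    hence "(unitv 1 :: nat \<Rightarrow> 'a) = (\<lambda>_. 0)" using 1 unfolding aniso_def by blast
    from fun_cong[OF this, of 1] show False by (simp add: unitv_def)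
  qed
  hence h: "hyp UNIV {..<2 ^ n} (qfm A)" using field_embedding.isotropic_pfister_hyp[OF embedding_id A, of 1] s1 by simp
  have e: "(2::nat) ^ n = 2 ^ (n - 1) + 2 ^ (n - 1)" using n by (cases n) auto
  have "isometric (hyperbolic_form (2 ^ (n - 1))) A"
    by (rule isometric_hyperbolic_of_hyp) (use cA h pfister_formsE(2)[OF A] e in simp_all)
  hence "witt_equiv A (0\<^sub>m 0 0)" using isometric_hyperbolic_witt_equiv[OF cA] isometric_sym by blast
  hence "witt_class A = \<one>\<^bsub>Iq1_group\<^esub>"
    unfolding Iq1_one using witt_class_eq_iff[OF pfister_even_nonsingular[OF A] even_nonsingular_zero] by blast
  thus ?thesis using A unfolding pfister_classes_def by (metis imageI)
qed

section \<open>Products over groups of exponent two\<close>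

lemma hom_finprod:
  assumes G: "comm_group G" and H: "comm_group H" and h: "h \<in> hom G H" and "f \<in> A \<rightarrow> carrier G"
  shows "h (finprod G f A) = finprod H (\<lambda>x. h (f x)) A"
proof -
  interpret G: comm_group G by fact
  interpret H: comm_group H by fact
  interpret h: group_hom G H h by unfold_locales (rule h)
  show ?thesis
    using assms(4)
  proof (induction A rule: infinite_finite_induct)
    case (insert a A)
    have f: "f \<in> A \<rightarrow> carrier G" "f a \<in> carrier G" using insert.prems by auto
    have "(\<lambda>x. h (f x)) \<in> A \<rightarrow> carrier H" "h (f a) \<in> carrier H" using f by (auto simp: Pi_iff)
    thus ?case using insert f by (simp add: G.finprod_insert H.finprod_insert G.finprod_closed)
  qed (simp_all add: G.finprod_infinite H.finprod_infinite)
qed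

context comm_group
begin

text \<open>In exponent two a new generator adds at most one coset.\<close>

lemma generate_insert_exponent_two:
  assumes sq: "\<And>x. x \<in> carrier G \<Longrightarrow> x \<otimes> x = \<one>" and S: "S \<subseteq> carrier G" and a: "a \<in> carrier G"
  shows "generate G (insert a S) = generate G S \<union> (\<lambda>x. a \<otimes> x) ` generate G S"
proof
  have gc: "x \<in> carrier G" if "x \<in> generate G S" for x using generate_in_carrier[OF S that] .
  have inv: "inv x = x" if "x \<in> carrier G" for x using inv_equality[OF sq[OF that] that that] .
  show "generate G (insert a S) \<subseteq> generate G S \<union> (\<lambda>x. a \<otimes> x) ` generate G S"
  proof
    fix x assume "x \<in> generate G (insert a S)"
    thus "x \<in> generate G S \<union> (\<lambda>x. a \<otimes> x) ` generate G S"
    proof (induction rule: generate.induct)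
      case one thus ?case using generate.one by blast
    next
      case (incl h)
      have "a = a \<otimes> \<one>" using a by simp
      thus ?case using incl generate.one[of G S] generate.incl[of h S G] by blast
    next
      case (inv h)
      have "inv h = h" using inv a S \<open>\<And>x. x \<in> carrier G \<Longrightarrow> inv x = x\<close> by blast
      moreover have "a = a \<otimes> \<one>" using a by simp
      ultimately show ?case using inv generate.one[of G S] generate.incl[of h S G] by auto
    next
      case (eng x y)
      obtain u where u: "u \<in> generate G S" "x = u \<or> x = a \<otimes> u" using eng.IH(1) by blast
      obtain v where v: "v \<in> generate G S" "y = v \<or> y = a \<otimes> v" using eng.IH(2) by blast
      have uv: "u \<otimes> v \<in> generate G S" using generate.eng[OF u(1) v(1)] .
      have c: "u \<in> carrier G" "v \<in> carrier G" using gc u v by auto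
      have 1: "u \<otimes> (a \<otimes> v) = a \<otimes> (u \<otimes> v)" using c a by (simp add: m_lcomm)
      have 2: "a \<otimes> u \<otimes> v = a \<otimes> (u \<otimes> v)" using c a by (simp add: m_assoc)
      have "a \<otimes> u \<otimes> (a \<otimes> v) = (a \<otimes> a) \<otimes> (u \<otimes> v)" using c a by (simp add: m_ac)
      hence 3: "a \<otimes> u \<otimes> (a \<otimes> v) = u \<otimes> v" using sq[OF a] c by simp
      show ?case using u(2) v(2) uv 1 2 3 by (metis UnI1 UnI2 imageI)
    qed
  qed
  have sub: "generate G S \<subseteq> generate G (insert a S)" by (rule mono_generate) blast
  moreover have "a \<otimes> x \<in> generate G (insert a S)" if "x \<in> generate G S" for x
    using generate.eng[OF generate.incl[of a "insert a S" G]] that sub by blast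
  ultimately show "generate G S \<union> (\<lambda>x. a \<otimes> x) ` generate G S \<subseteq> generate G (insert a S)" by blast
qed

text \<open>If \<open>a\<close> is new, the product over both cosets of \<open>V\<close> is
  \<open>a\<close> to the power \<open>card V\<close>, as the product over \<open>V\<close> enters
  squared. This is trivial for even \<open>card V\<close>; the exception \<open>card V = 1\<close>
  gives the group of order two. The parity clause keeps the induction going.\<close>

lemma finprod_generate_exponent_two:
  assumes sq: "\<And>x. x \<in> carrier G \<Longrightarrow> x \<otimes> x = \<one>" and "finite S" and "S \<subseteq> carrier G"
  shows "finite (generate G S) \<and> (card (generate G S) \<le> 2 \<or> finprod G (\<lambda>x. x) (generate G S) = \<one>) \<and>
    (card (generate G S) = 1 \<or> even (card (generate G S)))"
  using assms(2,3)
proof (induction S)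
  case empty
  thus ?case by (simp add: generate_empty)
next
  case (insert a S)
  let ?V = "generate G S"
  have a: "a \<in> carrier G" and S: "S \<subseteq> carrier G" using insert.prems by auto
  have V: "finite ?V" "card ?V \<le> 2 \<or> finprod G (\<lambda>x. x) ?V = \<one>" "card ?V = 1 \<or> even (card ?V)"
    using insert.IH[OF S] by auto
  have Vc: "?V \<subseteq> carrier G" using generate_incl[OF S] .
  have sV: "subgroup ?V G" using generate_is_subgroup[OF S] .
  have g: "generate G (insert a S) = ?V \<union> (\<lambda>x. a \<otimes> x) ` ?V"
    by (rule generate_insert_exponent_two[OF sq S a])
  show ?case
  proof (cases "a \<in> ?V")
    case True
    hence "(\<lambda>x. a \<otimes> x) ` ?V \<subseteq> ?V" using subgroup.m_closed[OF sV] by blast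
    hence "generate G (insert a S) = ?V" unfolding g by blast
    thus ?thesis using V by simp
  next
    case False
    let ?W = "(\<lambda>x. a \<otimes> x) ` ?V"
    have inj: "inj_on (\<lambda>x. a \<otimes> x) ?V" using a Vc by (intro inj_onI) (metis l_cancel subsetD)
    have disj: "?V \<inter> ?W = {}"
    proof (rule ccontr)
      assume "?V \<inter> ?W \<noteq> {}"
      then obtain x where x: "x \<in> ?V" "a \<otimes> x \<in> ?V" by blast
      have "a = a \<otimes> x \<otimes> x" using a x Vc sq[of x] by (simp add: m_assoc subsetD)
      thus False using False subgroup.m_closed[OF sV x(2,1)] by simp
    qed
    have card: "card (?V \<union> ?W) = card ?V + card ?V"
      using card_Un_disjoint[OF V(1) _ disj] V(1) card_image[OF inj] by simp
    have Wc: "(\<lambda>x. x) \<in> ?W \<rightarrow> carrier G" "(\<lambda>x. x) \<in> ?V \<rightarrow> carrier G" using Vc a by auto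
    let ?P = "finprod G (\<lambda>x. x) ?V"
    have P: "?P \<in> carrier G" using Wc(2) by (rule finprod_closed)
    have "finprod G (\<lambda>x. x) ?W = finprod G (\<lambda>x. a \<otimes> x) ?V"
      by (rule finprod_reindex[OF Wc(1) inj])
    also have "\<dots> = finprod G (\<lambda>x. a) ?V \<otimes> ?P"
      by (rule finprod_multf) (use a Wc in auto)
    also have "finprod G (\<lambda>x. a) ?V = a [^] card ?V" by (rule finprod_const[OF a])
    finally have W: "finprod G (\<lambda>x. x) ?W = a [^] card ?V \<otimes> ?P" .
    have "finprod G (\<lambda>x. x) (?V \<union> ?W) = ?P \<otimes> (a [^] card ?V \<otimes> ?P)"
      using finprod_Un_disjoint[OF V(1) _ disj Wc(2,1)] V(1) W by simp
    also have "\<dots> = a [^] card ?V \<otimes> (?P \<otimes> ?P)" using P a by (simp add: m_lcomm)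
    also have "\<dots> = a [^] card ?V" using sq[OF P] a by simp
    finally have prod: "finprod G (\<lambda>x. x) (?V \<union> ?W) = a [^] card ?V" .
    have pow: "a [^] card ?V = \<one>" if "even (card ?V)"
    proof -
      define k where "k = card ?V div 2"
      have k: "card ?V = k + k" using that unfolding k_def by presburger
      have "a [^] card ?V = a [^] k \<otimes> a [^] k" unfolding k using nat_pow_mult[OF a, of k k] by simp
      thus ?thesis using sq[of "a [^] k"] a by simp
    qed
    show ?thesis
      unfolding g using card prod pow V(1,3) by auto
  qed
qed

text \<open>Two distinct nontrivial elements and the identity exceed the exceptional order
  two.\<close>

lemma finprod_generate_trivial:
  assumes "\<And>x. x \<in> carrier G \<Longrightarrow> x \<otimes> x = \<one>" "finite S" "S \<subseteq> carrier G"
    and ab: "a \<in> S" "b \<in> S" "a \<noteq> b" "a \<noteq> \<one>" "b \<noteq> \<one>"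
  shows "finite (generate G S)" "finprod G (\<lambda>x. x) (generate G S) = \<one>"
proof -
  have *: "finite (generate G S) \<and> (card (generate G S) \<le> 2 \<or> finprod G (\<lambda>x. x) (generate G S) = \<one>)"
    using finprod_generate_exponent_two[OF assms(1-3)] by blast
  thus fin: "finite (generate G S)" by blast
  have "{\<one>, a, b} \<subseteq> generate G S" using generate.one[of G S] generate.incl[OF ab(1), of G] generate.incl[OF ab(2), of G] by simp
  hence "card {\<one>, a, b} \<le> card (generate G S)" by (rule card_mono[OF fin])
  moreover have "card {\<one>, a, b} = 3" using ab by simp
  ultimately show "finprod G (\<lambda>x. x) (generate G S) = \<one>" using * by auto
qed

end

section \<open>The sum over a tight set\<close>

theorem proposition4p2:
  fixes S :: "'a::field mat set set" and n :: nat
  assumes sqrt_minus_one: "CHAR('a) \<noteq> 2 \<Longrightarrow> \<exists>i::'a. i\<^sup>2 = - 1"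
    and n: "n \<ge> 1"
    and fin: "finite S"
    and more_than_one: "card (S - {\<one>\<^bsub>Iq1_group\<^esub>}) > 1"
  shows "(tight n S \<longrightarrow> Sigma_inv n S \<in> Iq (n + 1)) \<and>
         (strongly_tight n S \<longrightarrow> Sigma_inv n S = \<one>\<^bsub>Iq1_group\<^esub>)"
proof -
  let ?G = "Iq1_group :: 'a mat set monoid" and ?H = "Iq_group n :: 'a mat set monoid"
  let ?K = "Iq (Suc n) :: 'a mat set set" and ?Q = "Iq_quot n :: 'a mat set set monoid"
  let ?pr = "Iq_proj n :: 'a mat set \<Rightarrow> _" and ?P = "pfister_classes n :: 'a mat set set"
  have "\<exists>i::'a. i\<^sup>2 = - 1"
  proof (cases "CHAR('a) = 2")
    case True
    hence "of_nat 2 = (0::'a)" by (metis of_nat_CHAR)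
    hence "(1::'a) + 1 = 0" by simp
    hence "(1::'a)\<^sup>2 = - 1" by (simp add: eq_neg_iff_add_eq_0)
    thus ?thesis by blast
  qed (rule sqrt_minus_one)
  then obtain i :: 'a where i: "i\<^sup>2 = - 1" by blast
  have H: "carrier ?H = Iq n" "mult ?H = mult ?G" "one ?H = one ?G" unfolding Iq_group_def by auto
  have gH: "comm_group ?H"
  proof -
    interpret H: group ?H
      unfolding Iq_group_def by (rule subgroup.subgroup_is_group[OF subgroup_Iq Iq1.group_axioms])
    show ?thesis
    proof (rule H.group_comm_groupI)
      fix x y assume "x \<in> carrier ?H" "y \<in> carrier ?H"
      thus "x \<otimes>\<^bsub>?H\<^esub> y = y \<otimes>\<^bsub>?H\<^esub> x"
        unfolding H using subgroup.mem_carrier[OF subgroup_Iq] Iq1.m_comm by blast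
    qed
  qed
  interpret H: comm_group ?H by (rule gH)
  have sqH: "x \<otimes>\<^bsub>?H\<^esub> x = \<one>\<^bsub>?H\<^esub>" if "x \<in> carrier ?H" for x
    using Iq1_square[OF i] subgroup.mem_carrier[OF subgroup_Iq] that unfolding H by blast
  have K: "subgroup ?K ?H"
    unfolding Iq_group_def by (rule Iq1.subgroup_incl[OF subgroup_Iq subgroup_Iq Iq_Suc_subset[OF n]])
  interpret K: normal ?K ?H by (rule H.subgroup_imp_normal[OF K])
  have gQ: "comm_group ?Q" unfolding Iq_quot_def by (rule H.abelian_FactGroup[OF K])
  interpret Q: comm_group ?Q by (rule gQ)
  have pr: "?pr \<in> hom ?H ?Q"
    using K.r_coset_hom_Mod unfolding Iq_quot_def Iq_proj_def by simp
  interpret pr: group_hom ?H ?Q ?pr by unfold_locales (rule pr)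
  have Qc: "carrier ?Q = ?pr ` carrier ?H"
    unfolding Iq_quot_def Iq_proj_def FactGroup_def RCOSETS_def by auto
  have sqQ: "x \<otimes>\<^bsub>?Q\<^esub> x = \<one>\<^bsub>?Q\<^esub>" if x: "x \<in> carrier ?Q" for x
  proof -
    obtain y where y: "y \<in> carrier ?H" "x = ?pr y" using x unfolding Qc by blast
    have "x \<otimes>\<^bsub>?Q\<^esub> x = ?pr (y \<otimes>\<^bsub>?H\<^esub> y)" using y by simp
    thus ?thesis using sqH[OF y(1)] by simp
  qed
  have PH: "?P \<subseteq> carrier ?H" unfolding H by (rule pfister_classes_Iq)
  have uniq: "f = g" if "f \<in> ?P" "g \<in> ?P" "?pr f = ?pr g" for f g
    using pfister_class_unique[OF i n that] .
  have inj: "inj_on ?pr ?P" using uniq by (intro inj_onI)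
  have oneP: "\<one>\<^bsub>?H\<^esub> \<in> ?P" unfolding H by (rule one_pfister_class[OF n])
  have rep: "pfister_representative n (?pr f) = f" if "f \<in> ?P" for f
    unfolding pfister_representative_def using that uniq by (intro the_equality) auto
  have "card (S - {\<one>\<^bsub>?H\<^esub>}) > 1" using more_than_one unfolding H .
  then obtain a b where ab: "a \<in> S" "b \<in> S" "a \<noteq> b" "a \<noteq> \<one>\<^bsub>?H\<^esub>" "b \<noteq> \<one>\<^bsub>?H\<^esub>"
    using card_le_Suc0_iff_eq[of "S - {\<one>\<^bsub>?H\<^esub>}"] fin by (auto simp: not_le[symmetric])
  have prod1: "finite (generated_mod n S)" "finprod ?Q (\<lambda>x. x) (generated_mod n S) = \<one>\<^bsub>?Q\<^esub>" if S: "S \<subseteq> ?P"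
  proof -
    \<comment> \<open>Uniqueness of representatives, also compared with the zero class, keeps the
      two forms distinct and nonzero in the quotient.\<close>
    have ab': "?pr a \<noteq> ?pr b" "?pr a \<noteq> \<one>\<^bsub>?Q\<^esub>" "?pr b \<noteq> \<one>\<^bsub>?Q\<^esub>"
      using ab S uniq[of a b] uniq[OF _ oneP, of a] uniq[OF _ oneP, of b] by auto
    have "?pr ` S \<subseteq> carrier ?Q" using S PH unfolding Qc by blast
    from Q.finprod_generate_trivial[OF sqQ finite_imageI[OF fin] this _ _ ab', OF _ imageI[OF ab(1)] imageI[OF ab(2)]]
    show "finite (generated_mod n S)" "finprod ?Q (\<lambda>x. x) (generated_mod n S) = \<one>\<^bsub>?Q\<^esub>"
      unfolding generated_mod_def by auto
  qed
  show ?thesis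
  proof (intro conjI impI)
    assume t: "tight n S"
    have S: "S \<subseteq> ?P" and ex: "\<And>c. c \<in> generated_mod n S \<Longrightarrow> \<exists>f\<in>?P. ?pr f = c"
      using t unfolding tight_def by auto
    have r: "pfister_representative n c \<in> ?P \<and> ?pr (pfister_representative n c) = c" if "c \<in> generated_mod n S" for c
      using ex[OF that] rep by auto
    have rH: "pfister_representative n \<in> generated_mod n S \<rightarrow> carrier ?H" using r PH by blast
    have "?pr (Sigma_inv n S) = finprod ?Q (\<lambda>c. ?pr (pfister_representative n c)) (generated_mod n S)"
      unfolding Sigma_inv_def by (rule hom_finprod[OF gH gQ pr rH])
    also have "\<dots> = finprod ?Q (\<lambda>c. c) (generated_mod n S)"
    proof (rule Q.finprod_cong')
      show "(\<lambda>c. c) \<in> generated_mod n S \<rightarrow> carrier ?Q"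
      proof
        fix c assume c: "c \<in> generated_mod n S"
        have "?pr (pfister_representative n c) \<in> carrier ?Q" by (rule pr.hom_closed[OF funcset_mem[OF rH c]])
        thus "c \<in> carrier ?Q" using r[OF c] by simp
      qed
    qed (use r in auto)
    also have "\<dots> = \<one>\<^bsub>?Q\<^esub>" by (rule prod1(2)[OF S])
    finally have "?K #>\<^bsub>?H\<^esub> Sigma_inv n S = ?K" unfolding Iq_proj_def Iq_quot_def FactGroup_def by simp
    moreover have "Sigma_inv n S \<in> carrier ?H" unfolding Sigma_inv_def using rH by (rule H.finprod_closed)
    ultimately have "Sigma_inv n S \<in> ?K" using H.coset_join1 K by blast
    thus "Sigma_inv n S \<in> Iq (n + 1)" by simp
  next
    assume t: "strongly_tight n S"
    have S: "S \<subseteq> ?P" and W: "generate ?H S \<subseteq> ?P" using t unfolding strongly_tight_def by auto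
    have SH: "S \<subseteq> carrier ?H" using S PH by blast
    \<comment> \<open>The subgroup generated by \<open>S\<close> consists of Pfister classes, on
      which the projection is injective, so the sum over the quotient can be taken over this
      subgroup instead.\<close>
    have V: "generated_mod n S = ?pr ` generate ?H S"
      unfolding generated_mod_def by (rule pr.generate_img[OF SH])
    have rW: "pfister_representative n (?pr f) = f" "f \<in> carrier ?H" if "f \<in> generate ?H S" for f
      using rep[OF subsetD[OF W that]] W PH that by blast+
    hence rH: "pfister_representative n \<in> ?pr ` generate ?H S \<rightarrow> carrier ?H" by (simp add: Pi_iff)
    have "Sigma_inv n S = finprod ?H (\<lambda>f. pfister_representative n (?pr f)) (generate ?H S)"
      unfolding Sigma_inv_def V by (rule H.finprod_reindex[OF rH inj_on_subset[OF inj W]])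
    also have "\<dots> = finprod ?H (\<lambda>f. f) (generate ?H S)"
      by (rule H.finprod_cong') (use rW in auto)
    also have "\<dots> = \<one>\<^bsub>?H\<^esub>" by (rule H.finprod_generate_trivial(2)[OF sqH fin SH ab])
    finally show "Sigma_inv n S = \<one>\<^bsub>?G\<^esub>" unfolding H .
  qed
qed

end
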